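(* Let $u$ be an almost minimizer for $J$ or $J^+$ in $\Omega$ (with constant $\kappa$ and exponent $\alpha$). For each choice of $\rho_0>0$ and $L\ge1$, there are constants $\eta_0>0$ and $r_1>0$, that depend only on $\rho_0$, $L$, $n$, $\alpha$, $\kappa$ and $\|q_\pm\|_\infty$, such that if $x\in\Gamma$ and $0<r\le r_1$ are such that $\overline B(x,r)\subset\Omega$, and if $u$ is $L$-Lipschitz on $B(x,r)$ and $q_+(y)\ge\rho_0$ for $y\in B(x,r)$, then $$u^+(y)\ge\frac{\eta_0\,\delta(y)}{4}\quad\text{for }y\in B(x,r/2).$$
   Context: Let $n\ge 2$, let $\Omega\subset\mathbb{R}^n$ be a domain (open set), let $q_+,q_-\in L^\infty(\Omega)$ be bounded real-valued functions, and let $\kappa\in(0,\infty)$, $\alpha\in(0,1]$. Set $K_{\mathrm{loc}}(\Omega)=\{u\in L^1_{\mathrm{loc}}(\Omega): \nabla u\in L^2(B(x,r))$ for every open ball $B(x,r)\subset\Omega\}$ and $K^+_{\mathrm{loc}}(\Omega)=\{u\in K_{\mathrm{loc}}(\Omega): u\ge 0$ a.e. on $\Omega\}$. Let $$J_{x,r}(v)=\int_{B(x,r)}|\nabla v|^2+q_+^2\,\chi_{\{v>0\}}+q_-^2\,\chi_{\{v<0\}},\qquad J^+_{x,r}(v)=\int_{B(x,r)}|\nabla v|^2+q_+^2\,\chi_{\{v>0\}}.$$ $u$ is an almost minimizer for $J$ in $\Omega$ (with constant $\kappa$ and exponent $\alpha$) if $u\in K_{\mathrm{loc}}(\Omega)$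 and $J_{x,r}(u)\le(1+\kappa r^\alpha)J_{x,r}(v)$ for every ball $B(x,r)\subset\Omega$ and every $v\in L^1(B(x,r))$ with $\nabla v\in L^2(B(x,r))$ and $v=u$ on $\partial B(x,r)$ (equality of traces). $u$ is an almost minimizer for $J^+$ in $\Omega$ if $u\in K^+_{\mathrm{loc}}(\Omega)$ and $J^+_{x,r}(u)\le(1+\kappa r^\alpha)J^+_{x,r}(v)$ for every ball with $\overline B(x,r)\subset\Omega$ and every such $v$. Almost minimizers agree a.e. with a continuous function and are identified with it. Notation: $u^+=\max(u,0)$; the free boundary is $\Gamma=\Omega\cap\partial\{x\in\Omega:u(x)>0\}$; $\delta(y)=\mathrm{dist}(y,\{z\in\Omega:u(z)=0\})$.
   Formalization: The bound is stated only for those y in B(x,r/2) with u(y) ≥ 0: where u(y) < 0 (possible only for J) it always fails, since u^+(y) = 0 while δ(y) > 0, e.g. for the minimizer u(y) = y_1 with q_+ = q_- = 1. *)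

theory Defs
  imports "HOL-Analysis.Analysis" "HOL-Probability.Essential_Supremum"
begin

subsection \<open>Weak gradients\<close>

definition partial_deriv :: "'n::finite \<Rightarrow> (real^'n \<Rightarrow> real) \<Rightarrow> real^'n \<Rightarrow> real" where
  "partial_deriv i f x = frechet_derivative f (at x) (axis i 1)"

definition grad :: "(real^'n::finite \<Rightarrow> real) \<Rightarrow> real^'n \<Rightarrow> real^'n" where
  "grad f x = (\<chi> i. partial_deriv i f x)"

primrec Ck :: "nat \<Rightarrow> (real^'n::finite \<Rightarrow> real) \<Rightarrow> bool" where
  "Ck 0 f \<longleftrightarrow> continuous_on UNIV f"
| "Ck (Suc k) f \<longleftrightarrow> (\<forall>x. f differentiable (at x)) \<and> (\<forall>i. Ck k (partial_deriv i f))"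

definition smooth :: "(real^'n::finite \<Rightarrow> real) \<Rightarrow> bool" where
  "smooth f \<longleftrightarrow> (\<forall>k. Ck k f)"

definition test_function :: "(real^'n::finite) set \<Rightarrow> (real^'n \<Rightarrow> real) \<Rightarrow> bool" where
  "test_function U \<phi> \<longleftrightarrow> smooth \<phi> \<and> compact (closure {x. \<phi> x \<noteq> 0}) \<and> closure {x. \<phi> x \<noteq> 0} \<subseteq> U"

definition L1_loc :: "(real^'n::finite) set \<Rightarrow> (real^'n \<Rightarrow> 'b::euclidean_space) \<Rightarrow> bool" where
  "L1_loc U f \<longleftrightarrow> (\<forall>K. compact K \<and> K \<subseteq> U \<longrightarrow> f absolutely_integrable_on K)"

definition L2_on :: "(real^'n::finite) set \<Rightarrow> (real^'n \<Rightarrow> 'b::euclidean_space) \<Rightarrow> bool" where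
  "L2_on S f \<longleftrightarrow> f \<in> borel_measurable (lebesgue_on S) \<and>
     (\<lambda>y. (norm (f y))\<^sup>2) absolutely_integrable_on S"

definition has_weak_gradient ::
    "(real^'n::finite) set \<Rightarrow> (real^'n \<Rightarrow> real) \<Rightarrow> (real^'n \<Rightarrow> real^'n) \<Rightarrow> bool" where
  "has_weak_gradient U u G \<longleftrightarrow> L1_loc U u \<and> L1_loc U G \<and>
     (\<forall>\<phi> i. test_function U \<phi> \<longrightarrow>
        (LINT y:U|lebesgue. u y * partial_deriv i \<phi> y) = - (LINT y:U|lebesgue. G y $ i * \<phi> y))"

(* A choice of representative: weak gradients are unique up to null subsets of U. *)
definition weak_grad :: "(real^'n::finite) set \<Rightarrow> (real^'n \<Rightarrow> real) \<Rightarrow> real^'n \<Rightarrow> real^'n" where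
  "weak_grad U u = (SOME G. has_weak_gradient U u G)"

definition K_loc :: "(real^'n::finite) set \<Rightarrow> (real^'n \<Rightarrow> real) \<Rightarrow> bool" where
  "K_loc \<Omega> u \<longleftrightarrow> L1_loc \<Omega> u \<and>
     (\<exists>G. has_weak_gradient \<Omega> u G \<and> (\<forall>x r. 0 < r \<and> ball x r \<subseteq> \<Omega> \<longrightarrow> L2_on (ball x r) G))"

definition K_loc_plus :: "(real^'n::finite) set \<Rightarrow> (real^'n \<Rightarrow> real) \<Rightarrow> bool" where
  "K_loc_plus \<Omega> u \<longleftrightarrow> K_loc \<Omega> u \<and> (AE x in lebesgue_on \<Omega>. 0 \<le> u x)"

subsection \<open>Traces on spheres\<close>

(* Surface measure on the sphere of radius r about x, for r > 0.  The cone with vertex x over a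
   piece A of the sphere has volume (r / n) * area A, so the surface measure is n / r times
   the image of Lebesgue measure on the ball under radial projection from x. *)
definition sphere_measure :: "real^'n::finite \<Rightarrow> real \<Rightarrow> (real^'n) measure" where
  "sphere_measure x r = scale_measure (ennreal (real CARD('n) / r))
     (distr (restrict_space lborel (ball x r)) borel
        (\<lambda>y. x + (r / norm (y - x)) *\<^sub>R (y - x)))"

(* The trace operator is the continuous extension of restriction to the sphere: g is the trace
   of w if some functions smooth up to the boundary converge to w in the ball, with gradients
   converging in L2, while their boundary values converge to g in L1 of the sphere. *)
definition has_trace ::
    "real^'n::finite \<Rightarrow> real \<Rightarrow> (real^'n \<Rightarrow> real) \<Rightarrow> (real^'n \<Rightarrow> real) \<Rightarrow> bool" where
  "has_trace x r w g \<longleftrightarrow> integrable (sphere_measure x r) g \<and>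
     (\<exists>\<phi> :: nat \<Rightarrow> real^'n \<Rightarrow> real. (\<forall>k. smooth (\<phi> k)) \<and>
        (\<lambda>k. \<integral>\<^sup>+y\<in>ball x r. ennreal \<bar>\<phi> k y - w y\<bar> \<partial>lebesgue) \<longlonglongrightarrow> 0 \<and>
        (\<lambda>k. \<integral>\<^sup>+y\<in>ball x r. ennreal ((norm (grad (\<phi> k) y - weak_grad (ball x r) w y))\<^sup>2) \<partial>lebesgue)
          \<longlonglongrightarrow> 0 \<and>
        (\<lambda>k. \<integral>\<^sup>+z. ennreal \<bar>\<phi> k z - g z\<bar> \<partial>sphere_measure x r) \<longlonglongrightarrow> 0)"

definition same_trace ::
    "real^'n::finite \<Rightarrow> real \<Rightarrow> (real^'n \<Rightarrow> real) \<Rightarrow> (real^'n \<Rightarrow> real) \<Rightarrow> bool" where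
  "same_trace x r u v \<longleftrightarrow> (\<exists>g. has_trace x r u g \<and> has_trace x r v g)"

subsection \<open>The functionals and their almost minimizers\<close>

definition J_fun :: "(real^'n::finite \<Rightarrow> real) \<Rightarrow> (real^'n \<Rightarrow> real) \<Rightarrow> real^'n \<Rightarrow> real
    \<Rightarrow> (real^'n \<Rightarrow> real) \<Rightarrow> ennreal" where
  "J_fun qp qm x r v = (\<integral>\<^sup>+y\<in>ball x r. ennreal ((norm (weak_grad (ball x r) v y))\<^sup>2
      + (qp y)\<^sup>2 * indicator {z. v z > 0} y + (qm y)\<^sup>2 * indicator {z. v z < 0} y) \<partial>lebesgue)"

definition J_plus_fun :: "(real^'n::finite \<Rightarrow> real) \<Rightarrow> real^'n \<Rightarrow> real
    \<Rightarrow> (real^'n \<Rightarrow> real) \<Rightarrow> ennreal" where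
  "J_plus_fun qp x r v = (\<integral>\<^sup>+y\<in>ball x r. ennreal ((norm (weak_grad (ball x r) v y))\<^sup>2
      + (qp y)\<^sup>2 * indicator {z. v z > 0} y) \<partial>lebesgue)"

definition competitor ::
    "real^'n::finite \<Rightarrow> real \<Rightarrow> (real^'n \<Rightarrow> real) \<Rightarrow> (real^'n \<Rightarrow> real) \<Rightarrow> bool" where
  "competitor x r u v \<longleftrightarrow> v absolutely_integrable_on ball x r \<and>
     (\<exists>G. has_weak_gradient (ball x r) v G \<and> L2_on (ball x r) G) \<and> same_trace x r u v"

definition almost_minimizer_J :: "(real^'n::finite) set \<Rightarrow> (real^'n \<Rightarrow> real) \<Rightarrow> (real^'n \<Rightarrow> real)
    \<Rightarrow> real \<Rightarrow> real \<Rightarrow> (real^'n \<Rightarrow> real) \<Rightarrow> bool" where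
  "almost_minimizer_J \<Omega> qp qm \<kappa> \<alpha> u \<longleftrightarrow> K_loc \<Omega> u \<and>
     (\<forall>x r v. 0 < r \<and> ball x r \<subseteq> \<Omega> \<and> competitor x r u v \<longrightarrow>
        J_fun qp qm x r u \<le> ennreal (1 + \<kappa> * r powr \<alpha>) * J_fun qp qm x r v)"

definition almost_minimizer_J_plus :: "(real^'n::finite) set \<Rightarrow> (real^'n \<Rightarrow> real)
    \<Rightarrow> real \<Rightarrow> real \<Rightarrow> (real^'n \<Rightarrow> real) \<Rightarrow> bool" where
  "almost_minimizer_J_plus \<Omega> qp \<kappa> \<alpha> u \<longleftrightarrow> K_loc_plus \<Omega> u \<and>
     (\<forall>x r v. 0 < r \<and> cball x r \<subseteq> \<Omega> \<and> competitor x r u v \<longrightarrow>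
        J_plus_fun qp x r u \<le> ennreal (1 + \<kappa> * r powr \<alpha>) * J_plus_fun qp x r v)"

subsection \<open>Bounded data and the free boundary\<close>

definition Linf_norm :: "(real^'n::finite) set \<Rightarrow> (real^'n \<Rightarrow> real) \<Rightarrow> ennreal" where
  "Linf_norm \<Omega> q = esssup (lebesgue_on \<Omega>) (\<lambda>x. ennreal \<bar>q x\<bar>)"

definition free_boundary :: "(real^'n::finite) set \<Rightarrow> (real^'n \<Rightarrow> real) \<Rightarrow> (real^'n) set" where
  "free_boundary \<Omega> u = \<Omega> \<inter> frontier {x \<in> \<Omega>. u x > 0}"

definition zero_dist :: "(real^'n::finite) set \<Rightarrow> (real^'n \<Rightarrow> real) \<Rightarrow> real^'n \<Rightarrow> real" where
  "zero_dist \<Omega> u y = infdist y {z \<in> \<Omega>. u z = 0}"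

end

theory Submission
  imports Defs
begin

text \<open>
  If \<open>u\<close> is small at a point \<open>y\<close> compared with \<open>d = \<delta>(y)\<close>, then \<open>u > 0\<close> on \<open>B(y, d)\<close>, and two competitors
  lead to a contradiction. Raising \<open>u\<close> by a test function \<open>\<Phi> \<ge> 0\<close> does not change its positivity set, so \<open>u\<close>
  is almost superharmonic. Let \<open>\<Phi>\<close> be a smooth truncation of \<open>(|x|\<^sup>2 + a) powr (-\<sigma>)\<close>, \<open>2 \<sigma> = n - 2 + 1/2\<close>,
  which is subharmonic off a core of radius \<open>O(a powr (1/2))\<close> and whose negative Laplacian in the core has mass
  \<open>O(a powr (-1/4))\<close>. In the core \<open>u \<le> u(y) + O(L a powr (1/2) d)\<close>, so the average of \<open>u\<close> over an annulus of
  size \<open>d\<close> is small. Multiplying \<open>u\<close> by a cutoff that vanishes on \<open>B(y, d/4)\<close> then costs little Dirichlet energy,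
  but saves at least \<open>\<rho>\<^sub>0\<^sup>2 |B(y, d/4)|\<close>. The Lipschitz bound controls \<open>J(u)\<close>, hence the error caused by the factor
  \<open>1 + \<kappa> d powr \<alpha>\<close>.

  Both competitors are \<open>(1 - \<Psi>) u + \<Phi>\<close> with test functions \<open>\<Psi>, \<Phi>\<close>. Mollification of a Lipschitz extension of \<open>u\<close>
  shows that they have the trace of \<open>u\<close>, that weak gradients are unique, and that \<open>|\<nabla>u| \<le> L\<close> a.e.
\<close>

section \<open>Smooth functions and test functions\<close>

text \<open>Harmonic replacement and mean values are avoided: every competitor is an explicit smooth
  modification of \<open>u\<close>, so traces and weak gradients can be checked from their
  definitions, and an explicit profile takes the role of the mean value inequality. With the
  Newtonian exponent 2 \<sigma> = n - 2 that profile would have no positive Laplacian on the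
  annulus; the extra 1/2 supplies one, and keeps \<sigma> > 0 for n = 2, so that no logarithm is
  required. Its price is a core mass that diverges as the core shrinks, and the Lipschitz bound pays
  for it, because \<open>u\<close> on the core decreases faster than the mass grows. This dictates
  the order of the choices: \<open>a\<close> first, then the bound \<eta> on u(y)/d, then the size
  \<open>t\<close> of the perturbation, and last the radius, which makes the relative error \<kappa>
  d powr \<alpha> negligible against \<open>t\<close>. The two competitors are linked by one
  annulus: the Laplacian of the first test function is bounded below exactly where the cutoff of the
  second has its gradient.\<close>

lemma partial_deriv_eqI:
  assumes "(f has_derivative f') (at x)"
  shows "partial_deriv i f x = f' (axis i 1)"
  unfolding partial_deriv_def using frechet_derivative_at[OF assms] by simp

lemma partial_deriv_has_derivative:
  fixes f :: "real^'n::finite \<Rightarrow> real"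
  assumes "f differentiable (at x)"
  shows "(f has_derivative (\<lambda>h. \<Sum>i\<in>UNIV. h $ i * partial_deriv i f x)) (at x)"
proof -
  let ?D = "frechet_derivative f (at x)"
  have D: "(f has_derivative ?D) (at x)" using assms frechet_derivative_works by blast
  then interpret linear ?D by (rule has_derivative_linear)
  have "?D h = (\<Sum>i\<in>UNIV. h $ i * partial_deriv i f x)" for h
  proof -
    have "?D h = ?D (\<Sum>i\<in>UNIV. (h $ i) *\<^sub>R axis i 1)"
      by (simp add: basis_expansion flip: scalar_mult_eq_scaleR)
    then show ?thesis by (simp add: sum scaleR partial_deriv_def)
  qed
  then have "?D = (\<lambda>h. \<Sum>i\<in>UNIV. h $ i * partial_deriv i f x)" by auto
  with D show ?thesis by metis
qed

lemma grad_inner: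
  fixes f :: "real^'n::finite \<Rightarrow> real"
  assumes "f differentiable (at x)"
  shows "(f has_derivative (\<lambda>h. grad f x \<bullet> h)) (at x)"
  using partial_deriv_has_derivative[OF assms]
  by (simp add: grad_def inner_vec_def mult.commute)

lemma Ck_differentiable: "Ck (Suc k) f \<Longrightarrow> f differentiable (at x)"
  by simp

text \<open>The product rule leaves one factor undifferentiated, so an induction on the order of a
  product has to lower the order of the factors.\<close>

lemma Ck_Suc_imp_Ck: "Ck (Suc k) f \<Longrightarrow> Ck k f"
proof (induction k arbitrary: f)
  case 0
  then show ?case
    by (auto simp: continuous_on_eq_continuous_at differentiable_imp_continuous_within)
next
  case (Suc k)
  then show ?case by (metis Ck.simps(2))
qed

lemma Ck_SucI:
  assumes "\<And>x. (f has_derivative f' x) (at x)" "\<And>i. Ck k (\<lambda>x. f' x (axis i 1))"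
  shows "Ck (Suc k) f"
proof -
  have "partial_deriv i f = (\<lambda>x. f' x (axis i 1))" for i
    using partial_deriv_eqI[OF assms(1)] by auto
  then show ?thesis using assms by (auto simp: differentiable_def)
qed

lemma Ck_const: "Ck k (\<lambda>x. c)"
proof (induction k arbitrary: c)
  case (Suc k)
  show ?case by (rule Ck_SucI[where f' = "\<lambda>_ _. 0"]) (use Suc in auto)
qed simp

lemma Ck_add: "Ck k f \<Longrightarrow> Ck k g \<Longrightarrow> Ck k (\<lambda>x. f x + g x)"
proof (induction k arbitrary: f g)
  case (Suc k)
  have "((\<lambda>x. f x + g x) has_derivative
      (\<lambda>h. frechet_derivative f (at x) h + frechet_derivative g (at x) h)) (at x)" for x
    using Suc.prems by (intro has_derivative_add) (auto simp flip: frechet_derivative_works)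
  then show ?case
    by (rule Ck_SucI) (use Suc in \<open>auto simp flip: partial_deriv_def\<close>)
qed (auto intro: continuous_intros)

lemma Ck_mult: "Ck k f \<Longrightarrow> Ck k g \<Longrightarrow> Ck k (\<lambda>x. f x * g x)"
proof (induction k arbitrary: f g)
  case (Suc k)
  have "((\<lambda>x. f x * g x) has_derivative
      (\<lambda>h. f x * frechet_derivative g (at x) h + frechet_derivative f (at x) h * g x)) (at x)" for x
    using Suc.prems by (intro has_derivative_mult) (auto simp flip: frechet_derivative_works)
  then show ?case
    by (rule Ck_SucI)
      (use Suc Ck_Suc_imp_Ck[OF Suc.prems(1)] Ck_Suc_imp_Ck[OF Suc.prems(2)] in
        \<open>auto simp flip: partial_deriv_def intro!: Ck_add\<close>)
qed (auto intro: continuous_intros)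

lemma Ck_sum: "(\<And>i. i \<in> I \<Longrightarrow> Ck k (f i)) \<Longrightarrow> Ck k (\<lambda>x. \<Sum>i\<in>I. f i x)"
  by (induction I rule: infinite_finite_induct) (auto intro: Ck_const Ck_add)

lemma Ck_component:
  fixes i :: "'n::finite"
  shows "Ck k (\<lambda>x. x $ i - c)"
proof (cases k)
  case (Suc m)
  have "((\<lambda>x. x $ i - c) has_derivative (\<lambda>h. h $ i)) (at x)" for x
    by (rule has_derivative_diff[OF bounded_linear_imp_has_derivative[OF bounded_linear_vec_nth]
          has_derivative_const, simplified])
  then show ?thesis unfolding Suc by (rule Ck_SucI) (auto intro: Ck_const)
qed (auto intro!: continuous_intros)

lemma smooth_const: "smooth (\<lambda>x. c)"
  and smooth_add: "smooth f \<Longrightarrow> smooth g \<Longrightarrow> smooth (\<lambda>x. f x + g x)"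
  and smooth_mult: "smooth f \<Longrightarrow> smooth g \<Longrightarrow> smooth (\<lambda>x. f x * g x)"
  by (auto simp: smooth_def Ck_const Ck_add Ck_mult)

lemma smooth_differentiable: "smooth f \<Longrightarrow> f differentiable (at x)"
  unfolding smooth_def using Ck_differentiable by blast

lemma smooth_partial_deriv: "smooth f \<Longrightarrow> smooth (partial_deriv i f)"
  unfolding smooth_def by (metis Ck.simps(2))

lemma smooth_continuous_on: "smooth f \<Longrightarrow> continuous_on S f"
  unfolding smooth_def by (metis Ck.simps(1) continuous_on_subset top_greatest)

lemma continuous_on_grad: "smooth f \<Longrightarrow> continuous_on S (grad f)"
  unfolding grad_def by (intro continuous_on_vec_lambda smooth_continuous_on smooth_partial_deriv)

lemma partial_deriv_add:
  assumes "f differentiable (at x)" "g differentiable (at x)"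
  shows "partial_deriv i (\<lambda>x. f x + g x) x = partial_deriv i f x + partial_deriv i g x"
  unfolding partial_deriv_def using assms
  by (subst partial_deriv_eqI[unfolded partial_deriv_def, OF has_derivative_add])
     (auto simp flip: frechet_derivative_works)

lemma partial_deriv_mult:
  assumes "f differentiable (at x)" "g differentiable (at x)"
  shows "partial_deriv i (\<lambda>x. f x * g x) x = f x * partial_deriv i g x + partial_deriv i f x * g x"
  unfolding partial_deriv_def using assms
  by (subst partial_deriv_eqI[unfolded partial_deriv_def, OF has_derivative_mult])
     (auto simp flip: frechet_derivative_works)

lemma partial_deriv_const: "partial_deriv i (\<lambda>x. c) x = 0"
  by (rule partial_deriv_eqI[where f' = "\<lambda>_. 0", simplified]) simp

lemma grad_add:
  assumes "f differentiable (at x)" "g differentiable (at x)"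
  shows "grad (\<lambda>x. f x + g x) x = grad f x + grad g x"
  using assms by (simp add: grad_def vec_eq_iff partial_deriv_add)

lemma grad_mult:
  assumes "f differentiable (at x)" "g differentiable (at x)"
  shows "grad (\<lambda>x. f x * g x) x = f x *\<^sub>R grad g x + g x *\<^sub>R grad f x"
  using assms by (simp add: grad_def vec_eq_iff partial_deriv_mult)

lemma grad_const: "grad (\<lambda>x. c) x = 0"
  by (simp add: grad_def vec_eq_iff partial_deriv_const)

lemma partial_deriv_zero_outside:
  assumes "x \<notin> closure {x. f x \<noteq> 0}"
  shows "partial_deriv i f x = 0"
proof -
  have "(f has_derivative (\<lambda>_. 0)) (at x)"
  proof (rule has_derivative_transform_within_open[where s = "- closure {x. f x \<noteq> 0}"])
    show "((\<lambda>_. 0) has_derivative (\<lambda>_. 0)) (at x)" by simp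
  qed (use assms closure_subset[of "{x. f x \<noteq> 0}"] in auto)
  then show ?thesis by (rule partial_deriv_eqI)
qed

lemma test_function_eq_0: "test_function U \<phi> \<Longrightarrow> x \<notin> U \<Longrightarrow> \<phi> x = 0"
  using closure_subset[of "{x. \<phi> x \<noteq> 0}"] by (auto simp: test_function_def)

lemma test_function_smooth: "test_function U \<phi> \<Longrightarrow> smooth \<phi>"
  by (simp add: test_function_def)

text \<open>A closed subset of a compact support is compact; derivatives and smooth multiples of
  test functions are both handled through this.\<close>

lemma test_function_smaller_support:
  assumes "test_function U \<phi>" "smooth \<psi>" "\<And>x. x \<notin> closure {x. \<phi> x \<noteq> 0} \<Longrightarrow> \<psi> x = 0"
  shows "test_function U \<psi>"
proof -
  have "closure {x. \<psi> x \<noteq> 0} \<subseteq> closure {x. \<phi> x \<noteq> 0}"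
    by (rule closure_minimal) (use assms in auto)
  moreover have "compact (closure {x. \<phi> x \<noteq> 0} \<inter> closure {x. \<psi> x \<noteq> 0})"
    using assms(1) by (intro compact_Int_closed) (auto simp: test_function_def)
  ultimately show ?thesis using assms unfolding test_function_def
    by (auto simp: Int_absorb1)
qed

lemma test_function_partial_deriv:
  "test_function U \<phi> \<Longrightarrow> test_function U (partial_deriv i \<phi>)"
  by (rule test_function_smaller_support)
     (auto simp: test_function_def smooth_partial_deriv partial_deriv_zero_outside)

lemma test_function_mult:
  "test_function U \<phi> \<Longrightarrow> smooth \<psi> \<Longrightarrow> test_function U (\<lambda>x. \<psi> x * \<phi> x)"
  by (rule test_function_smaller_support)
     (use closure_subset[of "{x. \<phi> x \<noteq> 0}"] in \<open>auto simp: test_function_def intro: smooth_mult\<close>)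

lemma test_function_cmult:
  "test_function U \<phi> \<Longrightarrow> test_function U (\<lambda>x. c * \<phi> x)"
  by (rule test_function_mult[OF _ smooth_const])

lemma test_function_mono: "test_function U \<phi> \<Longrightarrow> U \<subseteq> V \<Longrightarrow> test_function V \<phi>"
  by (auto simp: test_function_def)

lemma test_function_partial_deriv_eq_0: "test_function U \<phi> \<Longrightarrow> x \<notin> U \<Longrightarrow> partial_deriv i \<phi> x = 0"
  using test_function_partial_deriv test_function_eq_0 by blast

lemma continuous_on_bounded_outside_compact:
  fixes f :: "'a::topological_space \<Rightarrow> 'b::real_normed_vector"
  assumes "continuous_on UNIV f" "compact K" "\<And>x. x \<notin> K \<Longrightarrow> f x = 0"
  obtains C where "0 < C" "\<And>x. norm (f x) \<le> C"
proof -
  have "bounded (f ` K)"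
    using assms by (intro compact_imp_bounded compact_continuous_image) (auto intro: continuous_on_subset)
  then obtain C where "0 < C" "\<And>x. x \<in> K \<Longrightarrow> norm (f x) \<le> C"
    by (auto simp: bounded_pos)
  moreover have "norm (f x) \<le> C" if "x \<notin> K" for x
    using assms(3)[OF that] \<open>0 < C\<close> by simp
  ultimately show thesis using that by blast
qed

lemma test_function_bounded:
  assumes "test_function U \<phi>"
  obtains C where "0 < C" "\<And>x. \<bar>\<phi> x\<bar> \<le> C"
proof (rule continuous_on_bounded_outside_compact)
  show "continuous_on UNIV \<phi>" "compact (closure {x. \<phi> x \<noteq> 0})"
    using assms by (auto simp: test_function_def smooth_continuous_on)
  show "\<phi> x = 0" if "x \<notin> closure {x. \<phi> x \<noteq> 0}" for x
    using that closure_subset[of "{x. \<phi> x \<noteq> 0}"] by auto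
qed auto

lemma test_function_grad_bounded:
  assumes "test_function U \<phi>"
  obtains C where "0 < C" "\<And>x. norm (grad \<phi> x) \<le> C"
proof (rule continuous_on_bounded_outside_compact)
  show "continuous_on UNIV (grad \<phi>)" "compact (closure {x. \<phi> x \<noteq> 0})"
    using assms by (auto simp: test_function_def continuous_on_grad)
  show "grad \<phi> x = 0" if "x \<notin> closure {x. \<phi> x \<noteq> 0}" for x
    using partial_deriv_zero_outside[OF that] by (simp add: grad_def vec_eq_iff)
qed auto

section \<open>Smooth functions of one real variable and their composition with smooth
  functions\<close>

text \<open>The set \<open>S\<close> is carried along because powers are smooth only on the positive
  axis. Derivatives are two-sided at every point of \<open>S\<close>. The derivative is quantified
  existentially, since its values outside \<open>S\<close> are arbitrary.\<close>

primrec Ck_real :: "nat \<Rightarrow> real set \<Rightarrow> (real \<Rightarrow> real) \<Rightarrow> bool" where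
  "Ck_real 0 S f \<longleftrightarrow> continuous_on S f"
| "Ck_real (Suc k) S f \<longleftrightarrow>
     (\<exists>f'. (\<forall>x\<in>S. (f has_real_derivative f' x) (at x)) \<and> Ck_real k S f')"

lemma Ck_real_SucI:
  "(\<And>x. x \<in> S \<Longrightarrow> (f has_real_derivative f' x) (at x)) \<Longrightarrow> Ck_real k S f' \<Longrightarrow> Ck_real (Suc k) S f"
  by auto

lemma Ck_real_SucE:
  assumes "Ck_real (Suc k) S f"
  obtains f' where "\<And>x. x \<in> S \<Longrightarrow> (f has_real_derivative f' x) (at x)" "Ck_real k S f'"
  using assms by auto

lemma Ck_real_Suc_imp: "Ck_real (Suc k) S f \<Longrightarrow> Ck_real k S f"
proof (induction k arbitrary: f)
  case 0
  then show ?case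
    by (auto intro!: continuous_at_imp_continuous_on intro: DERIV_isCont)
next
  case (Suc k)
  then show ?case by (metis Ck_real.simps(2))
qed

lemma Ck_real_const: "Ck_real k S (\<lambda>x. c)"
proof (induction k arbitrary: c)
  case (Suc k)
  show ?case by (rule Ck_real_SucI[where f' = "\<lambda>_. 0"]) (use Suc in auto)
qed auto

lemma Ck_real_ident: "Ck_real k S (\<lambda>x. x)"
proof (cases k)
  case (Suc k)
  show ?thesis unfolding Suc
    by (rule Ck_real_SucI[where f' = "\<lambda>_. 1"]) (use Ck_real_const in auto)
qed auto

lemma Ck_real_add: "Ck_real k S f \<Longrightarrow> Ck_real k S g \<Longrightarrow> Ck_real k S (\<lambda>x. f x + g x)"
proof (induction k arbitrary: f g)
  case (Suc k)
  obtain f' g' where *: "\<And>x. x \<in> S \<Longrightarrow> (f has_real_derivative f' x) (at x)"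
    "\<And>x. x \<in> S \<Longrightarrow> (g has_real_derivative g' x) (at x)" "Ck_real k S f'" "Ck_real k S g'"
    using Suc.prems(1,2) by (elim Ck_real_SucE) blast
  show ?case
    by (rule Ck_real_SucI[where f' = "\<lambda>x. f' x + g' x"]) (use * Suc.IH in \<open>auto intro: DERIV_add\<close>)
qed (auto intro: continuous_intros)

lemma Ck_real_mult: "Ck_real k S f \<Longrightarrow> Ck_real k S g \<Longrightarrow> Ck_real k S (\<lambda>x. f x * g x)"
proof (induction k arbitrary: f g)
  case (Suc k)
  obtain f' g' where *: "\<And>x. x \<in> S \<Longrightarrow> (f has_real_derivative f' x) (at x)"
    "\<And>x. x \<in> S \<Longrightarrow> (g has_real_derivative g' x) (at x)" "Ck_real k S f'" "Ck_real k S g'"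
    using Suc.prems(1,2) by (elim Ck_real_SucE) blast
  show ?case
    by (rule Ck_real_SucI[where f' = "\<lambda>x. f' x * g x + g' x * f x"])
       (use * Suc.IH Suc.prems[THEN Ck_real_Suc_imp] in \<open>auto intro!: DERIV_mult Ck_real_add\<close>)
qed (auto intro: continuous_intros)

lemma Ck_real_compose:
  "Ck_real k T f \<Longrightarrow> Ck_real k S g \<Longrightarrow> g ` S \<subseteq> T \<Longrightarrow> Ck_real k S (\<lambda>x. f (g x))"
proof (induction k arbitrary: f)
  case (Suc k)
  obtain f' g' where *: "\<And>x. x \<in> T \<Longrightarrow> (f has_real_derivative f' x) (at x)"
    "\<And>x. x \<in> S \<Longrightarrow> (g has_real_derivative g' x) (at x)" "Ck_real k T f'" "Ck_real k S g'"
    using Suc.prems(1,2) by (elim Ck_real_SucE) blast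
  show ?case
  proof (rule Ck_real_SucI[where f' = "\<lambda>x. f' (g x) * g' x"])
    show "((\<lambda>x. f (g x)) has_real_derivative f' (g x) * g' x) (at x)" if "x \<in> S" for x
      by (rule DERIV_chain2) (use * that Suc.prems in auto)
    have "Ck_real k S (\<lambda>x. f' (g x))"
      by (rule Suc.IH[OF *(3) Ck_real_Suc_imp[OF Suc.prems(2)] Suc.prems(3)])
    then show "Ck_real k S (\<lambda>x. f' (g x) * g' x)" using * by (intro Ck_real_mult)
  qed
qed (simp add: continuous_on_compose2[where f = g])

lemma Ck_real_powr: "Ck_real k {0<..} (\<lambda>x. x powr p)"
proof (induction k arbitrary: p)
  case (Suc k)
  show ?case
  proof (rule Ck_real_SucI[where f' = "\<lambda>x. p * x powr (p - 1)"])
    show "((\<lambda>x. x powr p) has_real_derivative p * x powr (p - 1)) (at x)" if "x \<in> {0<..}" for x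
      using that has_real_derivative_powr by simp
  qed (intro Ck_real_mult Ck_real_const Suc)
qed (simp add: continuous_on_powr)

lemma Ck_compose_real:
  fixes g :: "real^'n::finite \<Rightarrow> real"
  assumes "Ck_real k S f" "Ck k g" "range g \<subseteq> S"
  shows "Ck k (\<lambda>x. f (g x))"
  using assms
proof (induction k arbitrary: f)
  case (Suc k)
  obtain f' where *: "\<And>x. x \<in> S \<Longrightarrow> (f has_real_derivative f' x) (at x)" "Ck_real k S f'"
    using Suc.prems(1) by (elim Ck_real_SucE) blast
  show ?case
  proof (rule Ck_SucI[where f' = "\<lambda>x h. f' (g x) * frechet_derivative g (at x) h"])
    show "((\<lambda>x. f (g x)) has_derivative (\<lambda>h. f' (g x) * frechet_derivative g (at x) h)) (at x)" for x
    proof -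
      have "(g has_derivative frechet_derivative g (at x)) (at x)"
        using Suc.prems by (auto simp flip: frechet_derivative_works)
      moreover have "(f has_derivative (*) (f' (g x))) (at (g x))"
        using *(1)[of "g x"] Suc.prems(3) unfolding has_field_derivative_def by blast
      ultimately show ?thesis
        using has_derivative_compose[of g _ x UNIV f] by auto
    qed
    have "Ck k (\<lambda>x. f' (g x))"
      by (rule Suc.IH[OF *(2) Ck_Suc_imp_Ck[OF Suc.prems(2)] Suc.prems(3)])
    then show "Ck k (\<lambda>x. f' (g x) * frechet_derivative g (at x) (axis i 1))" for i
      using Suc.prems by (auto intro!: Ck_mult simp flip: partial_deriv_def)
  qed
qed (simp add: continuous_on_compose2[where f = g])

text \<open>The derivatives of \<open>exp (-1/t)\<close> are linear combinations of the functions below.\<close>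

definition flat :: "nat \<Rightarrow> real \<Rightarrow> real" where
  "flat m t = (if 0 < t then (1 / t) ^ m * exp (- (1 / t)) else 0)"

lemma flat_nonneg: "0 \<le> flat m t"
  by (simp add: flat_def)

text \<open>From the right, the substitution x = 1/t turns the claim into the decay of x^m / exp x
  at infinity.\<close>

lemma flat_tendsto_0: "(flat m \<longlongrightarrow> 0) (at 0)"
proof (rule filterlim_split_at)
  show "(flat m \<longlongrightarrow> 0) (at_left 0)"
    by (rule tendsto_eventually) (auto simp: flat_def eventually_at_filter)
  have "((\<lambda>x. x ^ m / exp x) \<longlongrightarrow> 0) (at_top :: real filter)"
    by (rule tendsto_power_div_exp_0)
  then have "((\<lambda>t. (inverse t) ^ m / exp (inverse t)) \<longlongrightarrow> 0) (at_right (0::real))"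
    by (rule filterlim_compose[OF _ filterlim_inverse_at_top_right])
  then show "(flat m \<longlongrightarrow> 0) (at_right 0)"
    by (rule filterlim_cong[THEN iffD1, rotated -1])
       (auto simp: flat_def eventually_at_filter exp_minus field_simps)
qed

text \<open>The derivative stays in the linear span of the family, which is what makes the induction
  in \<open>Ck_real_flat\<close> close. At 0 the difference quotient of \<open>flat m\<close> is
  \<open>flat (Suc m)\<close>, so its limit is already known.\<close>

lemma flat_has_derivative:
  "(flat m has_real_derivative flat (m + 2) t - real m * flat (m + 1) t) (at t)"
proof -
  consider "t < 0" | "t = 0" | "0 < t" by linarith
  then show ?thesis
  proof cases
    case 1
    have "((\<lambda>_. 0) has_real_derivative 0) (at t)" by simp
    then have "(flat m has_real_derivative 0) (at t)"
      by (rule has_field_derivative_transform_within_open[where S = "{..<0}"])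
         (use 1 in \<open>auto simp: flat_def\<close>)
    then show ?thesis using 1 by (simp add: flat_def)
  next
    case 2
    have "(flat m has_real_derivative 0) (at 0)"
      unfolding has_field_derivative_iff
    proof (rule filterlim_cong[THEN iffD1, rotated -1])
      show "(flat (Suc m) \<longlongrightarrow> 0) (at 0)" by (rule flat_tendsto_0)
    qed (auto simp: flat_def eventually_at_filter)
    then show ?thesis using 2 by (simp add: flat_def)
  next
    case 3
    have inv: "((\<lambda>t. 1 / t) has_real_derivative - (1 / t)\<^sup>2) (at t)"
      using 3 by (auto intro!: derivative_eq_intros simp: field_simps power2_eq_square)
    \<comment> \<open>For \<open>m = 0\<close> the exponent \<open>m - 1\<close> is truncated to 0,
      but its coefficient \<open>real m\<close> vanishes as well.\<close>
    have "((\<lambda>t. (1 / t) ^ m * exp (- (1 / t))) has_real_derivative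
        (real m * (1 / t) ^ (m - 1) * - (1 / t)\<^sup>2 * exp (- (1 / t)) +
         exp (- (1 / t)) * (1 / t)\<^sup>2 * (1 / t) ^ m)) (at t)"
      by (rule inv DERIV_mult derivative_eq_intros refl | simp)+
    also have "real m * (1 / t) ^ (m - 1) * - (1 / t)\<^sup>2 * exp (- (1 / t)) +
         exp (- (1 / t)) * (1 / t)\<^sup>2 * (1 / t) ^ m = flat (m + 2) t - real m * flat (m + 1) t"
      using 3 by (cases m) (auto simp: flat_def power2_eq_square algebra_simps add_divide_distrib)
    finally have "((\<lambda>t. (1 / t) ^ m * exp (- (1 / t))) has_real_derivative
        (flat (m + 2) t - real m * flat (m + 1) t)) (at t)" .
    then show ?thesis
      by (rule has_field_derivative_transform_within_open[where S = "{0<..}"])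
         (use 3 in \<open>auto simp: flat_def\<close>)
  qed
qed

lemma Ck_real_flat: "Ck_real k S (flat m)"
proof (induction k arbitrary: m)
  case 0
  show ?case
    by (auto intro!: continuous_at_imp_continuous_on intro: DERIV_isCont[OF flat_has_derivative])
next
  case (Suc k)
  show ?case
  proof (rule Ck_real_SucI[OF flat_has_derivative])
    have "Ck_real k S (\<lambda>t. flat (m + 2) t + (- real m) * flat (m + 1) t)"
      by (intro Ck_real_add Ck_real_mult Ck_real_const Suc)
    then show "Ck_real k S (\<lambda>t. flat (m + 2) t - real m * flat (m + 1) t)" by simp
  qed
qed

section \<open>Radial functions\<close>

text \<open>The profile is applied to the scaled squared distance, a polynomial in the coordinates:
  smooth profiles give functions that are smooth at the centre too, and a single profile serves all
  radii \<open>d\<close>.\<close>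

definition radial :: "(real \<Rightarrow> real) \<Rightarrow> real^'n::finite \<Rightarrow> real \<Rightarrow> real^'n \<Rightarrow> real" where
  "radial F y d z = F ((norm (z - y))\<^sup>2 / d\<^sup>2)"

lemma radial_has_derivative:
  assumes "(F has_real_derivative F') (at ((norm (z - y))\<^sup>2 / d\<^sup>2))"
  shows "(radial F y d has_derivative (\<lambda>h. F' * (2 * ((z - y) \<bullet> h) / d\<^sup>2))) (at z)"
proof -
  have D: "((\<lambda>z. z - y) has_derivative (\<lambda>h. h)) (at z)"
    by (rule has_derivative_diff[OF has_derivative_ident has_derivative_const, simplified])
  have "((\<lambda>z. ((z - y) \<bullet> (z - y)) * (1 / d\<^sup>2)) has_derivative
      (\<lambda>h. ((z - y) \<bullet> h + h \<bullet> (z - y)) * (1 / d\<^sup>2))) (at z)"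
    by (intro has_derivative_mult_left has_derivative_inner D)
  then have "((\<lambda>z. (norm (z - y))\<^sup>2 / d\<^sup>2) has_derivative (\<lambda>h. 2 * ((z - y) \<bullet> h) / d\<^sup>2)) (at z)"
    by (simp only: power2_norm_eq_inner inner_commute[of _ "z - y"] mult_2 mult_1_right times_divide_eq_right)
  from has_derivative_compose[OF this, of F "(*) F'"] assms
  show ?thesis
    by (simp add: has_field_derivative_def radial_def[abs_def])
qed

lemma partial_deriv_radial:
  assumes "(F has_real_derivative F') (at ((norm (z - y))\<^sup>2 / d\<^sup>2))"
  shows "partial_deriv i (radial F y d) z = F' * (2 * (z $ i - y $ i) / d\<^sup>2)"
  using partial_deriv_eqI[OF radial_has_derivative[OF assms]] by (simp add: inner_axis)

lemma grad_radial:
  assumes "(F has_real_derivative F') (at ((norm (z - y))\<^sup>2 / d\<^sup>2))"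
  shows "grad (radial F y d) z = (2 * F' / d\<^sup>2) *\<^sub>R (z - y)"
  using partial_deriv_radial[OF assms] by (simp add: grad_def vec_eq_iff)

lemma smooth_sq_dist: "smooth (\<lambda>z::real^'n::finite. (norm (z - y))\<^sup>2 / d\<^sup>2)"
proof -
  have "(\<lambda>z::real^'n. (norm (z - y))\<^sup>2 / d\<^sup>2)
      = (\<lambda>z. (\<Sum>i\<in>UNIV. (z $ i - y $ i) * (z $ i - y $ i)) * (1 / d\<^sup>2))"
    by (auto simp: power2_norm_eq_inner inner_vec_def)
  then show ?thesis
    by (simp only: smooth_def) (intro allI Ck_mult Ck_sum Ck_const Ck_component)
qed

lemma smooth_radial:
  assumes "\<And>k. Ck_real k S F" "{0..} \<subseteq> S"
  shows "smooth (radial F y d)"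
  unfolding smooth_def radial_def[abs_def]
  using assms(2) smooth_sq_dist
  by (auto simp: smooth_def intro!: Ck_compose_real[OF assms(1)])

text \<open>The support lies in the closed ball of radius \<open>sqrt b * d\<close>; the gap between
  \<open>b\<close> and 1 keeps it inside the open ball.\<close>

lemma test_function_radial:
  assumes "\<And>k. Ck_real k S F" "{0..} \<subseteq> S" "\<And>s. b \<le> s \<Longrightarrow> F s = 0" "0 \<le> b" "b < 1" "0 < d"
  shows "test_function (ball y d) (radial F y d)"
proof -
  have "{z. radial F y d z \<noteq> 0} \<subseteq> cball y (sqrt b * d)"
  proof
    fix z assume "z \<in> {z. radial F y d z \<noteq> 0}"
    then have "\<not> b \<le> (norm (z - y))\<^sup>2 / d\<^sup>2" using assms(3) by (auto simp: radial_def)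
    then have "(norm (z - y))\<^sup>2 \<le> (sqrt b * d)\<^sup>2"
      using assms by (auto simp: field_simps power_mult_distrib)
    then show "z \<in> cball y (sqrt b * d)"
      using assms by (auto simp: dist_norm norm_minus_commute intro: power2_le_imp_le)
  qed
  then have cl: "closure {z. radial F y d z \<noteq> 0} \<subseteq> cball y (sqrt b * d)"
    by (simp add: closure_minimal)
  have "sqrt b * d < d" using assms by simp
  then have "cball y (sqrt b * d) \<subseteq> ball y d" by auto
  moreover have "compact (closure {z. radial F y d z \<noteq> 0})"
    using compact_Int_closed[OF compact_cball closed_closure, of y "sqrt b * d" "{z. radial F y d z \<noteq> 0}"] cl
    by (simp add: Int_absorb1)
  ultimately show ?thesis
    unfolding test_function_def using cl smooth_radial[OF assms(1,2)] by blast
qed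

lemma second_partial_deriv_radial:
  fixes y z :: "real^'n::finite" and d :: real
  assumes F: "\<And>s. 0 \<le> s \<Longrightarrow> (F has_real_derivative F' s) (at s)"
    and F': "\<And>s. 0 \<le> s \<Longrightarrow> (F' has_real_derivative F'' s) (at s)"
  defines "s \<equiv> (norm (z - y))\<^sup>2 / d\<^sup>2"
  shows "partial_deriv i (partial_deriv i (radial F y d)) z
    = F'' s * (4 * (z $ i - y $ i)\<^sup>2 / d^4) + F' s * (2 / d\<^sup>2)"
proof -
  have "partial_deriv i (radial F y d) = (\<lambda>z. radial F' y d z * (2 * (z $ i - y $ i) / d\<^sup>2))"
    by (rule ext) (subst partial_deriv_radial[OF F], auto simp: radial_def)
  moreover have "((\<lambda>z. radial F' y d z * (2 * (z $ i - y $ i) / d\<^sup>2)) has_derivative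
      (\<lambda>h. radial F' y d z * (2 * h $ i / d\<^sup>2)
         + F'' s * (2 * ((z - y) \<bullet> h) / d\<^sup>2) * (2 * (z $ i - y $ i) / d\<^sup>2))) (at z)"
  proof (rule has_derivative_mult)
    show "(radial F' y d has_derivative (\<lambda>h. F'' s * (2 * ((z - y) \<bullet> h) / d\<^sup>2))) (at z)"
      unfolding s_def by (rule radial_has_derivative[OF F']) auto
    have "((\<lambda>z. z $ i - y $ i) has_derivative (\<lambda>h. h $ i)) (at z)"
      by (rule has_derivative_diff[OF bounded_linear_imp_has_derivative[OF bounded_linear_vec_nth]
          has_derivative_const, simplified])
    from has_derivative_mult_right[OF this, of "2 / d\<^sup>2"]
    show "((\<lambda>z. 2 * (z $ i - y $ i) / d\<^sup>2) has_derivative (\<lambda>h. 2 * h $ i / d\<^sup>2)) (at z)"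
      by (simp add: field_simps)
  qed
  ultimately have "partial_deriv i (partial_deriv i (radial F y d)) z = radial F' y d z * (2 / d\<^sup>2)
      + F'' s * (2 * (z $ i - y $ i) / d\<^sup>2) * (2 * (z $ i - y $ i) / d\<^sup>2)"
    by (simp add: partial_deriv_eqI inner_axis)
  moreover have "F'' s * (2 * c / d\<^sup>2) * (2 * c / d\<^sup>2) = F'' s * (4 * c\<^sup>2 / d^4)" for c
    by (simp add: power2_eq_square power4_eq_xxxx mult_ac)
  ultimately show ?thesis unfolding radial_def s_def by (metis add.commute)
qed

text \<open>In the sum over the coordinates the squared offsets add up to d^2 s. Lower bounds for
  the Laplacian of a radial test function thereby become inequalities for the one-variable
  expression 4 s F'' + 2 n F'.\<close>

lemma laplacian_radial:
  fixes y :: "real^'n::finite" and d :: real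
  assumes F: "\<And>s. 0 \<le> s \<Longrightarrow> (F has_real_derivative F' s) (at s)"
    and F': "\<And>s. 0 \<le> s \<Longrightarrow> (F' has_real_derivative F'' s) (at s)"
  defines "s \<equiv> \<lambda>z. (norm (z - y))\<^sup>2 / d\<^sup>2"
  assumes "d \<noteq> 0"
  shows "(\<Sum>i\<in>UNIV. partial_deriv i (partial_deriv i (radial F y d)) z)
    = (4 * s z * F'' (s z) + 2 * real CARD('n) * F' (s z)) / d\<^sup>2"
proof -
  have "(\<Sum>i\<in>UNIV. partial_deriv i (partial_deriv i (radial F y d)) z)
     = (\<Sum>i\<in>UNIV. F'' (s z) * 4 / d^4 * (z $ i - y $ i)\<^sup>2) + (\<Sum>i\<in>(UNIV::'n set). F' (s z) * (2 / d\<^sup>2))"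
    by (simp add: second_partial_deriv_radial[OF F F'] s_def sum.distrib mult_ac)
  also have "(\<Sum>i\<in>UNIV. F'' (s z) * 4 / d^4 * (z $ i - y $ i)\<^sup>2) = F'' (s z) * 4 / d^4 * (norm (z - y))\<^sup>2"
    unfolding sum_distrib_left[symmetric]
    by (simp add: power2_norm_eq_inner inner_vec_def flip: power2_eq_square)
  also have "\<dots> = 4 * s z * F'' (s z) / d\<^sup>2"
    unfolding s_def by (simp add: power4_eq_xxxx power2_eq_square mult_ac)
  finally show ?thesis by (simp add: add_divide_distrib)
qed

section \<open>Density of compactly supported continuous functions in L1\<close>

lemma borel_measurable_lebesgue_continuous:
  "continuous_on UNIV f \<Longrightarrow> f \<in> borel_measurable lebesgue"
  by (simp add: borel_measurable_continuous_onI measurable_completion)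

lemma integrable_lebesgue_bounded_support:
  fixes f :: "'a::euclidean_space \<Rightarrow> real"
  assumes "f \<in> borel_measurable lebesgue" "\<And>x. \<bar>f x\<bar> \<le> B" "\<And>x. x \<notin> cball a R \<Longrightarrow> f x = 0"
  shows "integrable lebesgue f"
proof (rule Bochner_Integration.integrable_bound)
  show "integrable lebesgue (\<lambda>x. B * indicat_real (cball a R) x)"
    by (intro integrable_mult_right integrable_real_indicator)
       (use emeasure_lborel_cball_finite in \<open>auto simp: less_top\<close>)
  show "AE x in lebesgue. norm (f x) \<le> norm (B * indicat_real (cball a R) x)"
  proof (rule AE_I2)
    fix x show "norm (f x) \<le> norm (B * indicat_real (cball a R) x)"
      using assms(2)[of x] assms(3)[of x] by (cases "x \<in> cball a R") auto
  qed
qed (use assms in auto)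

text \<open>Two applications of dominated convergence: \<open>f\<close> is first truncated in height
  and in space, with dominating function 2 |f|, and the truncation is then approximated by
  continuous functions that obey the same truncation.\<close>

lemma L1_dense_continuous:
  fixes f :: "'a::euclidean_space \<Rightarrow> real"
  assumes f: "integrable lebesgue f" and "0 < e"
  obtains c R where "continuous_on UNIV c" "\<And>x. x \<notin> cball 0 R \<Longrightarrow> c x = 0"
    "integrable lebesgue c" "(LINT x|lebesgue. \<bar>f x - c x\<bar>) < e"
proof -
  define cut where "cut = (\<lambda>(k::nat) x::'a. max 0 (min 1 (real k + 1 - norm x)))"
  define clip where "clip = (\<lambda>(k::nat) s::real. max (- real k) (min (real k) s))"
  have cut: "continuous_on UNIV (cut k)" "0 \<le> cut k x" "cut k x \<le> 1" for k x
    unfolding cut_def by (auto intro!: continuous_intros)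
  have cut0: "cut k x = 0" if "x \<notin> cball 0 (real k + 1)" for k x
    using that by (auto simp: cut_def)
  have clip: "\<bar>clip k s\<bar> \<le> real k" "\<bar>clip k s\<bar> \<le> \<bar>s\<bar>" "continuous_on UNIV (clip k)" for k s
    unfolding clip_def by (auto intro!: continuous_intros)
  have [measurable]: "f \<in> borel_measurable lebesgue" "clip k \<in> borel_measurable borel"
    "cut k \<in> borel_measurable lebesgue" for k
    using f cut clip by (auto intro: borel_measurable_lebesgue_continuous borel_measurable_continuous_onI)
  define fk where "fk = (\<lambda>k x. clip k (f x) * cut k x)"
  have [measurable]: "fk k \<in> borel_measurable lebesgue" for k
    unfolding fk_def by measurable
  have le: "\<bar>clip k s * cut k x\<bar> \<le> min (real k) \<bar>s\<bar>" for k s x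
    using mult_mono[OF clip(1)[of k s] cut(3)[of k x]] mult_mono[OF clip(2)[of k s] cut(3)[of k x]] cut(2)[of k x]
    by (auto simp: abs_mult)
  have "(\<lambda>k. LINT x|lebesgue. \<bar>f x - fk k x\<bar>) \<longlonglongrightarrow> (LINT (x::'a)|lebesgue. 0)"
  proof (rule integral_dominated_convergence[where w = "\<lambda>x. 2 * \<bar>f x\<bar>"])
    show "AE x in lebesgue. (\<lambda>k. \<bar>f x - fk k x\<bar>) \<longlonglongrightarrow> 0"
    proof (rule AE_I2)
      fix x
      have "\<forall>\<^sub>F k in sequentially. \<bar>f x - fk k x\<bar> = 0"
      proof (rule eventually_sequentiallyI)
        fix k assume k: "nat \<lceil>\<bar>f x\<bar> + norm x\<rceil> \<le> k"
        then have "\<bar>f x\<bar> + norm x \<le> real k" by linarith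
        then have "\<bar>f x\<bar> \<le> real k" "norm x \<le> real k"
            using norm_ge_zero[of x] abs_ge_zero[of "f x"] by linarith+
        then show "\<bar>f x - fk k x\<bar> = 0"
          by (auto simp: fk_def clip_def cut_def abs_le_iff max_def min_def)
      qed
      then show "(\<lambda>k. \<bar>f x - fk k x\<bar>) \<longlonglongrightarrow> 0" by (rule tendsto_eventually)
    qed
    show "AE x in lebesgue. norm \<bar>f x - fk k x\<bar> \<le> 2 * \<bar>f x\<bar>" for k
    proof (rule AE_I2)
      fix x show "norm \<bar>f x - fk k x\<bar> \<le> 2 * \<bar>f x\<bar>"
        using le[of k "f x" x] unfolding fk_def real_norm_def abs_abs min.bounded_iff by linarith
    qed
  qed (use f in auto)
  then have "\<forall>\<^sub>F k in sequentially. (LINT x|lebesgue. \<bar>f x - fk k x\<bar>) < e / 2"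
    using \<open>0 < e\<close> by (intro order_tendstoD) auto
  then obtain k where k: "(LINT x|lebesgue. \<bar>f x - fk k x\<bar>) < e / 2"
    by (meson eventually_sequentially order_refl)
  \<comment> \<open>Measurability in this sense yields continuous functions converging to
    \<open>f\<close> off a negligible set. They need not be dominated, so the same clip and cut are
    applied to them as to \<open>f\<close>.\<close>
  have "f measurable_on UNIV" by (intro lebesgue_measurable_imp_measurable_on) auto
  then obtain N g where N: "negligible N" and g: "\<And>n. continuous_on UNIV (g n)"
    "\<And>x. x \<notin> N \<Longrightarrow> (\<lambda>n. g n x) \<longlonglongrightarrow> f x"
    unfolding measurable_on_def by auto
  define c where "c = (\<lambda>n x. clip k (g n x) * cut k x)"
  have c: "continuous_on UNIV (c n)" for n
    unfolding c_def by (intro continuous_intros continuous_on_compose2[OF clip(3) g(1)] cut) auto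
  then have [measurable]: "c n \<in> borel_measurable lebesgue" for n
    by (rule borel_measurable_lebesgue_continuous)
  have c0: "c n x = 0" if "x \<notin> cball 0 (real k + 1)" for n x
    using cut0[OF that] by (simp add: c_def)
  have fk0: "fk k x = 0" if "x \<notin> cball 0 (real k + 1)" for x
    using cut0[OF that] by (simp add: fk_def)
  have le_c: "\<bar>c n x\<bar> \<le> real k" and le_fk: "\<bar>fk k x\<bar> \<le> real k" for n x
    using le[of k "g n x" x] le[of k "f x" x] by (simp_all add: c_def fk_def)
  have "(\<lambda>n. LINT x|lebesgue. \<bar>fk k x - c n x\<bar>) \<longlonglongrightarrow> (LINT (x::'a)|lebesgue. 0)"
  proof (rule integral_dominated_convergence[where w = "\<lambda>x. 2 * real k * indicator (cball 0 (real k + 1)) x"])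
    show "AE x in lebesgue. (\<lambda>n. \<bar>fk k x - c n x\<bar>) \<longlonglongrightarrow> 0"
    proof -
      have "AE x in lebesgue. x \<notin> N" using N by (auto simp: negligible_iff_null_sets intro: AE_not_in)
      then show ?thesis
      proof eventually_elim
        case (elim x)
        have "isCont (clip k) (f x)" using clip(3) by (simp add: continuous_on_eq_continuous_at)
        then have "(\<lambda>n. clip k (g n x)) \<longlonglongrightarrow> clip k (f x)"
          using g(2)[OF elim] isCont_tendsto_compose by blast
        then have "(\<lambda>n. \<bar>fk k x - c n x\<bar>) \<longlonglongrightarrow> \<bar>fk k x - fk k x\<bar>"
          unfolding c_def fk_def by (intro tendsto_intros)
        then show ?case by simp
      qed
    qed
    show "AE x in lebesgue. norm \<bar>fk k x - c n x\<bar> \<le> 2 * real k * indicator (cball 0 (real k + 1)) x" for n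
    proof (rule AE_I2)
      fix x show "norm \<bar>fk k x - c n x\<bar> \<le> 2 * real k * indicator (cball 0 (real k + 1)) x"
        using le_c[of n x] le_fk[of x] c0[of x n] fk0[of x]
          abs_triangle_ineq4[of "fk k x" "c n x"]
        by (cases "x \<in> cball 0 (real k + 1)") auto
    qed
    show "integrable lebesgue (\<lambda>x::'a. 2 * real k * indicat_real (cball 0 (real k + 1)) x)"
      by (intro integrable_mult_right integrable_real_indicator)
         (use emeasure_lborel_cball_finite in \<open>auto simp: less_top\<close>)
  qed auto
  then have "\<forall>\<^sub>F n in sequentially. (LINT x|lebesgue. \<bar>fk k x - c n x\<bar>) < e / 2"
    using \<open>0 < e\<close> by (intro order_tendstoD) auto
  then obtain n where n: "(LINT x|lebesgue. \<bar>fk k x - c n x\<bar>) < e / 2"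
    by (meson eventually_sequentially order_refl)
  have ic: "integrable lebesgue (c n)"
    by (rule integrable_lebesgue_bounded_support[where a = 0, OF _ le_c c0]) auto
  have ifk: "integrable lebesgue (fk k)"
    by (rule integrable_lebesgue_bounded_support[where a = 0, OF _ le_fk fk0]) auto
  have "(LINT x|lebesgue. \<bar>f x - c n x\<bar>) \<le> (LINT x|lebesgue. \<bar>f x - fk k x\<bar> + \<bar>fk k x - c n x\<bar>)"
    using f ic ifk by (intro integral_mono) auto
  also have "\<dots> = (LINT x|lebesgue. \<bar>f x - fk k x\<bar>) + (LINT x|lebesgue. \<bar>fk k x - c n x\<bar>)"
    using f ic ifk by (intro Bochner_Integration.integral_add) auto
  also have "\<dots> < e" using k n by simp
  finally have "(LINT x|lebesgue. \<bar>f x - c n x\<bar>) < e" .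
  then show thesis using that[of "c n" "real k + 1"] c c0 ic by blast
qed

section \<open>Mollification\<close>

lemma nn_integral_lborel_translate:
  fixes K :: "'a::euclidean_space \<Rightarrow> ennreal"
  assumes [measurable]: "K \<in> borel_measurable borel"
  shows "(\<integral>\<^sup>+z. K (z - t) \<partial>lborel) = (\<integral>\<^sup>+z. K z \<partial>lborel)"
proof -
  have "(\<integral>\<^sup>+z. K z \<partial>lborel) = (\<integral>\<^sup>+z. K z \<partial>distr lborel borel ((+) (- t)))"
    by (simp add: lborel_distr_plus)
  also have "\<dots> = (\<integral>\<^sup>+z. K (z - t) \<partial>lborel)"
    by (subst nn_integral_distr) auto
  finally show ?thesis by simp
qed

text \<open>The error at \<open>z\<close> is the average of g t - g z against the probability
  density K (z - t). Passing through c t and c z splits it into three parts: the outer two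
  contribute the L1 distance of \<open>g\<close> and \<open>c\<close> each, the middle one at most
  \<open>e\<close> on the ball enlarged by \<delta>.\<close>

lemma nn_integral_convolution_error_le:
  fixes g c K :: "'a::euclidean_space \<Rightarrow> real"
  assumes [measurable]: "g \<in> borel_measurable borel" "c \<in> borel_measurable borel" "K \<in> borel_measurable borel"
    and g: "integrable lborel g"
    and K: "\<And>x. 0 \<le> K x" "\<And>x. K x \<le> B" "\<And>x. K (- x) = K x" "\<And>x. \<delta> \<le> norm x \<Longrightarrow> K x = 0"
      "(\<integral>\<^sup>+x. ennreal (K x) \<partial>lborel) = 1"
    and c: "\<And>x. x \<notin> cball 0 R \<Longrightarrow> c x = 0" "\<And>x y. dist x y < \<delta> \<Longrightarrow> \<bar>c x - c y\<bar> \<le> e" and "0 \<le> e"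
  shows "(\<integral>\<^sup>+z. ennreal \<bar>(LINT t|lborel. g t * K (z - t)) - g z\<bar> \<partial>lborel)
    \<le> 2 * (\<integral>\<^sup>+x. ennreal \<bar>g x - c x\<bar> \<partial>lborel) + ennreal e * emeasure lborel (cball (0::'a) (R + \<delta>))"
proof -
  have K1: "(\<integral>\<^sup>+t. ennreal (K (z - t)) \<partial>lborel) = 1" for z
    using nn_integral_lborel_translate[of "\<lambda>x. ennreal (K x)" z] K(3)[of "z - t" for t] K(5) by simp
  have K2: "(\<integral>\<^sup>+z. ennreal (K (z - t)) \<partial>lborel) = 1" for t
    using nn_integral_lborel_translate[of "\<lambda>x. ennreal (K x)" t] K(5) by simp
  have iK: "integrable lborel (\<lambda>t. K (z - t))" "(LINT t|lborel. K (z - t)) = 1" for z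
    using K1[of z] K(1) by (auto simp: integrable_iff_bounded integral_eq_nn_integral)
  have igK: "integrable lborel (\<lambda>t. g t * K (z - t))" for z
  proof (rule Bochner_Integration.integrable_bound)
    show "integrable lborel (\<lambda>t. B * g t)" using g by simp
    have "\<bar>K x\<bar> \<le> \<bar>B\<bar>" for x using K(1,2)[of x] by linarith
    then show "AE t in lborel. norm (g t * K (z - t)) \<le> norm (B * g t)"
      by (intro AE_I2) (simp add: abs_mult mult.commute[of "\<bar>B\<bar>"] mult_left_mono)
  qed measurable
  have le: "ennreal \<bar>(LINT t|lborel. g t * K (z - t)) - g z\<bar>
      \<le> (\<integral>\<^sup>+t. ennreal \<bar>g t - c t\<bar> * ennreal (K (z - t)) \<partial>lborel)
        + ennreal e * indicator (cball 0 (R + \<delta>)) z + ennreal \<bar>g z - c z\<bar>" (is "_ \<le> ?A z") for z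
  proof -
    have "(LINT t|lborel. g t * K (z - t)) - g z = (LINT t|lborel. g t * K (z - t) - g z * K (z - t))"
      using igK iK by simp
    moreover have "ennreal (norm (LINT t|lborel. g t * K (z - t) - g z * K (z - t)))
        \<le> (\<integral>\<^sup>+t. ennreal (norm (g t * K (z - t) - g z * K (z - t))) \<partial>lborel)"
      using igK iK by (intro integral_norm_bound_ennreal) auto
    ultimately have "ennreal \<bar>(LINT t|lborel. g t * K (z - t)) - g z\<bar>
        \<le> (\<integral>\<^sup>+t. ennreal (norm (g t * K (z - t) - g z * K (z - t))) \<partial>lborel)"
      by simp
    also have "\<dots> \<le> (\<integral>\<^sup>+t. ennreal \<bar>g t - c t\<bar> * ennreal (K (z - t))
        + (ennreal e * indicator (cball 0 (R + \<delta>)) z) * ennreal (K (z - t))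
        + ennreal \<bar>g z - c z\<bar> * ennreal (K (z - t)) \<partial>lborel)"
    proof (rule nn_integral_mono)
      fix t
      \<comment> \<open>Only pairs with |z - t| < \<delta> matter; if \<open>z\<close> lies outside
        the enlarged ball, then both \<open>t\<close> and \<open>z\<close> lie outside the support
        of \<open>c\<close>.\<close>
      have mid: "\<bar>c t - c z\<bar> * K (z - t) \<le> e * indicat_real (cball 0 (R + \<delta>)) z * K (z - t)"
      proof (cases "K (z - t) = 0")
        case False
        then have "norm (z - t) < \<delta>" using K(4)[of "z - t"] by linarith
        then have d: "dist t z < \<delta>" by (simp add: dist_norm norm_minus_commute)
        show ?thesis
        proof (cases "z \<in> cball 0 (R + \<delta>)")
          case True
          then show ?thesis using c(2)[OF d] K(1) by (simp add: mult_right_mono)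
        next
          case out: False
          then have "t \<notin> cball 0 R" "z \<notin> cball 0 R"
            using d dist_triangle[of 0 z t] zero_le_dist[of t z] by (auto simp del: zero_le_dist)
          then show ?thesis using c(1) out by simp
        qed
      qed simp
      have "norm (g t * K (z - t) - g z * K (z - t)) = \<bar>g t - g z\<bar> * K (z - t)"
        using K(1) by (simp add: left_diff_distrib[symmetric] abs_mult)
      also have "\<dots> \<le> (\<bar>g t - c t\<bar> + \<bar>c t - c z\<bar> + \<bar>g z - c z\<bar>) * K (z - t)"
        using K(1) by (intro mult_right_mono) auto
      also have "\<dots> \<le> \<bar>g t - c t\<bar> * K (z - t) + e * indicat_real (cball 0 (R + \<delta>)) z * K (z - t)
          + \<bar>g z - c z\<bar> * K (z - t)"
        using mid by (simp add: distrib_right)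
      finally have "ennreal (norm (g t * K (z - t) - g z * K (z - t))) \<le> ennreal (\<bar>g t - c t\<bar> * K (z - t)
          + e * indicat_real (cball 0 (R + \<delta>)) z * K (z - t) + \<bar>g z - c z\<bar> * K (z - t))"
        by (rule ennreal_leI)
      also have "\<dots> = ennreal \<bar>g t - c t\<bar> * ennreal (K (z - t))
        + (ennreal e * indicator (cball 0 (R + \<delta>)) z) * ennreal (K (z - t))
        + ennreal \<bar>g z - c z\<bar> * ennreal (K (z - t))"
        using K(1) \<open>0 \<le> e\<close> by (simp add: ennreal_plus ennreal_mult ennreal_indicator)
      finally show "ennreal (norm (g t * K (z - t) - g z * K (z - t))) \<le> \<dots>" .
    qed
    also have "\<dots> = ?A z"
      by (simp add: nn_integral_add nn_integral_cmult K1)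
    finally show ?thesis .
  qed
  have [measurable]: "(\<lambda>z. \<integral>\<^sup>+t. ennreal \<bar>g t - c t\<bar> * ennreal (K (z - t)) \<partial>lborel) \<in> borel_measurable lborel"
    by (rule lborel.borel_measurable_nn_integral) measurable
  from le have "(\<integral>\<^sup>+z. ennreal \<bar>(LINT t|lborel. g t * K (z - t)) - g z\<bar> \<partial>lborel) \<le> (\<integral>\<^sup>+z. ?A z \<partial>lborel)"
    by (rule nn_integral_mono)
  also have "\<dots> = (\<integral>\<^sup>+z. \<integral>\<^sup>+t. ennreal \<bar>g t - c t\<bar> * ennreal (K (z - t)) \<partial>lborel \<partial>lborel)
      + ennreal e * emeasure lborel (cball (0::'a) (R + \<delta>)) + (\<integral>\<^sup>+z. ennreal \<bar>g z - c z\<bar> \<partial>lborel)"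
  proof -
    have a: "(\<lambda>z. \<integral>\<^sup>+t. ennreal \<bar>g t - c t\<bar> * ennreal (K (z - t)) \<partial>lborel) \<in> borel_measurable lborel"
      by fact
    have b: "(\<lambda>z. ennreal e * indicator (cball (0::'a) (R + \<delta>)) z) \<in> borel_measurable lborel"
      by (intro borel_measurable_times_ennreal borel_measurable_const borel_measurable_indicator) auto
    have c: "(\<lambda>z. ennreal \<bar>g z - c z\<bar>) \<in> borel_measurable lborel"
      by measurable
    have "(\<integral>\<^sup>+z. ennreal e * indicator (cball (0::'a) (R + \<delta>)) z \<partial>lborel)
        = ennreal e * emeasure lborel (cball (0::'a) (R + \<delta>))"
      by (rule nn_integral_cmult_indicator) simp
    then show ?thesis
      by (simp only: nn_integral_add[OF borel_measurable_add[OF a b] c] nn_integral_add[OF a b])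
  qed
  \<comment> \<open>After the exchange of the integrals the kernel is integrated in \<open>z\<close>
    first and gives 1.\<close>
  also have "(\<integral>\<^sup>+z. \<integral>\<^sup>+t. ennreal \<bar>g t - c t\<bar> * ennreal (K (z - t)) \<partial>lborel \<partial>lborel)
      = (\<integral>\<^sup>+t. \<integral>\<^sup>+z. ennreal \<bar>g t - c t\<bar> * ennreal (K (z - t)) \<partial>lborel \<partial>lborel)"
    by (rule lborel_pair.Fubini') measurable
  also have "\<dots> = (\<integral>\<^sup>+t. ennreal \<bar>g t - c t\<bar> \<partial>lborel)"
    by (simp add: nn_integral_cmult K2)
  finally show ?thesis by (simp add: mult_2 add_ac)
qed

lemma uniformly_continuous_compact_support:
  fixes c :: "'a::euclidean_space \<Rightarrow> real"
  assumes "continuous_on UNIV c" "\<And>x. x \<notin> cball 0 R \<Longrightarrow> c x = 0" "0 < e"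
  obtains \<delta> where "0 < \<delta>" "\<And>x y. dist x y < \<delta> \<Longrightarrow> \<bar>c x - c y\<bar> \<le> e"
proof -
  have "uniformly_continuous_on (cball 0 (R + 1)) c"
    using assms(1) by (intro compact_uniformly_continuous) (auto intro: continuous_on_subset)
  then obtain d where d: "0 < d" "\<And>x y. x \<in> cball 0 (R + 1) \<Longrightarrow> y \<in> cball 0 (R + 1) \<Longrightarrow> dist y x < d \<Longrightarrow> dist (c y) (c x) < e"
    unfolding uniformly_continuous_on_def using \<open>0 < e\<close> by metis
  show thesis
  proof (rule that[of "min d 1"])
    fix x y :: 'a assume *: "dist x y < min d 1"
    show "\<bar>c x - c y\<bar> \<le> e"
    proof (cases "x \<in> cball 0 R \<or> y \<in> cball 0 R")
      case True
      then have "x \<in> cball 0 (R + 1)" "y \<in> cball 0 (R + 1)"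
        using * dist_triangle[of 0 x y] dist_triangle[of 0 y x] zero_le_dist[of x y]
        by (auto simp: dist_commute simp del: zero_le_dist)
      then show ?thesis using d(2)[of y x] * by (auto simp: dist_real_def)
    next
      case False
      then show ?thesis using assms(2)[of x] assms(2)[of y] \<open>0 < e\<close> by simp
    qed
  qed (use d in auto)
qed

lemma partial_deriv_cmult:
  assumes "f differentiable (at x)"
  shows "partial_deriv i (\<lambda>x. c * f x) x = c * partial_deriv i f x"
  using partial_deriv_mult[OF smooth_differentiable[OF smooth_const, of c] assms]
  by (simp only: partial_deriv_const mult_zero_left add_0_right)

text \<open>The bump exp (-1 / (1/2 - s)) is cut off at s = 1/2 and not at 1, so that its closed
  support lies inside the open ball of radius \<delta> and the kernel is a test function
  there.\<close>

definition mollifier :: "real \<Rightarrow> real^'n::finite \<Rightarrow> real" where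
  "mollifier \<delta> z = radial (\<lambda>s. flat 0 (1 / 2 - s)) 0 \<delta> z
     / (LINT x|lborel. radial (\<lambda>s. flat 0 (1 / 2 - s)) 0 \<delta> (x :: real^'n))"

lemma Ck_real_bump: "Ck_real k UNIV (\<lambda>s. flat m (c - s))"
proof (rule Ck_real_compose[where T = UNIV and f = "flat m" and g = "\<lambda>s. c - s"])
  have "Ck_real k UNIV (\<lambda>s. c + (-1) * s)"
    by (intro Ck_real_add Ck_real_mult Ck_real_const Ck_real_ident)
  then show "Ck_real k UNIV (\<lambda>s. c - s)" by simp
qed (auto intro: Ck_real_flat)

lemma test_function_bump:
  assumes "0 < \<delta>"
  shows "test_function (ball z \<delta>) (radial (\<lambda>s. flat 0 (1 / 2 - s)) z \<delta>)"
  by (rule test_function_radial[OF Ck_real_bump, where b = "1 / 2"])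
     (use assms in \<open>auto simp: flat_def\<close>)

lemma radial_translate: "radial F 0 d (z - t) = radial F z d t"
  by (simp add: radial_def norm_minus_commute)

lemma mollifier_properties:
  assumes "0 < \<delta>"
  shows mollifier_smooth: "smooth (mollifier \<delta> :: real^'n::finite \<Rightarrow> real)"
    and mollifier_nonneg: "0 \<le> mollifier \<delta> (z :: real^'n)"
    and mollifier_even: "mollifier \<delta> (- z) = mollifier \<delta> z"
    and mollifier_support: "\<delta> \<le> norm z \<Longrightarrow> mollifier \<delta> z = 0"
    and mollifier_integral: "(\<integral>\<^sup>+x. ennreal (mollifier \<delta> (x :: real^'n)) \<partial>lborel) = 1"
    and mollifier_test_function: "test_function (ball z \<delta>) (\<lambda>t. mollifier \<delta> (z - t))"
    and mollifier_partial_deriv: "partial_deriv i (\<lambda>t. mollifier \<delta> (z - t)) t = - partial_deriv i (mollifier \<delta>) (z - t)"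
proof -
  let ?F = "\<lambda>s. flat 0 (1 / 2 - s)"
  let ?R = "radial ?F 0 \<delta> :: real^'n \<Rightarrow> real"
  let ?c = "LINT x|lborel. ?R x"
  have m: "mollifier \<delta> = (\<lambda>x. 1 / ?c * ?R x)" by (auto simp: mollifier_def)
  have nn: "0 \<le> ?R x" for x by (simp add: radial_def flat_nonneg)
  have test: "test_function (ball z \<delta>) (radial ?F z \<delta>)" for z :: "real^'n"
    by (rule test_function_bump[OF assms])
  have [measurable]: "?R \<in> borel_measurable borel"
    by (intro borel_measurable_continuous_onI smooth_continuous_on test_function_smooth[OF test])
  have i: "integrable lborel ?R"
  proof -
    have "integrable lebesgue ?R"
    proof (rule integrable_lebesgue_bounded_support[where B = 1 and a = 0 and R = \<delta>])
      show "\<bar>?R x\<bar> \<le> 1" for x by (simp add: radial_def flat_def)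
      show "?R x = 0" if "x \<notin> cball 0 \<delta>" for x
        using test_function_eq_0[OF test, of x 0] that by auto
    qed (auto intro: measurable_completion)
    then show ?thesis using integrable_completion[of ?R lborel] by simp
  qed
  \<comment> \<open>If the integral of the nonnegative bump were 0, the bump would vanish almost
    everywhere, but it is positive on the ball of radius \<delta>/2.\<close>
  have "0 < ?c"
  proof -
    have "\<not> (AE x in lborel. ?R x = 0)"
    proof
      assume "AE x in lborel. ?R x = 0"
      then have "AE x in lborel. x \<notin> ball (0::real^'n) (\<delta> / 2)"
      proof eventually_elim
        case (elim x)
        have "(norm x)\<^sup>2 / \<delta>\<^sup>2 < 1 / 2" if "norm x < \<delta> / 2"
        proof -
          have "(norm x)\<^sup>2 < (\<delta> / 2)\<^sup>2" using that by (intro power_strict_mono) auto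
          have "0 < \<delta>\<^sup>2" using assms by simp
          have "p < q / 4 \<Longrightarrow> 0 \<le> p \<Longrightarrow> p * 2 < q" for p q :: real by linarith
          from this[of "(norm x)\<^sup>2" "\<delta>\<^sup>2"] \<open>(norm x)\<^sup>2 < (\<delta> / 2)\<^sup>2\<close>
          have "(norm x)\<^sup>2 * 2 < \<delta>\<^sup>2" by (simp add: power_divide)
          then show ?thesis using \<open>0 < \<delta>\<^sup>2\<close> by (simp add: divide_less_eq)
        qed
        then show ?case using elim by (auto simp: radial_def flat_def)
      qed
      then have "ball (0::real^'n) (\<delta> / 2) \<in> null_sets lborel"
        using AE_iff_null_sets[of "ball (0::real^'n) (\<delta> / 2)" lborel] by simp
      then have "negligible (ball (0::real^'n) (\<delta> / 2))"
        by (simp add: negligible_iff_null_sets null_sets_completionI)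
      then show False using assms open_not_negligible[of "ball (0::real^'n) (\<delta> / 2)"] by simp
    qed
    then have "?c \<noteq> 0" using integral_nonneg_eq_0_iff_AE[OF i] nn by auto
    moreover have "0 \<le> ?c" using nn by simp
    ultimately show ?thesis by simp
  qed
  show "smooth (mollifier \<delta> :: real^'n \<Rightarrow> real)"
    unfolding m by (intro smooth_mult smooth_const test_function_smooth[OF test])
  show "0 \<le> mollifier \<delta> (z :: real^'n)"
    unfolding m using nn \<open>0 < ?c\<close> by simp
  show "mollifier \<delta> (- z) = mollifier \<delta> z" by (simp add: m radial_def)
  show "mollifier \<delta> z = 0" if "\<delta> \<le> norm z"
    using test_function_eq_0[OF test, of z 0] that by (simp add: m)
  show "(\<integral>\<^sup>+x. ennreal (mollifier \<delta> (x :: real^'n)) \<partial>lborel) = 1"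
  proof -
    have "(\<integral>\<^sup>+x. ennreal (mollifier \<delta> (x :: real^'n)) \<partial>lborel) = ennreal (LINT x|lborel. 1 / ?c * ?R x)"
      unfolding m using i nn \<open>0 < ?c\<close> by (intro nn_integral_eq_integral) auto
    also have "(LINT x|lborel. 1 / ?c * ?R x) = 1" using \<open>0 < ?c\<close> by simp
    finally show ?thesis by simp
  qed
  show "test_function (ball z \<delta>) (\<lambda>t. mollifier \<delta> (z - t))"
    unfolding m radial_translate by (rule test_function_cmult[OF test])
  have D: "(?F has_real_derivative - flat 2 (1 / 2 - s)) (at s)" for s
  proof -
    have "((\<lambda>s. 1 / 2 - s) has_real_derivative - 1) (at s)" by (auto intro!: derivative_eq_intros)
    from DERIV_chain2[OF flat_has_derivative[of 0] this] show ?thesis by (simp add: numeral_2_eq_2)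
  qed
  have dd: "partial_deriv i (\<lambda>t. 1 / ?c * f t) t = 1 / ?c * partial_deriv i f t"
    if "smooth f" for f :: "real^'n \<Rightarrow> real" and i t
    by (rule partial_deriv_cmult[OF smooth_differentiable[OF that]])
  have "partial_deriv i (radial ?F z \<delta>) t = - partial_deriv i ?R (z - t)"
    unfolding partial_deriv_radial[OF D] norm_minus_commute[of t z]
    by (simp add: diff_divide_distrib right_diff_distrib)
  then show "partial_deriv i (\<lambda>t. mollifier \<delta> (z - t)) t = - partial_deriv i (mollifier \<delta>) (z - t)"
    unfolding m radial_translate by (simp only: dd[OF test_function_smooth[OF test]] mult_minus_right)
qed


text \<open>The exchange of integrals and the measurability of parameter integrals are used over
  \<open>lborel\<close>, so \<open>g\<close> is replaced by a Borel function that agrees with it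
  almost everywhere; the convolution does not see the difference.\<close>

lemma mollify_borel_version:
  fixes g :: "real^'n::finite \<Rightarrow> real"
  assumes g: "integrable lebesgue g"
  obtains g0 where "g0 \<in> borel_measurable borel" "AE x in lborel. g x = g0 x" "integrable lborel g0"
    "integrable lebesgue g0"
    "\<forall>\<delta>>0. \<forall>z. (LINT t|lebesgue. g t * mollifier \<delta> (z - t)) = (LINT t|lborel. g0 t * mollifier \<delta> (z - t))"
proof -
  obtain g0 where g0 [measurable]: "g0 \<in> borel_measurable lborel" and eq: "AE x in lborel. g x = g0 x"
    using completion_ex_borel_measurable_real[of g lborel] g by auto
  have eq': "AE x in lebesgue. g x = g0 x" using eq by (rule AE_completion)
  have i: "integrable lebesgue g0"
    by (rule integrable_cong_AE_imp[OF g measurable_completion[OF g0] eq'])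
  then have ig0: "integrable lborel g0" using integrable_completion[of g0 lborel] g0 by simp
  have I: "(LINT t|lebesgue. g t * mollifier \<delta> (z - t)) = (LINT t|lborel. g0 t * mollifier \<delta> (z - t))"
    if "0 < \<delta>" for \<delta> and z
  proof -
    have K [measurable]: "mollifier \<delta> \<in> borel_measurable (borel :: (real^'n) measure)"
      by (intro borel_measurable_continuous_onI smooth_continuous_on mollifier_smooth that)
    have m: "(\<lambda>t. mollifier \<delta> (z - t)) \<in> borel_measurable lborel" by measurable
    then have m': "(\<lambda>t. mollifier \<delta> (z - t)) \<in> borel_measurable lebesgue" by (rule measurable_completion)
    have "(LINT t|lebesgue. g t * mollifier \<delta> (z - t)) = (LINT t|lebesgue. g0 t * mollifier \<delta> (z - t))"
    proof (rule integral_cong_AE)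
      show "AE t in lebesgue. g t * mollifier \<delta> (z - t) = g0 t * mollifier \<delta> (z - t)"
        using eq' by eventually_elim simp
    qed (use g m' g0 in \<open>auto intro!: borel_measurable_times intro: measurable_completion\<close>)
    also have "\<dots> = (LINT t|lborel. g0 t * mollifier \<delta> (z - t))"
      by (rule integral_completion) measurable
    finally show ?thesis .
  qed
  have "g0 \<in> borel_measurable borel" using g0 by simp
  then show thesis by (rule that[OF _ eq ig0 i]) (use I in blast)
qed

lemma mollify_measurable:
  fixes g :: "real^'n::finite \<Rightarrow> real"
  assumes g: "integrable lebesgue g" and "0 < \<delta>"
  shows "(\<lambda>z. LINT t|lebesgue. g t * mollifier \<delta> (z - t)) \<in> borel_measurable lebesgue"
proof -
  obtain g0 where g0 [measurable]: "g0 \<in> borel_measurable borel" and "AE x in lborel. g x = g0 x"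
    and "integrable lborel g0" and "integrable lebesgue g0"
    and I0: "\<forall>\<delta>>0. \<forall>z. (LINT t|lebesgue. g t * mollifier \<delta> (z - t)) = (LINT t|lborel. g0 t * mollifier \<delta> (z - t))"
    by (rule mollify_borel_version[OF g])
  note eq = I0[rule_format, OF \<open>0 < \<delta>\<close>]
  have [measurable]: "mollifier \<delta> \<in> borel_measurable (borel :: (real^'n) measure)"
    by (intro borel_measurable_continuous_onI smooth_continuous_on mollifier_smooth \<open>0 < \<delta>\<close>)
  have "(\<lambda>z. LINT t|lborel. g0 t * mollifier \<delta> (z - t)) \<in> borel_measurable lborel"
    by measurable
  then show ?thesis unfolding eq by (rule measurable_completion)
qed

text \<open>The bound of \<open>nn_integral_convolution_error_le\<close> is applied to a continuous
  approximation \<open>c\<close> of \<open>g0\<close>, which stays fixed while the kernels shrink: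
  as soon as \<delta> k is below the modulus of continuity of \<open>c\<close>, the error is at most
  2 (e/4) + e/4.\<close>

lemma mollify_L1_tendsto:
  fixes g :: "real^'n::finite \<Rightarrow> real"
  assumes g: "integrable lebesgue g" and \<delta>: "\<And>k. 0 < \<delta> k" "\<delta> \<longlonglongrightarrow> 0"
  shows "(\<lambda>k. \<integral>\<^sup>+z. ennreal \<bar>(LINT t|lebesgue. g t * mollifier (\<delta> k) (z - t)) - g z\<bar> \<partial>lebesgue) \<longlonglongrightarrow> 0"
proof -
  obtain g0 where g0 [measurable]: "g0 \<in> borel_measurable borel" and eq: "AE x in lborel. g x = g0 x"
    and ig0: "integrable lborel g0" and "integrable lebesgue g0"
    and I0: "\<forall>\<delta>>0. \<forall>z. (LINT t|lebesgue. g t * mollifier \<delta> (z - t)) = (LINT t|lborel. g0 t * mollifier \<delta> (z - t))"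
    by (rule mollify_borel_version[OF g])
  note I = I0[rule_format, OF \<delta>(1)]
  have K [measurable]: "mollifier (\<delta> k) \<in> borel_measurable (borel :: (real^'n) measure)" for k
    by (intro borel_measurable_continuous_onI smooth_continuous_on mollifier_smooth \<delta>)
  have eqn: "(\<integral>\<^sup>+z. ennreal \<bar>(LINT t|lebesgue. g t * mollifier (\<delta> k) (z - t)) - g z\<bar> \<partial>lebesgue)
      = (\<integral>\<^sup>+z. ennreal \<bar>(LINT t|lborel. g0 t * mollifier (\<delta> k) (z - t)) - g0 z\<bar> \<partial>lborel)" for k
    unfolding I nn_integral_completion
    by (rule nn_integral_cong_AE) (use eq in \<open>auto elim: eventually_mono\<close>)
  show ?thesis
    unfolding eqn
  proof (rule order_tendstoI)
    fix x :: ennreal assume "0 < x"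
    obtain e :: real where e: "0 < e" "ennreal e \<le> x"
    proof (cases x rule: ennreal_cases)
      case (real r)
      then show ?thesis using that[of r] \<open>0 < x\<close> by auto
    qed (use that[of 1] in auto)
    obtain c R where c: "continuous_on UNIV c" "\<And>x. x \<notin> cball 0 R \<Longrightarrow> c x = 0" "integrable lebesgue c"
      "(LINT x|lebesgue. \<bar>g0 x - c x\<bar>) < e / 4"
      using L1_dense_continuous[OF \<open>integrable lebesgue g0\<close>, of "e / 4"] e by auto
    have cm [measurable]: "c \<in> borel_measurable borel" by (rule borel_measurable_continuous_onI[OF c(1)])
    define V where "V = measure lborel (cball (0::real^'n) (R + 1))"
    have V: "emeasure lborel (cball (0::real^'n) (R + 1)) = ennreal V"
      unfolding V_def using emeasure_lborel_cball_finite by (intro emeasure_eq_ennreal_measure) (auto simp: less_top)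
    have V0: "0 \<le> V" by (simp add: V_def)
    \<comment> \<open>The volume \<open>V\<close> belongs to the radius R + 1, which covers all
      \<delta> k < 1. The summand 1 in the denominator guards against V = 0.\<close>
    define e' where "e' = e / (4 * (V + 1))"
    have e': "0 < e'" "e' * V \<le> e / 4"
      using e V0 by (auto simp: e'_def field_simps)
    obtain d where d: "0 < d" "\<And>x y. dist x y < d \<Longrightarrow> \<bar>c x - c y\<bar> \<le> e'"
      using uniformly_continuous_compact_support[OF c(1,2) e'(1)] by metis
    have "\<forall>\<^sub>F k in sequentially. \<delta> k < min d 1"
      using d(1) by (intro order_tendstoD(2)[OF \<delta>(2)]) simp
    then show "\<forall>\<^sub>F k in sequentially. (\<integral>\<^sup>+z. ennreal \<bar>(LINT t|lborel. g0 t * mollifier (\<delta> k) (z - t)) - g0 z\<bar> \<partial>lborel) < x"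
    proof eventually_elim
      case (elim k)
      obtain B where B': "\<And>x::real^'n. \<bar>mollifier (\<delta> k) (0 - x)\<bar> \<le> B"
        using test_function_bounded[OF mollifier_test_function[OF \<delta>(1)[of k], where z = "0::real^'n"]] by blast
      have B: "\<bar>mollifier (\<delta> k) x\<bar> \<le> B" for x :: "real^'n" using B'[of "- x"] by simp
      have "(\<integral>\<^sup>+z. ennreal \<bar>(LINT t|lborel. g0 t * mollifier (\<delta> k) (z - t)) - g0 z\<bar> \<partial>lborel)
        \<le> 2 * (\<integral>\<^sup>+x. ennreal \<bar>g0 x - c x\<bar> \<partial>lborel) + ennreal e' * emeasure lborel (cball (0::real^'n) (R + \<delta> k))"
      proof (rule nn_integral_convolution_error_le[where B = B])
        show "mollifier (\<delta> k) x \<le> B" for x :: "real^'n" using B[of x] by linarith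
        show "\<bar>c x - c y\<bar> \<le> e'" if "dist x y < \<delta> k" for x y using d(2) that elim by simp
      qed (use \<delta>(1) c(2) e'(1) ig0 g0 mollifier_properties[OF \<delta>(1)] in auto)
      also have "\<dots> \<le> 2 * ennreal (e / 4) + ennreal e' * ennreal V"
      proof (intro add_mono mult_left_mono)
        have "(\<integral>\<^sup>+x. ennreal \<bar>g0 x - c x\<bar> \<partial>lborel) = (\<integral>\<^sup>+x. ennreal \<bar>g0 x - c x\<bar> \<partial>lebesgue)"
          by (simp add: nn_integral_completion)
        also have "\<dots> = ennreal (LINT x|lebesgue. \<bar>g0 x - c x\<bar>)"
          using c(3) \<open>integrable lebesgue g0\<close> by (intro nn_integral_eq_integral) auto
        also have "\<dots> \<le> ennreal (e / 4)" using c(4) by (intro ennreal_leI) simp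
        finally show "(\<integral>\<^sup>+x. ennreal \<bar>g0 x - c x\<bar> \<partial>lborel) \<le> ennreal (e / 4)" .
        have "emeasure lborel (cball (0::real^'n) (R + \<delta> k)) \<le> emeasure lborel (cball (0::real^'n) (R + 1))"
          using elim by (intro emeasure_mono) auto
        then show "emeasure lborel (cball (0::real^'n) (R + \<delta> k)) \<le> ennreal V" by (simp add: V)
      qed auto
      also have "\<dots> = ennreal (2 * (e / 4) + e' * V)"
      proof -
        have "2 * ennreal (e / 4) = ennreal (2 * (e / 4))" using e by (subst ennreal_mult) auto
        moreover have "ennreal e' * ennreal V = ennreal (e' * V)" using e' V0 by (subst ennreal_mult) auto
        ultimately show ?thesis using e e' V0 by (simp add: ennreal_plus)
      qed
      also have "\<dots> < ennreal e" using e e' V0 by (intro ennreal_lessI) auto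
      finally show ?case using e(2) by simp
    qed
  qed simp
qed

section \<open>Weak gradients\<close>

text \<open>Integration over a fixed box puts differentiation under the integral within reach of the
  Leibniz rule on compact boxes; in the applications the box contains everything that the kernel
  reaches.\<close>

definition convol :: "'a::euclidean_space \<Rightarrow> 'a \<Rightarrow> ('a \<Rightarrow> real) \<Rightarrow> ('a \<Rightarrow> real) \<Rightarrow> 'a \<Rightarrow> real" where
  "convol a b u K z = integral (cbox a b) (\<lambda>t. u t * K (z - t))"

lemma convol_has_derivative:
  fixes u K :: "real^'n::finite \<Rightarrow> real"
  assumes u: "continuous_on UNIV u" and K: "smooth K"
  shows "(convol a b u K has_derivative (\<lambda>h. integral (cbox a b) (\<lambda>t. u t *\<^sub>R grad K (z - t)) \<bullet> h)) (at z)"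
proof -
  have cg: "continuous_on UNIV (grad K)" by (rule continuous_on_grad[OF K])
  have c1: "continuous_on S (\<lambda>t. u (f t))" if "continuous_on S f" for S and f :: "'b::topological_space \<Rightarrow> real^'n"
    using continuous_on_compose2[OF u that] by simp
  have c2: "continuous_on S (\<lambda>t. grad K (f t))" if "continuous_on S f" for S and f :: "'b::topological_space \<Rightarrow> real^'n"
    using continuous_on_compose2[OF cg that] by simp
  have c3: "continuous_on S (\<lambda>t. K (f t))" if "continuous_on S f" for S and f :: "'b::topological_space \<Rightarrow> real^'n"
    using continuous_on_compose2[OF smooth_continuous_on[OF K, of UNIV] that] by simp
  define fx where "fx = (\<lambda>x t. blinfun_inner_right (u t *\<^sub>R grad K (x - t)))"
  have "((\<lambda>x. integral (cbox a b) (\<lambda>t. u t * K (x - t))) has_derivative integral (cbox a b) (fx z)) (at z within UNIV)"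
  proof (rule leibniz_rule)
    fix x t
    have "((\<lambda>x. K (x - t)) has_derivative (\<lambda>h. grad K (x - t) \<bullet> h)) (at x)"
    proof -
      have D: "((\<lambda>x. x - t) has_derivative (\<lambda>h. h)) (at x)"
        by (rule has_derivative_diff[OF has_derivative_ident has_derivative_const, simplified])
      show ?thesis
        using has_derivative_compose[OF D grad_inner[OF smooth_differentiable[OF K]]] by simp
    qed
    from has_derivative_mult_right[OF this, of "u t"]
    show "((\<lambda>x. u t * K (x - t)) has_derivative blinfun_apply (fx x t)) (at x within UNIV)"
      by (simp add: fx_def inner_scaleR_left[abs_def])
  next
    show "(\<lambda>t. u t * K (x - t)) integrable_on cbox a b" for x
      by (intro integrable_continuous continuous_intros c1 c3)
    show "continuous_on (UNIV \<times> cbox a b) (\<lambda>(x, t). fx x t)"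
      unfolding fx_def split_beta
      by (intro continuous_intros bounded_linear.continuous_on[OF bounded_linear_blinfun_inner_right] c1 c2)
  qed auto
  moreover have "blinfun_apply (integral (cbox a b) (fx z)) = (\<lambda>h. integral (cbox a b) (\<lambda>t. u t *\<^sub>R grad K (z - t)) \<bullet> h)"
  proof -
    have "(\<lambda>t. u t *\<^sub>R grad K (z - t)) integrable_on cbox a b"
      by (intro integrable_continuous continuous_intros c1 c2)
    from integral_linear[OF this bounded_linear_blinfun_inner_right]
    have "integral (cbox a b) (fx z) = blinfun_inner_right (integral (cbox a b) (\<lambda>t. u t *\<^sub>R grad K (z - t)))"
      by (simp add: fx_def o_def)
    then show ?thesis by simp
  qed
  ultimately show ?thesis by (simp add: convol_def[abs_def])
qed

lemma partial_deriv_convol: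
  fixes u K :: "real^'n::finite \<Rightarrow> real"
  assumes u: "continuous_on UNIV u" and K: "smooth K"
  shows "partial_deriv i (convol a b u K) = convol a b u (partial_deriv i K)"
proof
  fix z
  have "(\<lambda>t. u t *\<^sub>R grad K (z - t)) integrable_on cbox a b"
    by (intro integrable_continuous continuous_intros continuous_on_subset[OF u]
        continuous_on_compose2[OF continuous_on_grad[OF K, of UNIV]]) auto
  from integral_component_eq_cart[OF this, of i]
  show "partial_deriv i (convol a b u K) z = convol a b u (partial_deriv i K) z"
    by (simp add: partial_deriv_eqI[OF convol_has_derivative[OF u K]] inner_axis convol_def grad_def)
qed

text \<open>A partial derivative of the convolution is again a convolution of \<open>u\<close>, now
  with a derivative of the kernel, so the induction on the order runs with the kernel
  arbitrary.\<close>

lemma smooth_convol: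
  assumes u: "continuous_on UNIV u" and K: "smooth K"
  shows "smooth (convol a b u K)"
proof -
  have "Ck k (convol a b u K)" if "smooth K" for k K
    using that
  proof (induction k arbitrary: K)
    case 0
    have "convol a b u K differentiable at x" for x
      using convol_has_derivative[OF u 0] by (auto simp: differentiable_def)
    then show ?case
      by (simp add: continuous_on_eq_continuous_at differentiable_imp_continuous_within)
  next
    case (Suc k)
    have "convol a b u K differentiable at x" for x
      using convol_has_derivative[OF u Suc.prems] by (auto simp: differentiable_def)
    then show ?case
      using Suc.IH[OF smooth_partial_deriv[OF Suc.prems]] partial_deriv_convol[OF u Suc.prems] by simp
  qed
  then show ?thesis using K by (simp add: smooth_def)
qed

section \<open>Localization and uniqueness of weak gradients\<close>

lemma set_lebesgue_integral_support:
  assumes "V \<subseteq> U" "\<And>x. x \<in> U \<Longrightarrow> x \<notin> V \<Longrightarrow> f x = 0"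
  shows "(LINT x:U|M. f x) = (LINT x:V|M. f x)"
  unfolding set_lebesgue_integral_def
  by (rule Bochner_Integration.integral_cong) (use assms in \<open>auto split: split_indicator\<close>)

lemma L1_loc_subset: "L1_loc U f \<Longrightarrow> V \<subseteq> U \<Longrightarrow> L1_loc V f"
  by (auto simp: L1_loc_def)

lemma L1_loc_component: "L1_loc U G \<Longrightarrow> L1_loc U (\<lambda>y. G y $ i)"
  unfolding L1_loc_def
  using absolutely_integrable_linear[OF _ bounded_linear_vec_nth, unfolded o_def] by blast

lemma L1_loc_cball: "L1_loc (ball y r) g \<Longrightarrow> m < r \<Longrightarrow> g absolutely_integrable_on cball y m"
proof -
  assume "L1_loc (ball y r) g" "m < r"
  moreover have "cball y m \<subseteq> ball y r" using \<open>m < r\<close> by auto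
  ultimately show ?thesis unfolding L1_loc_def by (meson compact_cball)
qed

lemma absolutely_integrable_continuous_compact:
  fixes f :: "'a::euclidean_space \<Rightarrow> 'b::euclidean_space"
  assumes "compact K" "continuous_on K f"
  shows "f absolutely_integrable_on K"
proof -
  have "integrable lborel (\<lambda>x. indicator K x *\<^sub>R f x)"
    by (rule borel_integrable_compact[OF assms])
  then show ?thesis
    unfolding set_integrable_def using integrable_completion[of "\<lambda>x. indicator K x *\<^sub>R f x" lborel] by auto
qed

lemma has_weak_gradient_subset:
  assumes "has_weak_gradient U u G" "V \<subseteq> U"
  shows "has_weak_gradient V u G"
  unfolding has_weak_gradient_def
proof (intro conjI allI impI)
  fix \<phi> i assume t: "test_function V \<phi>"
  then have "test_function U \<phi>" using assms(2) by (rule test_function_mono)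
  then have "(LINT y:U|lebesgue. u y * partial_deriv i \<phi> y) = - (LINT y:U|lebesgue. G y $ i * \<phi> y)"
    using assms(1) by (auto simp: has_weak_gradient_def)
  then show "(LINT y:V|lebesgue. u y * partial_deriv i \<phi> y) = - (LINT y:V|lebesgue. G y $ i * \<phi> y)"
    using set_lebesgue_integral_support[OF assms(2), of "\<lambda>y. u y * partial_deriv i \<phi> y" lebesgue]
      set_lebesgue_integral_support[OF assms(2), of "\<lambda>y. G y $ i * \<phi> y" lebesgue]
      test_function_eq_0[OF t] test_function_partial_deriv_eq_0[OF t] by simp
qed (use assms L1_loc_subset in \<open>auto simp: has_weak_gradient_def\<close>)

text \<open>From \<open>ball y d\<close> a kernel of radius at most (r - d)/2 reaches no further
  than the closed ball of radius (d + r)/2. That ball is a compact subset of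
  \<open>ball y r\<close>, so a locally integrable function may be replaced there by an integrable
  one on the whole space.\<close>

lemma mollify_truncate:
  fixes g :: "real^'n::finite \<Rightarrow> real"
  assumes "0 < \<delta>" "\<delta> \<le> (r - d) / 2" "z \<in> ball y d"
  shows "(LINT t:ball y r|lebesgue. g t * mollifier \<delta> (z - t))
    = (LINT t|lebesgue. (indicat_real (cball y ((d + r) / 2)) t * g t) * mollifier \<delta> (z - t))"
  unfolding set_lebesgue_integral_def
proof (rule Bochner_Integration.integral_cong)
  fix t :: "real^'n"
  show "indicat_real (ball y r) t *\<^sub>R (g t * mollifier \<delta> (z - t))
      = indicat_real (cball y ((d + r) / 2)) t * g t * mollifier \<delta> (z - t)"
  proof (cases "t \<in> cball y ((d + r) / 2)")
    case False
    have "dist y t \<le> dist y z + norm (z - t)" using dist_triangle[of y t z] by (simp add: dist_norm)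
    moreover have "(d + r) / 2 < dist y t" "dist y z < d" using False assms by auto
    ultimately have "\<delta> \<le> norm (z - t)" using assms(2) by (simp add: field_simps)
    then show ?thesis using mollifier_support[OF assms(1), of "z - t"] by simp
  next
    case True
    then have "t \<in> ball y r" using assms by auto
    then show ?thesis using True by simp
  qed
qed simp

lemma mollify_L1_loc:
  fixes g :: "real^'n::finite \<Rightarrow> real"
  assumes g: "L1_loc (ball y r) g" and "0 < d" "d < r"
    and \<delta>: "\<And>k. 0 < \<delta> k" "\<And>k. \<delta> k \<le> (r - d) / 2" "\<delta> \<longlonglongrightarrow> 0"
  defines "M \<equiv> \<lambda>k z. (LINT t:ball y r|lebesgue. g t * mollifier (\<delta> k) (z - t)) - g z"
  shows "(\<lambda>k. \<integral>\<^sup>+z\<in>ball y d. ennreal \<bar>M k z\<bar> \<partial>lebesgue) \<longlonglongrightarrow> 0"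
    and "(\<lambda>z. M k z * indicat_real (ball y d) z) \<in> borel_measurable lebesgue"
proof -
  define g' where "g' = (\<lambda>x. indicat_real (cball y ((d + r) / 2)) x * g x)"
  have "g absolutely_integrable_on cball y ((d + r) / 2)"
    by (rule L1_loc_cball[OF g]) (use assms in auto)
  then have ig': "integrable lebesgue g'"
    by (simp add: g'_def set_integrable_def)
  have eq: "M k z = (LINT t|lebesgue. g' t * mollifier (\<delta> k) (z - t)) - g' z" if "z \<in> ball y d" for k z
    unfolding M_def g'_def
    by (subst mollify_truncate[OF \<delta>(1,2) that]) (use that assms in auto)
  have "(\<lambda>z. ((LINT t|lebesgue. g' t * mollifier (\<delta> k) (z - t)) - g' z) * indicat_real (ball y d) z) \<in> borel_measurable lebesgue"
    using ig' by (intro borel_measurable_times borel_measurable_diff mollify_measurable[OF ig' \<delta>(1)] borel_measurable_indicator) auto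
  also have "(\<lambda>z. ((LINT t|lebesgue. g' t * mollifier (\<delta> k) (z - t)) - g' z) * indicat_real (ball y d) z) = (\<lambda>z. M k z * indicat_real (ball y d) z)"
    using eq by (auto split: split_indicator)
  finally show "(\<lambda>z. M k z * indicat_real (ball y d) z) \<in> borel_measurable lebesgue" .
  show "(\<lambda>k. \<integral>\<^sup>+z\<in>ball y d. ennreal \<bar>M k z\<bar> \<partial>lebesgue) \<longlonglongrightarrow> 0"
  proof (rule tendsto_sandwich[OF _ _ tendsto_const])
    show "(\<lambda>k. \<integral>\<^sup>+z. ennreal \<bar>(LINT t|lebesgue. g' t * mollifier (\<delta> k) (z - t)) - g' z\<bar> \<partial>lebesgue) \<longlonglongrightarrow> 0"
      by (rule mollify_L1_tendsto[OF ig' \<delta>(1,3)])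
    show "\<forall>\<^sub>F k in sequentially. (\<integral>\<^sup>+z\<in>ball y d. ennreal \<bar>M k z\<bar> \<partial>lebesgue)
        \<le> (\<integral>\<^sup>+z. ennreal \<bar>(LINT t|lebesgue. g' t * mollifier (\<delta> k) (z - t)) - g' z\<bar> \<partial>lebesgue)"
      by (intro always_eventually allI nn_integral_mono) (use eq in \<open>auto split: split_indicator\<close>)
  qed auto
qed

text \<open>The fundamental lemma of the calculus of variations. Shifted mollifiers are test
  functions, so the mollifications of \<open>g\<close> and \<open>h\<close> coincide on a smaller
  ball; both converge there in L1, which forces g = h almost everywhere.\<close>

lemma AE_eq_of_test_integrals:
  fixes g h :: "real^'n::finite \<Rightarrow> real"
  assumes g: "L1_loc (ball y r) g" and h: "L1_loc (ball y r) h"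
    and eq: "\<And>\<phi>. test_function (ball y r) \<phi> \<Longrightarrow>
      (LINT t:ball y r|lebesgue. g t * \<phi> t) = (LINT t:ball y r|lebesgue. h t * \<phi> t)"
  shows "AE x in lebesgue. x \<in> ball y r \<longrightarrow> g x = h x"
proof -
  have *: "AE x in lebesgue. x \<in> ball y d \<longrightarrow> g x = h x" if d: "0 < d" "d < r" for d
  proof -
    define \<delta> where "\<delta> = (\<lambda>k. (r - d) / 2 / real (Suc k))"
    have \<delta>: "0 < \<delta> k" "\<delta> k \<le> (r - d) / 2" for k
    proof -
      show "0 < \<delta> k" using d by (simp add: \<delta>_def)
      have "(r - d) / 2 / real (Suc k) \<le> (r - d) / 2 / 1" using d by (intro divide_left_mono) auto
      then show "\<delta> k \<le> (r - d) / 2" by (simp add: \<delta>_def)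
    qed
    have \<delta>0: "\<delta> \<longlonglongrightarrow> 0" unfolding \<delta>_def
      by (rule LIMSEQ_Suc[OF lim_const_over_n])
    let ?M = "\<lambda>g k z. LINT t:ball y r|lebesgue. g t * mollifier (\<delta> k) (z - t)"
    have meas: "(\<lambda>x. f x * indicat_real (ball y d) x) \<in> borel_measurable lebesgue"
      if "L1_loc (ball y r) f" for f :: "real^'n \<Rightarrow> real"
    proof -
      have "f absolutely_integrable_on cball y d" by (rule L1_loc_cball[OF that d(2)])
      then have "f absolutely_integrable_on ball y d"
        by (rule set_integrable_subset) auto
      then show ?thesis
        by (auto simp: set_integrable_def mult.commute dest: borel_measurable_integrable)
    qed
    have le: "(\<integral>\<^sup>+z\<in>ball y d. ennreal \<bar>g z - h z\<bar> \<partial>lebesgue) \<le>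
       (\<integral>\<^sup>+z\<in>ball y d. ennreal \<bar>?M g k z - g z\<bar> \<partial>lebesgue) + (\<integral>\<^sup>+z\<in>ball y d. ennreal \<bar>?M h k z - h z\<bar> \<partial>lebesgue)" for k
    proof -
      have "(\<integral>\<^sup>+z\<in>ball y d. ennreal \<bar>g z - h z\<bar> \<partial>lebesgue) \<le>
        (\<integral>\<^sup>+z. ennreal \<bar>?M g k z - g z\<bar> * indicator (ball y d) z + ennreal \<bar>?M h k z - h z\<bar> * indicator (ball y d) z \<partial>lebesgue)"
      proof (rule nn_integral_mono)
        fix z
        have "?M g k z = ?M h k z" if "z \<in> ball y d"
        proof (rule eq)
          show "test_function (ball y r) (\<lambda>t. mollifier (\<delta> k) (z - t))"
            by (rule test_function_mono[OF mollifier_test_function[OF \<delta>(1)]])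
               (use that d \<delta>(2)[of k] in \<open>simp add: ball_subset_ball_iff dist_commute\<close>)
        qed
        then have "ennreal \<bar>g z - h z\<bar> \<le> ennreal \<bar>?M g k z - g z\<bar> + ennreal \<bar>?M h k z - h z\<bar>" if "z \<in> ball y d"
          using that by (simp flip: ennreal_plus)
        then show "ennreal \<bar>g z - h z\<bar> * indicator (ball y d) z \<le>
            ennreal \<bar>?M g k z - g z\<bar> * indicator (ball y d) z + ennreal \<bar>?M h k z - h z\<bar> * indicator (ball y d) z"
          by (cases "z \<in> ball y d") auto
      qed
      also have "\<dots> = (\<integral>\<^sup>+z\<in>ball y d. ennreal \<bar>?M g k z - g z\<bar> \<partial>lebesgue) + (\<integral>\<^sup>+z\<in>ball y d. ennreal \<bar>?M h k z - h z\<bar> \<partial>lebesgue)"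
      proof -
        have "(\<lambda>z. ennreal \<bar>?M f k z - f z\<bar> * indicator (ball y d) z) \<in> borel_measurable lebesgue"
          if "L1_loc (ball y r) f" for f
        proof -
          have "(\<lambda>z. ennreal \<bar>(?M f k z - f z) * indicat_real (ball y d) z\<bar>) \<in> borel_measurable lebesgue"
            using mollify_L1_loc(2)[where k = k, OF that d \<delta> \<delta>0] by auto
          also have "(\<lambda>z. ennreal \<bar>(?M f k z - f z) * indicat_real (ball y d) z\<bar>) = (\<lambda>z. ennreal \<bar>?M f k z - f z\<bar> * indicator (ball y d) z)"
            by (auto split: split_indicator)
          finally show ?thesis .
        qed
        then show ?thesis using g h by (intro nn_integral_add) auto
      qed
      finally show ?thesis .
    qed
    have "(\<integral>\<^sup>+z\<in>ball y d. ennreal \<bar>g z - h z\<bar> \<partial>lebesgue) \<le> 0 + 0"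
      using tendsto_add[OF mollify_L1_loc(1)[OF g d \<delta> \<delta>0] mollify_L1_loc(1)[OF h d \<delta> \<delta>0]]
      by (rule tendsto_lowerbound) (use le in auto)
    then have "(\<integral>\<^sup>+z. ennreal \<bar>g z * indicat_real (ball y d) z - h z * indicat_real (ball y d) z\<bar> \<partial>lebesgue) = 0"
      by (subst (asm) nn_integral_cong[where v = "\<lambda>z. ennreal \<bar>g z * indicat_real (ball y d) z - h z * indicat_real (ball y d) z\<bar>"])
         (auto split: split_indicator)
    then show ?thesis
      using meas[OF g] meas[OF h]
      by (subst (asm) nn_integral_0_iff_AE) (auto elim!: eventually_mono)
  qed
  \<comment> \<open>Countably many smaller balls exhaust the given one; the offset 2 makes already
    the first radius, r/2, positive.\<close>
  have "AE x in lebesgue. \<forall>k. x \<in> ball y (r * (1 - 1 / real (k + 2))) \<longrightarrow> g x = h x" if "0 < r"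
    unfolding AE_all_countable
  proof
    fix k
    show "AE x in lebesgue. x \<in> ball y (r * (1 - 1 / real (k + 2))) \<longrightarrow> g x = h x"
      by (rule *) (use that in \<open>auto simp: field_simps add_pos_nonneg\<close>)
  qed
  moreover have "\<exists>k. x \<in> ball y (r * (1 - 1 / real (k + 2)))" if "x \<in> ball y r" "0 < r" for x
  proof -
    have "(\<lambda>k. r * (1 - 1 / real (k + 2))) \<longlonglongrightarrow> r * (1 - 0)"
      by (intro tendsto_intros LIMSEQ_ignore_initial_segment[OF lim_1_over_n])
    then have "\<forall>\<^sub>F k in sequentially. dist y x < r * (1 - 1 / real (k + 2))"
      using that by (intro order_tendstoD(1)[where y = r]) auto
    then show ?thesis by (auto simp: eventually_sequentially)
  qed
  ultimately have pos: ?thesis if "0 < r" using that by (auto elim: eventually_mono)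
  have "x \<notin> ball y r" if "\<not> 0 < r" for x
    using that zero_le_dist[of y x] by (simp del: zero_le_dist)
  then have ?thesis if "\<not> 0 < r" using that by (intro AE_I2) blast
  then show ?thesis using pos by blast
qed

lemma weak_gradient_unique:
  assumes "has_weak_gradient (ball y r) u G" "has_weak_gradient (ball y r) u H"
  shows "AE x in lebesgue. x \<in> ball y r \<longrightarrow> G x = H x"
proof -
  have "AE x in lebesgue. x \<in> ball y r \<longrightarrow> G x $ i = H x $ i" for i
  proof (rule AE_eq_of_test_integrals)
    fix \<phi> assume t: "test_function (ball y r) \<phi>"
    have "(LINT t:ball y r|lebesgue. u t * partial_deriv i \<phi> t) = - (LINT t:ball y r|lebesgue. G t $ i * \<phi> t)"
      using assms(1) t by (auto simp: has_weak_gradient_def)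
    moreover have "(LINT t:ball y r|lebesgue. u t * partial_deriv i \<phi> t) = - (LINT t:ball y r|lebesgue. H t $ i * \<phi> t)"
      using assms(2) t by (auto simp: has_weak_gradient_def)
    ultimately show "(LINT t:ball y r|lebesgue. G t $ i * \<phi> t) = (LINT t:ball y r|lebesgue. H t $ i * \<phi> t)"
      by simp
  qed (use assms in \<open>auto simp: has_weak_gradient_def intro: L1_loc_component\<close>)
  then have "AE x in lebesgue. \<forall>i\<in>UNIV. x \<in> ball y r \<longrightarrow> G x $ i = H x $ i"
    by (intro AE_finite_allI) auto
  then show ?thesis by eventually_elim (auto simp: vec_eq_iff)
qed

text \<open>The energies are written with an arbitrary choice of weak gradient. Under integrals over
  the ball, any explicitly known weak gradient may stand in its place.\<close>

lemma weak_grad_eq: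
  assumes "has_weak_gradient (ball y r) u G"
  shows "AE x in lebesgue. x \<in> ball y r \<longrightarrow> weak_grad (ball y r) u x = G x"
  unfolding weak_grad_def by (rule weak_gradient_unique[OF someI[of "has_weak_gradient (ball y r) u", OF assms] assms])


section \<open>Smooth approximation of Lipschitz functions with control of the gradients\<close>

text \<open>The derivative in the direction v = \<open>grad f x\<close> equals |v|^2, while the
  difference quotients in that direction are at most L |v|.\<close>

lemma norm_grad_le_lipschitz:
  fixes f :: "real^'n::finite \<Rightarrow> real"
  assumes f: "f differentiable (at x)" and "open S" "x \<in> S"
    and L: "\<And>a b. a \<in> S \<Longrightarrow> b \<in> S \<Longrightarrow> \<bar>f a - f b\<bar> \<le> L * dist a b"
  shows "norm (grad f x) \<le> L"
proof (cases "grad f x = 0")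
  case True
  \<comment> \<open>The bound 0 \<le> L has to be extracted from the Lipschitz estimate itself, at
    two distinct points of \<open>S\<close>.\<close>
  obtain e where e: "0 < e" "ball x e \<subseteq> S" using assms openE by blast
  define b where "b = x + (e / 2) *\<^sub>R axis undefined 1"
  have "dist x b = e / 2" using e by (simp add: b_def dist_norm norm_axis_1)
  then have "b \<in> S" using e by auto
  then have "0 \<le> L * dist x b" using L[of x b] assms(3) by linarith
  then have "0 \<le> L" using \<open>dist x b = e / 2\<close> e by (simp add: zero_le_mult_iff)
  then show ?thesis using True by simp
next
  case False
  define v where "v = grad f x"
  have D: "((\<lambda>t. f (x + t *\<^sub>R v)) has_real_derivative v \<bullet> v) (at 0)"
  proof -
    have "((\<lambda>t. x + t *\<^sub>R v) has_derivative (\<lambda>t. t *\<^sub>R v)) (at 0)"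
      by (auto intro!: derivative_eq_intros)
    from has_derivative_compose[OF this, of f "\<lambda>h. v \<bullet> h"] grad_inner[OF f]
    have "((\<lambda>t. f (x + t *\<^sub>R v)) has_derivative (\<lambda>t. v \<bullet> (t *\<^sub>R v))) (at 0)"
      by (simp add: v_def)
    then show ?thesis
      by (simp add: has_field_derivative_def mult_commute_abs)
  qed
  then have lim: "((\<lambda>h. (f (x + h *\<^sub>R v) - f x) / h) \<longlongrightarrow> v \<bullet> v) (at 0)"
    by (simp add: has_field_derivative_iff)
  have "\<forall>\<^sub>F h in at 0. x + h *\<^sub>R v \<in> S"
  proof -
    have "((\<lambda>h. x + h *\<^sub>R v) \<longlongrightarrow> x + 0 *\<^sub>R v) (at 0)" by (intro tendsto_intros)
    then show ?thesis using topological_tendstoD[OF _ \<open>open S\<close>] \<open>x \<in> S\<close> by simp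
  qed
  moreover have "\<forall>\<^sub>F h in at (0::real). h \<noteq> 0" by (simp add: eventually_at_filter)
  ultimately have "\<forall>\<^sub>F h in at 0. (f (x + h *\<^sub>R v) - f x) / h \<le> L * norm v"
  proof eventually_elim
    case (elim h)
    have "\<bar>f (x + h *\<^sub>R v) - f x\<bar> \<le> L * (\<bar>h\<bar> * norm v)"
      using L[of "x + h *\<^sub>R v" x] elim \<open>x \<in> S\<close> by (simp add: dist_norm)
    then have "\<bar>(f (x + h *\<^sub>R v) - f x) / h\<bar> \<le> L * norm v"
      using elim by (simp add: abs_divide divide_le_eq mult_ac)
    then show ?case by linarith
  qed
  then have "v \<bullet> v \<le> L * norm v"
    by (intro tendsto_upperbound[OF lim]) auto
  then show ?thesis using False
    by (simp add: v_def dot_square_norm power2_eq_square)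
qed

lemma integrable_lborel_continuous_support:
  fixes f :: "'a::euclidean_space \<Rightarrow> real"
  assumes "continuous_on UNIV f" "\<And>x. x \<notin> cball a R \<Longrightarrow> f x = 0"
  shows "integrable lborel f"
proof -
  have "integrable lborel (\<lambda>x. indicator (cball a R) x *\<^sub>R f x)"
    using assms(1) by (intro borel_integrable_compact) (auto intro: continuous_on_subset)
  also have "(\<lambda>x. indicator (cball a R) x *\<^sub>R f x) = f"
    using assms(2) by (auto split: split_indicator)
  finally show ?thesis .
qed

text \<open>Written as an average of the shifts u (z + s) over a kernel independent of
  \<open>z\<close>, the mollification inherits every estimate that holds for all shifts.\<close>

lemma convol_mollifier_eq:
  fixes u :: "real^'n::finite \<Rightarrow> real"
  assumes u: "continuous_on UNIV u" and "0 < \<delta>" "cball z \<delta> \<subseteq> cbox a b"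
  shows "convol a b u (mollifier \<delta>) z = (LINT s|lborel. u (z + s) * mollifier \<delta> s)"
    and "integrable lborel (\<lambda>s. u (z + s) * mollifier \<delta> s)"
proof -
  have cK: "continuous_on UNIV (mollifier \<delta> :: real^'n \<Rightarrow> real)"
    by (rule smooth_continuous_on[OF mollifier_smooth[OF \<open>0 < \<delta>\<close>]])
  let ?f = "\<lambda>t. u t * mollifier \<delta> (z - t)"
  have f0: "?f t = 0" if "t \<notin> cball z \<delta>" for t
    using mollifier_support[OF \<open>0 < \<delta>\<close>, of "z - t"] that by (simp add: dist_norm)
  have cf: "continuous_on UNIV ?f"
    by (intro continuous_intros u continuous_on_compose2[OF cK]) auto
  have i: "integrable lborel ?f" by (rule integrable_lborel_continuous_support[OF cf f0])
  have "convol a b u (mollifier \<delta>) z = integral UNIV ?f"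
  proof -
    have "?f = (\<lambda>t. if t \<in> cbox a b then ?f t else 0)" using assms(3) f0 by (intro ext) (metis subsetD)
    then have "integral UNIV ?f = integral UNIV (\<lambda>t. if t \<in> cbox a b then ?f t else 0)" by simp
    also have "\<dots> = integral (cbox a b) ?f" by (rule integral_restrict_UNIV)
    finally show ?thesis by (simp only: convol_def)
  qed
  also have "\<dots> = (LINT t|lborel. ?f t)" using i by (rule integral_lborel)
  also have "\<dots> = (LINT t|distr lborel borel ((+) z). ?f t)" by (simp add: lborel_distr_plus)
  also have "\<dots> = (LINT s|lborel. u (z + s) * mollifier \<delta> (z - (z + s)))"
    by (rule integral_distr) (use cf in \<open>auto intro: borel_measurable_continuous_onI\<close>)
  also have "\<dots> = (LINT s|lborel. u (z + s) * mollifier \<delta> s)"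
    by (simp add: mollifier_even[OF \<open>0 < \<delta>\<close>])
  finally show "convol a b u (mollifier \<delta>) z = (LINT s|lborel. u (z + s) * mollifier \<delta> s)" .
  show "integrable lborel (\<lambda>s. u (z + s) * mollifier \<delta> s)"
  proof (rule integrable_lborel_continuous_support[where a = 0 and R = \<delta>])
    show "continuous_on UNIV (\<lambda>s. u (z + s) * mollifier \<delta> s)"
      by (intro continuous_intros continuous_on_compose2[OF u] cK) auto
    show "u (z + x) * mollifier \<delta> x = 0" if "x \<notin> cball 0 \<delta>" for x
      using mollifier_support[OF \<open>0 < \<delta>\<close>, of x] that by simp
  qed
qed

lemma mollifier_integral_eq:
  assumes "0 < \<delta>"
  shows "integrable lborel (mollifier \<delta> :: real^'n::finite \<Rightarrow> real)"
    and "(LINT x|lborel. mollifier \<delta> (x :: real^'n)) = 1"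
proof -
  have m: "(mollifier \<delta> :: real^'n \<Rightarrow> real) \<in> borel_measurable lborel"
    using borel_measurable_continuous_onI[OF smooth_continuous_on[OF mollifier_smooth[OF assms]]] by simp
  show "integrable lborel (mollifier \<delta> :: real^'n \<Rightarrow> real)" "(LINT x|lborel. mollifier \<delta> (x :: real^'n)) = 1"
    using m mollifier_nonneg[OF assms, where 'n = 'n] mollifier_integral[OF assms, where 'n = 'n]
    by (auto simp: integrable_iff_bounded integral_eq_nn_integral)
qed

text \<open>With c s = u z this measures the distance of the mollification from \<open>u\<close>;
  with c s = u (q + s) it shows that mollification preserves the Lipschitz constant.\<close>

lemma convol_mollifier_diff_le:
  fixes u :: "real^'n::finite \<Rightarrow> real"
  assumes u: "continuous_on UNIV u" and "0 < \<delta>"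
    and z: "cball z \<delta> \<subseteq> cbox a b"
    and le: "\<And>s. norm s \<le> \<delta> \<Longrightarrow> \<bar>u (z + s) - c s\<bar> \<le> e"
    and c: "integrable lborel (\<lambda>s. c s * mollifier \<delta> s)"
  shows "\<bar>convol a b u (mollifier \<delta>) z - (LINT s|lborel. c s * mollifier \<delta> s)\<bar> \<le> e"
proof -
  note i = convol_mollifier_eq[OF u \<open>0 < \<delta>\<close> z] and m = mollifier_integral_eq[OF \<open>0 < \<delta>\<close>, where 'n = 'n]
  have "\<bar>convol a b u (mollifier \<delta>) z - (LINT s|lborel. c s * mollifier \<delta> s)\<bar>
      = \<bar>LINT s|lborel. u (z + s) * mollifier \<delta> s - c s * mollifier \<delta> s\<bar>"
    using i c by simp
  also have "\<dots> \<le> (LINT s|lborel. \<bar>u (z + s) * mollifier \<delta> s - c s * mollifier \<delta> s\<bar>)"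
    by (rule integral_abs_bound)
  also have "\<dots> \<le> (LINT s|lborel. e * mollifier \<delta> (s :: real^'n))"
  proof (rule integral_mono)
    fix s :: "real^'n"
    show "\<bar>u (z + s) * mollifier \<delta> s - c s * mollifier \<delta> s\<bar> \<le> e * mollifier \<delta> s"
    proof (cases "norm s \<le> \<delta>")
      case True
      then show ?thesis using mult_right_mono[OF le mollifier_nonneg[OF \<open>0 < \<delta>\<close>]] mollifier_nonneg[OF \<open>0 < \<delta>\<close>, of s]
        by (simp add: left_diff_distrib[symmetric] abs_mult)
    next
      case False
      then show ?thesis using mollifier_support[OF \<open>0 < \<delta>\<close>, of s] by simp
    qed
  qed (use i c m in auto)
  also have "\<dots> = e" using m by simp
  finally show ?thesis .
qed


text \<open>The approximations are mollifications of \<open>u\<close>, whose gradients are the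
  mollifications of \<open>G\<close>; L1 convergence of the latter gives almost everywhere
  convergence along a subsequence. The uniform estimate is stated on the closed ball because the
  trace is read off on the sphere.\<close>

lemma weak_gradient_approximation:
  fixes u :: "real^'n::finite \<Rightarrow> real"
  assumes L: "L-lipschitz_on UNIV u" and G: "has_weak_gradient (ball y r) u G" and d: "0 < d" "d < r"
  obtains \<phi> e where "\<forall>k. smooth (\<phi> k)" "e \<longlonglongrightarrow> 0"
    "\<forall>k. \<forall>z\<in>cball y d. \<bar>\<phi> k z - u z\<bar> \<le> e k"
    "\<forall>k. \<forall>z\<in>ball y d. norm (grad (\<phi> k) z) \<le> L"
    "AE z in lebesgue. z \<in> ball y d \<longrightarrow> (\<lambda>k. grad (\<phi> k) z) \<longlonglongrightarrow> G z"
proof -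
  have L0: "0 \<le> L" and Ldist: "\<bar>u p - u q\<bar> \<le> L * dist p q" for p q
    using L by (auto simp: lipschitz_on_def dist_real_def)
  have cu: "continuous_on UNIV u" using L by (rule lipschitz_on_continuous_on)
  define \<delta> where "\<delta> = (\<lambda>k. (r - d) / 2 / real (Suc k))"
  have \<delta>: "0 < \<delta> k" "\<delta> k \<le> (r - d) / 2" for k
  proof -
    show "0 < \<delta> k" using d by (simp add: \<delta>_def)
    have "(r - d) / 2 / real (Suc k) \<le> (r - d) / 2 / 1" using d by (intro divide_left_mono) auto
    then show "\<delta> k \<le> (r - d) / 2" by (simp add: \<delta>_def)
  qed
  have \<delta>0: "\<delta> \<longlonglongrightarrow> 0" unfolding \<delta>_def
    by (rule LIMSEQ_Suc[OF lim_const_over_n])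
  obtain a b where ab: "cball y r \<subseteq> cbox a b"
    using bounded_subset_cbox_symmetric[OF bounded_cball] by metis
  have sub: "cball z (\<delta> k) \<subseteq> cbox a b" if "z \<in> cball y d" for z k
  proof
    fix t assume "t \<in> cball z (\<delta> k)"
    then have "dist y t \<le> d + (r - d) / 2" using that \<delta>(2)[of k] dist_triangle[of y t z]
      unfolding mem_cball by linarith
    also have "\<dots> \<le> r" using d by (simp add: field_simps)
    finally show "t \<in> cbox a b" using ab by auto
  qed
  define \<psi> where "\<psi> = (\<lambda>k. convol a b u (mollifier (\<delta> k)))"
  have sm: "smooth (\<psi> k)" for k
    unfolding \<psi>_def by (rule smooth_convol[OF cu mollifier_smooth[OF \<delta>(1)]])
  have unif: "\<bar>\<psi> k z - u z\<bar> \<le> L * \<delta> k" if "z \<in> cball y d" for k z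
  proof -
    note m = mollifier_integral_eq[OF \<delta>(1)[of k], where 'n = 'n]
    have "\<bar>\<psi> k z - (LINT s|lborel. u z * mollifier (\<delta> k) (s :: real^'n))\<bar> \<le> L * \<delta> k"
      unfolding \<psi>_def
    proof (rule convol_mollifier_diff_le[OF cu \<delta>(1) sub[OF that]])
      fix s :: "real^'n" assume "norm s \<le> \<delta> k"
      then show "\<bar>u (z + s) - u z\<bar> \<le> L * \<delta> k"
        using Ldist[of "z + s" z] mult_left_mono[OF _ L0, of "norm s" "\<delta> k"] by (simp add: dist_norm)
    qed (use m in auto)
    then show ?thesis using m by simp
  qed
  have lip: "\<bar>\<psi> k p - \<psi> k q\<bar> \<le> L * dist p q" if "p \<in> ball y d" "q \<in> ball y d" for k p q
  proof -
    have pq: "p \<in> cball y d" "q \<in> cball y d" using that by auto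
    note q = convol_mollifier_eq[OF cu \<delta>(1) sub[OF pq(2)], of k]
    show ?thesis
      unfolding \<psi>_def q(1)
    proof (rule convol_mollifier_diff_le[OF cu \<delta>(1) sub[OF pq(1)] _ q(2)])
      show "\<bar>u (p + s) - u (q + s)\<bar> \<le> L * dist p q" for s
        using Ldist[of "p + s" "q + s"] by (simp add: dist_norm)
    qed
  qed
  have gb: "norm (grad (\<psi> k) z) \<le> L" if "z \<in> ball y d" for k z
    by (rule norm_grad_le_lipschitz[OF smooth_differentiable[OF sm] open_ball that lip])
  define M where "M = (\<lambda>i k z. (LINT t:ball y r|lebesgue. G t $ i * mollifier (\<delta> k) (z - t)) - G z $ i)"
  \<comment> \<open>The reflected kernel t \<mapsto> \<open>mollifier (\<delta> k) (z - t)\<close>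
    is a test function in \<open>ball y r\<close>, and the definition of the weak gradient moves the
    derivative from it to \<open>u\<close>. The two signs, from the reflection and from the
    integration by parts, cancel.\<close>
  have gM: "grad (\<psi> k) z $ i - G z $ i = M i k z" if z: "z \<in> ball y d" for k z i
  proof -
    have zc: "z \<in> cball y d" using z by auto
    have t: "test_function (ball y r) (\<lambda>t. mollifier (\<delta> k) (z - t))"
      by (rule test_function_mono[OF mollifier_test_function[OF \<delta>(1)]])
         (use z d \<delta>(2)[of k] in \<open>simp add: ball_subset_ball_iff dist_commute\<close>)
    have t': "test_function (ball z (\<delta> k)) (\<lambda>t. mollifier (\<delta> k) (z - t))"
      by (rule mollifier_test_function[OF \<delta>(1)])
    let ?f = "\<lambda>t. u t * partial_deriv i (mollifier (\<delta> k)) (z - t)"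
    have f0: "?f t = 0" if "t \<notin> ball z (\<delta> k)" for t
      using test_function_partial_deriv_eq_0[OF t' that, of i] mollifier_partial_deriv[OF \<delta>(1)[of k], of i z t] by simp
    have cf: "continuous_on UNIV ?f"
      by (intro continuous_intros cu continuous_on_compose2[OF smooth_continuous_on[OF smooth_partial_deriv[OF mollifier_smooth[OF \<delta>(1)[of k]]], of UNIV]]) auto
    have "grad (\<psi> k) z $ i = integral (cbox a b) ?f"
      by (simp add: grad_def \<psi>_def partial_deriv_convol[OF cu mollifier_smooth[OF \<delta>(1)]] convol_def)
    also have "\<dots> = (LINT t:cbox a b|lebesgue. ?f t)"
      by (rule set_lebesgue_integral_eq_integral(2)[symmetric])
         (intro absolutely_integrable_continuous continuous_on_subset[OF cf] subset_UNIV)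
    also have "\<dots> = (LINT t:ball z (\<delta> k)|lebesgue. ?f t)"
      using sub[OF zc, of k] ball_subset_cball[of z "\<delta> k"] f0 by (intro set_lebesgue_integral_support) auto
    also have "\<dots> = (LINT t:ball y r|lebesgue. ?f t)"
    proof (rule set_lebesgue_integral_support[symmetric])
      show "ball z (\<delta> k) \<subseteq> ball y r"
        using z d \<delta>(2)[of k] by (simp add: ball_subset_ball_iff dist_commute)
    qed (use f0 in auto)
    also have "\<dots> = - (LINT t:ball y r|lebesgue. u t * partial_deriv i (\<lambda>t. mollifier (\<delta> k) (z - t)) t)"
      by (simp add: mollifier_partial_deriv[OF \<delta>(1)] set_lebesgue_integral_def)
    also have "\<dots> = (LINT t:ball y r|lebesgue. G t $ i * mollifier (\<delta> k) (z - t))"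
      using G t by (simp add: has_weak_gradient_def)
    finally show ?thesis by (simp add: M_def)
  qed
  have GL: "L1_loc (ball y r) (\<lambda>t. G t $ i)" for i
    using G by (auto simp: has_weak_gradient_def intro: L1_loc_component)
  have M0: "(\<lambda>k. \<integral>\<^sup>+z\<in>ball y d. ennreal \<bar>M i k z\<bar> \<partial>lebesgue) \<longlonglongrightarrow> 0"
    "(\<lambda>z. M i k z * indicat_real (ball y d) z) \<in> borel_measurable lebesgue" for i k
    unfolding M_def by (rule mollify_L1_loc[OF GL d \<delta> \<delta>0])+
  \<comment> \<open>All components are collected in one function, so that a single subsequence
    serves them all.\<close>
  define N where "N = (\<lambda>k z. (\<Sum>i\<in>UNIV. \<bar>M i k z\<bar>) * indicat_real (ball y d) z)"
  have Nint: "(\<integral>\<^sup>+z. ennreal (N k z) \<partial>lebesgue) = (\<Sum>i\<in>UNIV. \<integral>\<^sup>+z\<in>ball y d. ennreal \<bar>M i k z\<bar> \<partial>lebesgue)"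
    and Nm: "N k \<in> borel_measurable lebesgue" for k
  proof -
    have m: "(\<lambda>z. \<bar>M i k z * indicat_real (ball y d) z\<bar>) \<in> borel_measurable lebesgue" for i
      using M0(2)[of i k] by auto
    have N_alt: "N k = (\<lambda>z. \<Sum>i\<in>UNIV. \<bar>M i k z * indicat_real (ball y d) z\<bar>)"
      by (auto simp: N_def sum_distrib_right abs_mult)
    show "N k \<in> borel_measurable lebesgue" unfolding N_alt using m by auto
    have "(\<integral>\<^sup>+z. ennreal (N k z) \<partial>lebesgue) = (\<integral>\<^sup>+z. (\<Sum>i\<in>UNIV. ennreal \<bar>M i k z * indicat_real (ball y d) z\<bar>) \<partial>lebesgue)"
      by (simp add: N_alt sum_ennreal)
    also have "\<dots> = (\<Sum>i\<in>UNIV. \<integral>\<^sup>+z. ennreal \<bar>M i k z * indicat_real (ball y d) z\<bar> \<partial>lebesgue)"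
      using m by (intro nn_integral_sum) auto
    also have "\<dots> = (\<Sum>i\<in>UNIV. \<integral>\<^sup>+z\<in>ball y d. ennreal \<bar>M i k z\<bar> \<partial>lebesgue)"
      by (intro sum.cong refl nn_integral_cong) (auto split: split_indicator)
    finally show "(\<integral>\<^sup>+z. ennreal (N k z) \<partial>lebesgue) = (\<Sum>i\<in>UNIV. \<integral>\<^sup>+z\<in>ball y d. ennreal \<bar>M i k z\<bar> \<partial>lebesgue)" .
  qed
  have N_nonneg: "0 \<le> N k z" for k z by (simp add: N_def sum_nonneg)
  have "(\<lambda>k. \<integral>\<^sup>+z. ennreal (N k z) \<partial>lebesgue) \<longlonglongrightarrow> (\<Sum>i\<in>(UNIV::'n set). 0)"
    unfolding Nint by (intro tendsto_sum M0(1))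
  then have N0: "(\<lambda>k. \<integral>\<^sup>+z. ennreal (N k z) \<partial>lebesgue) \<longlonglongrightarrow> 0" by simp
  \<comment> \<open>Integrability of every term is required for the subsequence; finiteness of the
    integrals is known only from some index on, hence the shift by \<open>k0\<close>.\<close>
  obtain k0 where k0: "\<And>k. k0 \<le> k \<Longrightarrow> (\<integral>\<^sup>+z. ennreal (N k z) \<partial>lebesgue) < 1"
    using order_tendstoD(2)[OF N0, of 1] by (auto simp: eventually_sequentially)
  have Ni: "integrable lebesgue (N (k + k0))" for k
    using k0[of "k + k0"] Nm N_nonneg by (intro integrableI_nonneg) (auto intro: less_trans)
  have "(\<lambda>k. LINT z|lebesgue. norm (N (k + k0) z)) \<longlonglongrightarrow> 0"
  proof -
    have "ennreal (LINT z|lebesgue. norm (N (k + k0) z)) = (\<integral>\<^sup>+z. ennreal (N (k + k0) z) \<partial>lebesgue)" for k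
      using nn_integral_eq_integral[OF Ni, of k] N_nonneg by simp
    then have "(\<lambda>k. ennreal (LINT z|lebesgue. norm (N (k + k0) z))) \<longlonglongrightarrow> ennreal 0"
      using LIMSEQ_ignore_initial_segment[OF N0, of k0] by simp
    then show ?thesis by (subst (asm) tendsto_ennreal_iff) (auto intro!: always_eventually)
  qed
  from tendsto_L1_AE_subseq[OF Ni this] obtain s where s: "strict_mono s"
    and ae: "AE z in lebesgue. (\<lambda>k. N (s k + k0) z) \<longlonglongrightarrow> 0" by blast
  show thesis
  proof (rule that)
    show "\<forall>k. smooth (\<psi> (s k + k0))" using sm by blast
    show "\<forall>k. \<forall>z\<in>cball y d. \<bar>\<psi> (s k + k0) z - u z\<bar> \<le> L * \<delta> (s k + k0)"
      using unif by blast
    show "\<forall>k. \<forall>z\<in>ball y d. norm (grad (\<psi> (s k + k0)) z) \<le> L"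
      using gb by blast
    have "(\<lambda>k. L * \<delta> (s k + k0)) \<longlonglongrightarrow> L * 0"
    proof (intro tendsto_intros filterlim_compose[OF \<delta>0])
      show "filterlim (\<lambda>k. s k + k0) at_top sequentially"
        by (rule filterlim_subseq) (use s in \<open>simp add: strict_mono_def\<close>)
    qed
    then show "(\<lambda>k. L * \<delta> (s k + k0)) \<longlonglongrightarrow> 0" by simp
    show "AE z in lebesgue. z \<in> ball y d \<longrightarrow> (\<lambda>k. grad (\<psi> (s k + k0)) z) \<longlonglongrightarrow> G z"
      using ae
    proof eventually_elim
      case (elim z)
      show ?case
      proof
        assume z: "z \<in> ball y d"
        show "(\<lambda>k. grad (\<psi> (s k + k0)) z) \<longlonglongrightarrow> G z"
        proof (rule vec_tendstoI)
          fix i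
          have "(\<lambda>k. grad (\<psi> (s k + k0)) z $ i - G z $ i) \<longlonglongrightarrow> 0"
          proof (rule Lim_null_comparison[OF always_eventually elim], intro allI)
            fix k
            have "\<bar>M i (s k + k0) z\<bar> \<le> (\<Sum>i\<in>UNIV. \<bar>M i (s k + k0) z\<bar>)"
              by (rule member_le_sum) auto
            then show "norm (grad (\<psi> (s k + k0)) z $ i - G z $ i) \<le> N (s k + k0) z"
              using z by (simp add: gM N_def)
          qed
          then show "(\<lambda>k. grad (\<psi> (s k + k0)) z $ i) \<longlonglongrightarrow> G z $ i" by (rule Lim_null[THEN iffD2])
        qed
      qed
    qed
  qed
qed

section \<open>Competitors\<close>

lemma integral_lborel_reflect:
  fixes f :: "'a::euclidean_space \<Rightarrow> real"
  assumes "f \<in> borel_measurable borel"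
  shows "(LINT t|lborel. f (z - t)) = (LINT t|lborel. f t)"
proof -
  have "lborel = density (distr lborel borel (\<lambda>x::'a. z + (-1) *\<^sub>R x)) (\<lambda>_. ennreal (\<bar>- 1 :: real\<bar> ^ DIM('a)))"
    by (rule lborel_affine) simp
  also have "\<dots> = distr lborel borel (\<lambda>x::'a. z - x)" by (simp add: density_1)
  finally have "(LINT t|lborel. f t) = (LINT t|distr lborel borel (\<lambda>x::'a. z - x). f t)" by simp
  also have "\<dots> = (LINT t|lborel. f (z - t))" by (rule integral_distr) (use assms in auto)
  finally show ?thesis by simp
qed

text \<open>Convolving \<open>K\<close> with the constant 1 over a large box gives the integral of
  \<open>K\<close> for all \<open>z\<close> near 0, by reflection and translation invariance. Its
  derivative at 0 therefore vanishes, and that derivative is the integral of the partial derivative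
  of \<open>K\<close>.\<close>

lemma integral_partial_deriv_test_function:
  fixes K :: "real^'n::finite \<Rightarrow> real"
  assumes K: "test_function U K"
  shows "(LINT t|lborel. partial_deriv i K t) = 0"
proof -
  have sK: "smooth K" using K by (simp add: test_function_def)
  have "bounded (closure {x. K x \<noteq> 0})" using K by (simp add: test_function_def compact_imp_bounded)
  then obtain R where R: "\<And>x. x \<in> closure {x. K x \<noteq> 0} \<Longrightarrow> norm x \<le> R" by (auto simp: bounded_iff)
  have K0: "K x = 0" if "x \<notin> cball 0 R" for x
    using R[of x] closure_subset[of "{x. K x \<noteq> 0}"] that by auto
  have D0: "partial_deriv i K x = 0" if "x \<notin> cball 0 R" for x
    using R[of x] partial_deriv_zero_outside[of x K i] that by auto
  obtain a b where ab: "cball (0::real^'n) (R + 1) \<subseteq> cbox a b"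
    using bounded_subset_cbox_symmetric[OF bounded_cball] by metis
  have const: "convol a b (\<lambda>_. 1) f z = (LINT t|lborel. f t)"
    if z: "z \<in> ball 0 1" and f: "continuous_on UNIV f" "\<And>x. x \<notin> cball 0 R \<Longrightarrow> f x = 0" for z f
  proof -
    have f0: "f (z - t) = 0" if "t \<notin> cbox a b" for t
    proof (rule f(2))
      have "t \<notin> cball 0 (R + 1)" using that ab by blast
      then have "R + 1 < norm t" by simp
      then show "z - t \<notin> cball 0 R" using z norm_triangle_ineq2[of t z] by (auto simp: norm_minus_commute)
    qed
    have "integrable lborel (\<lambda>t. f (z - t))"
    proof (rule integrable_lborel_continuous_support)
      show "continuous_on UNIV (\<lambda>t. f (z - t))"
        by (intro continuous_on_compose2[OF f(1)] continuous_intros) auto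
      show "f (z - x) = 0" if "x \<notin> cball z R" for x
        using f(2)[of "z - x"] that by (simp add: dist_norm norm_minus_commute[of x z])
    qed
    then have "(LINT t|lborel. f (z - t)) = integral UNIV (\<lambda>t. f (z - t))" by (simp add: integral_lborel)
    also have "integral UNIV (\<lambda>t. f (z - t)) = integral UNIV (\<lambda>t. if t \<in> cbox a b then f (z - t) else 0)"
      using f0 by (intro arg_cong[of _ _ "integral UNIV"]) auto
    also have "\<dots> = convol a b (\<lambda>_. 1) f z"
      unfolding convol_def by (simp only: integral_restrict_UNIV mult_1)
    finally show ?thesis
      using integral_lborel_reflect[OF borel_measurable_continuous_onI[OF f(1)], of z] by simp
  qed
  have "(convol a b (\<lambda>_. 1) K has_derivative (\<lambda>_. 0)) (at 0)"
  proof (rule has_derivative_transform_within_open)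
    show "((\<lambda>_. LINT t|lborel. K t) has_derivative (\<lambda>_. 0)) (at (0::real^'n))" by simp
    show "(LINT t|lborel. K t) = convol a b (\<lambda>_. 1) K z" if "z \<in> ball 0 1" for z
      using const[OF that smooth_continuous_on[OF sK] K0] by simp
  qed auto
  then have "0 = partial_deriv i (convol a b (\<lambda>_. 1) K) 0"
    by (rule partial_deriv_eqI[symmetric])
  also have "\<dots> = convol a b (\<lambda>_. 1) (partial_deriv i K) 0"
    by (simp only: partial_deriv_convol[OF continuous_on_const sK])
  also have "\<dots> = (LINT t|lborel. partial_deriv i K t)"
    by (rule const[OF _ smooth_continuous_on[OF smooth_partial_deriv[OF sK]] D0]) simp
  finally show ?thesis by simp
qed

text \<open>The product lives on the support of \<phi>, a compact subset of \<open>U\<close>, where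
  \<open>f\<close> is integrable and \<phi> bounded.\<close>

lemma set_integrable_test_function_mult:
  fixes f :: "real^'n::finite \<Rightarrow> real"
  assumes f: "L1_loc U f" and t: "test_function U \<phi>"
  shows "set_integrable lebesgue U (\<lambda>y. f y * \<phi> y)"
proof -
  let ?K = "closure {x. \<phi> x \<noteq> 0}"
  have K: "compact ?K" "?K \<subseteq> U" using t by (auto simp: test_function_def)
  have fK: "integrable lebesgue (\<lambda>x. indicat_real ?K x * f x)"
    using f K by (auto simp: L1_loc_def set_integrable_def)
  obtain C where C: "\<And>x. \<bar>\<phi> x\<bar> \<le> C" using test_function_bounded[OF t] by blast
  have "integrable lebesgue (\<lambda>x. (indicat_real ?K x * f x) * \<phi> x)"
  proof (rule Bochner_Integration.integrable_bound)
    show "integrable lebesgue (\<lambda>x. (indicat_real ?K x * f x) * C)" using fK by simp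
    have "\<phi> \<in> borel_measurable lebesgue"
      by (intro borel_measurable_lebesgue_continuous smooth_continuous_on test_function_smooth[OF t])
    then show "(\<lambda>x. indicat_real ?K x * f x * \<phi> x) \<in> borel_measurable lebesgue"
      using fK by (auto intro!: borel_measurable_times)
    show "AE x in lebesgue. norm (indicat_real ?K x * f x * \<phi> x) \<le> norm (indicat_real ?K x * f x * C)"
    proof (rule AE_I2)
      fix x
      have "\<bar>\<phi> x\<bar> \<le> \<bar>C\<bar>" using C[of x] by linarith
      then show "norm (indicat_real ?K x * f x * \<phi> x) \<le> norm (indicat_real ?K x * f x * C)"
        by (simp add: abs_mult mult_left_mono)
    qed
  qed
  also have "(\<lambda>x. (indicat_real ?K x * f x) * \<phi> x) = (\<lambda>x. indicat_real U x *\<^sub>R (f x * \<phi> x))"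
  proof
    fix x show "(indicat_real ?K x * f x) * \<phi> x = indicat_real U x *\<^sub>R (f x * \<phi> x)"
      using K(2) closure_subset[of "{x. \<phi> x \<noteq> 0}"] by (cases "\<phi> x = 0"; cases "x \<in> ?K") auto
  qed
  finally show ?thesis by (simp add: set_integrable_def)
qed

text \<open>The product of \<open>f\<close> and \<phi> is itself a test function, so the integral of
  its partial derivative is 0; the product rule does the rest.\<close>

lemma integration_by_parts_test_functions:
  fixes f \<phi> :: "real^'n::finite \<Rightarrow> real"
  assumes f: "smooth f" and t: "test_function U \<phi>"
  shows "(LINT y:U|lebesgue. f y * partial_deriv i \<phi> y) = - (LINT y:U|lebesgue. partial_deriv i f y * \<phi> y)"
proof -
  have p: "partial_deriv i (\<lambda>y. f y * \<phi> y) y = f y * partial_deriv i \<phi> y + partial_deriv i f y * \<phi> y" for y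
    by (rule partial_deriv_mult[OF smooth_differentiable[OF f] smooth_differentiable[OF test_function_smooth[OF t]]])
  have L: "L1_loc U g" if "smooth g" for g :: "real^'n \<Rightarrow> real"
    unfolding L1_loc_def
    by (auto intro!: absolutely_integrable_continuous_compact smooth_continuous_on that)
  have "0 = (LINT y|lborel. partial_deriv i (\<lambda>y. f y * \<phi> y) y)"
    by (rule integral_partial_deriv_test_function[OF test_function_mult[OF t f], symmetric])
  also have "\<dots> = (LINT y|lebesgue. partial_deriv i (\<lambda>y. f y * \<phi> y) y)"
  proof (rule integral_completion[symmetric])
    have "continuous_on UNIV (partial_deriv i (\<lambda>y. f y * \<phi> y))"
      by (intro smooth_continuous_on smooth_partial_deriv smooth_mult f test_function_smooth[OF t])
    then show "partial_deriv i (\<lambda>y. f y * \<phi> y) \<in> borel_measurable lborel"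
      using borel_measurable_continuous_onI by simp
  qed
  also have "\<dots> = (LINT y:U|lebesgue. partial_deriv i (\<lambda>y. f y * \<phi> y) y)"
    unfolding set_lebesgue_integral_def
  proof (intro Bochner_Integration.integral_cong refl)
    fix y show "partial_deriv i (\<lambda>y. f y * \<phi> y) y = indicat_real U y *\<^sub>R partial_deriv i (\<lambda>y. f y * \<phi> y) y"
      using test_function_partial_deriv_eq_0[OF test_function_mult[OF t f], of y i]
      by (cases "y \<in> U") auto
  qed
  also have "\<dots> = (LINT y:U|lebesgue. f y * partial_deriv i \<phi> y) + (LINT y:U|lebesgue. partial_deriv i f y * \<phi> y)"
    unfolding p
    by (intro set_integral_add set_integrable_test_function_mult L f smooth_partial_deriv t test_function_partial_deriv)
  finally show ?thesis by simp
qed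

lemma L1_loc_add: "L1_loc U f \<Longrightarrow> L1_loc U g \<Longrightarrow> L1_loc U (\<lambda>x. f x + g x)"
  unfolding L1_loc_def by (auto intro: set_integral_add(1))

lemma L1_loc_mult_continuous:
  fixes f :: "real^'n::finite \<Rightarrow> 'b::euclidean_space"
  assumes f: "L1_loc U f" and a: "continuous_on U a"
  shows "L1_loc U (\<lambda>x. a x *\<^sub>R f x)"
  unfolding L1_loc_def
proof (intro allI impI)
  fix K assume K: "compact K \<and> K \<subseteq> U"
  have bil: "bilinear ((*\<^sub>R) :: real \<Rightarrow> 'b \<Rightarrow> 'b)"
    by (simp add: bilinear_conv_bounded_bilinear bounded_bilinear_scaleR)
  have aK: "continuous_on K a" using a K continuous_on_subset by blast
  show "(\<lambda>x. a x *\<^sub>R f x) absolutely_integrable_on K"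
  proof (rule absolutely_integrable_bounded_measurable_product[OF bil])
    have sK: "K \<in> sets lebesgue" using K by (auto intro: lmeasurable_compact fmeasurableD)
    show "K \<in> sets lebesgue" by fact
    show "a \<in> borel_measurable (lebesgue_on K)"
      using aK sK by (rule continuous_imp_measurable_on_sets_lebesgue)
    show "bounded (a ` K)" using aK K by (intro compact_imp_bounded compact_continuous_image) auto
    show "f absolutely_integrable_on K" using f K by (auto simp: L1_loc_def)
  qed
qed

lemma L1_loc_continuous:
  fixes f :: "real^'n::finite \<Rightarrow> 'b::euclidean_space"
  assumes "continuous_on U f"
  shows "L1_loc U f"
  unfolding L1_loc_def
proof (intro allI impI)
  fix K assume K: "compact K \<and> K \<subseteq> U"
  show "f absolutely_integrable_on K"
    by (rule absolutely_integrable_continuous_compact[OF conjunct1[OF K] continuous_on_subset[OF assms conjunct2[OF K]]])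
qed

section \<open>The family of modified functions and their gradients\<close>

text \<open>One family for both comparisons: \<Psi> = 0 raises \<open>u\<close> by \<Phi>, \<Phi> =
  0 cuts \<open>u\<close> off, and \<Psi> = \<Phi> = 0 returns \<open>u\<close> itself, which lets
  \<open>u\<close> and its competitors share the same lemmas.\<close>

definition modify :: "(real^'n::finite \<Rightarrow> real) \<Rightarrow> (real^'n \<Rightarrow> real) \<Rightarrow> (real^'n \<Rightarrow> real) \<Rightarrow> real^'n \<Rightarrow> real" where
  "modify \<Psi> \<Phi> u z = (1 - \<Psi> z) * u z + \<Phi> z"

definition modify_grad :: "(real^'n::finite \<Rightarrow> real) \<Rightarrow> (real^'n \<Rightarrow> real) \<Rightarrow> (real^'n \<Rightarrow> real)
    \<Rightarrow> (real^'n \<Rightarrow> real^'n) \<Rightarrow> real^'n \<Rightarrow> real^'n" where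
  "modify_grad \<Psi> \<Phi> u G z = (1 - \<Psi> z) *\<^sub>R G z - u z *\<^sub>R grad \<Psi> z + grad \<Phi> z"

lemma smooth_one_minus: "smooth \<Psi> \<Longrightarrow> smooth (\<lambda>x. 1 - \<Psi> x)"
  using smooth_add[OF smooth_const[of 1] smooth_mult[OF smooth_const[of "- 1"], of \<Psi>]] by simp

lemma grad_one_minus:
  assumes "smooth \<Psi>"
  shows "grad (\<lambda>x. 1 - \<Psi> x) x = - grad \<Psi> x"
proof -
  have "(\<Psi> has_derivative frechet_derivative \<Psi> (at x)) (at x)"
    using smooth_differentiable[OF assms] frechet_derivative_works by blast
  from partial_deriv_eqI[OF has_derivative_diff[OF has_derivative_const this]]
  show ?thesis by (simp add: grad_def vec_eq_iff partial_deriv_def)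
qed

lemma grad_modify:
  assumes "smooth \<Psi>" "smooth \<Phi>" "smooth \<phi>"
  shows "smooth (modify \<Psi> \<Phi> \<phi>)" "grad (modify \<Psi> \<Phi> \<phi>) z = modify_grad \<Psi> \<Phi> \<phi> (grad \<phi>) z"
proof -
  note s = smooth_mult[OF smooth_one_minus[OF assms(1)] assms(3)]
  show "smooth (modify \<Psi> \<Phi> \<phi>)"
    unfolding modify_def[abs_def] by (intro smooth_add s assms)
  have "grad (modify \<Psi> \<Phi> \<phi>) z = grad (\<lambda>x. (1 - \<Psi> x) * \<phi> x) z + grad \<Phi> z"
    unfolding modify_def[abs_def]
    by (rule grad_add[OF smooth_differentiable[OF s] smooth_differentiable[OF assms(2)]])
  also have "grad (\<lambda>x. (1 - \<Psi> x) * \<phi> x) z = (1 - \<Psi> z) *\<^sub>R grad \<phi> z + \<phi> z *\<^sub>R grad (\<lambda>x. 1 - \<Psi> x) z"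
    by (rule grad_mult[OF smooth_differentiable[OF smooth_one_minus[OF assms(1)]] smooth_differentiable[OF assms(3)]])
  also have "grad (\<lambda>x. 1 - \<Psi> x) z = - grad \<Psi> z"
    by (rule grad_one_minus[OF assms(1)])
  finally show "grad (modify \<Psi> \<Phi> \<phi>) z = modify_grad \<Psi> \<Phi> \<phi> (grad \<phi>) z"
    by (simp add: modify_grad_def)
qed

text \<open>For a test function \<zeta>, also (1 - \<Psi>) \<zeta> is a test function; applying the
  weak gradient of \<open>u\<close> to it produces the product rule, the surplus term u \<zeta> grad
  \<Psi> being integrable. The summand \<Phi> is covered by classical integration by parts.\<close>

lemma has_weak_gradient_modify:
  fixes u :: "real^'n::finite \<Rightarrow> real"
  assumes G: "has_weak_gradient U u G" and \<Psi>: "smooth \<Psi>" and \<Phi>: "smooth \<Phi>"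
  shows "has_weak_gradient U (modify \<Psi> \<Phi> u) (modify_grad \<Psi> \<Phi> u G)"
proof -
  have u: "L1_loc U u" and LG: "L1_loc U G" using G by (auto simp: has_weak_gradient_def)
  note \<Psi>' = smooth_one_minus[OF \<Psi>]
  have Lu: "L1_loc U (\<lambda>x. (1 - \<Psi> x) * u x)"
    using L1_loc_mult_continuous[OF u smooth_continuous_on[OF \<Psi>']] by simp
  have L\<Phi>: "L1_loc U \<Phi>" by (intro L1_loc_continuous smooth_continuous_on \<Phi>)
  have L1: "L1_loc U (modify \<Psi> \<Phi> u)"
    unfolding modify_def[abs_def] by (intro L1_loc_add Lu L\<Phi>)
  have "L1_loc U (\<lambda>x. u x *\<^sub>R grad \<Psi> x)"
  proof -
    have "L1_loc U (\<lambda>x. u x * partial_deriv i \<Psi> x)" for i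
      using L1_loc_mult_continuous[OF u smooth_continuous_on[OF smooth_partial_deriv[OF \<Psi>]], of i]
      by (simp add: mult.commute)
    moreover have "(\<lambda>x. (u x *\<^sub>R grad \<Psi> x) \<bullet> axis i 1) = (\<lambda>x. u x * partial_deriv i \<Psi> x)" for i
      by (simp add: inner_axis grad_def)
    ultimately have *: "L1_loc U (\<lambda>x. (u x *\<^sub>R grad \<Psi> x) \<bullet> axis i 1)" for i by (simp only:)
    show ?thesis
      unfolding L1_loc_def
    proof (intro allI impI, rule absolutely_integrable_componentwise)
      fix K and b :: "real^'n" assume K: "compact K \<and> K \<subseteq> U" and bB: "b \<in> Basis"
      obtain i where b: "b = axis i 1" using bB unfolding Basis_vec_def Basis_real_def by blast
      show "(\<lambda>x. (u x *\<^sub>R grad \<Psi> x) \<bullet> b) absolutely_integrable_on K"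
        unfolding b by (rule *[of i, unfolded L1_loc_def, rule_format, OF K])
    qed
  qed
  from L1_loc_mult_continuous[OF this continuous_on_const[of U "-1"]]
  have L2: "L1_loc U (\<lambda>x. - (u x *\<^sub>R grad \<Psi> x))" by simp
  have "L1_loc U (\<lambda>x. (1 - \<Psi> x) *\<^sub>R G x + - (u x *\<^sub>R grad \<Psi> x) + grad \<Phi> x)"
    by (intro L1_loc_add L2 L1_loc_continuous continuous_on_grad \<Phi>
        L1_loc_mult_continuous[OF LG smooth_continuous_on[OF \<Psi>']])
  then have L3: "L1_loc U (modify_grad \<Psi> \<Phi> u G)"
    by (simp add: modify_grad_def[abs_def])
  have "(LINT y:U|lebesgue. modify \<Psi> \<Phi> u y * partial_deriv i \<zeta> y)
      = - (LINT y:U|lebesgue. modify_grad \<Psi> \<Phi> u G y $ i * \<zeta> y)" if t: "test_function U \<zeta>" for \<zeta> i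
  proof -
    let ?\<eta> = "\<lambda>x. (1 - \<Psi> x) * \<zeta> x"
    have t\<eta>: "test_function U ?\<eta>" by (rule test_function_mult[OF t \<Psi>'])
    have p\<Psi>: "partial_deriv i (\<lambda>x. 1 - \<Psi> x) x = - partial_deriv i \<Psi> x" for x
      using grad_one_minus[OF \<Psi>, of x] by (simp add: grad_def vec_eq_iff)
    have p: "partial_deriv i ?\<eta> x = (1 - \<Psi> x) * partial_deriv i \<zeta> x - partial_deriv i \<Psi> x * \<zeta> x" for x
      using partial_deriv_mult[OF smooth_differentiable[OF \<Psi>'] smooth_differentiable[OF test_function_smooth[OF t]], of i x]
      by (simp add: p\<Psi>)
    have t\<Psi>: "test_function U (\<lambda>x. partial_deriv i \<Psi> x * \<zeta> x)"
      by (rule test_function_mult[OF t smooth_partial_deriv[OF \<Psi>]])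
    note int = set_integrable_test_function_mult
    have i1: "set_integrable lebesgue U (\<lambda>y. u y * partial_deriv i ?\<eta> y)"
      by (rule int[OF u test_function_partial_deriv[OF t\<eta>]])
    have i2: "set_integrable lebesgue U (\<lambda>y. u y * (partial_deriv i \<Psi> y * \<zeta> y))"
      by (rule int[OF u t\<Psi>])
    have i3: "set_integrable lebesgue U (\<lambda>y. \<Phi> y * partial_deriv i \<zeta> y)"
      by (rule int[OF L\<Phi> test_function_partial_deriv[OF t]])
    have i4: "set_integrable lebesgue U (\<lambda>y. G y $ i * ?\<eta> y)"
      by (rule int[OF L1_loc_component[OF LG] t\<eta>])
    have i5: "set_integrable lebesgue U (\<lambda>y. partial_deriv i \<Phi> y * \<zeta> y)"
      by (rule int[OF L1_loc_continuous[OF smooth_continuous_on[OF smooth_partial_deriv[OF \<Phi>]]] t])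
    have "(LINT y:U|lebesgue. modify \<Psi> \<Phi> u y * partial_deriv i \<zeta> y)
        = (LINT y:U|lebesgue. (u y * partial_deriv i ?\<eta> y + u y * (partial_deriv i \<Psi> y * \<zeta> y)) + \<Phi> y * partial_deriv i \<zeta> y)"
    proof -
      have "modify \<Psi> \<Phi> u y * partial_deriv i \<zeta> y
          = (u y * partial_deriv i ?\<eta> y + u y * (partial_deriv i \<Psi> y * \<zeta> y)) + \<Phi> y * partial_deriv i \<zeta> y" for y
        unfolding modify_def p by (simp add: ring_distribs)
      then show ?thesis by (simp only:)
    qed
    also have "\<dots> = (LINT y:U|lebesgue. u y * partial_deriv i ?\<eta> y)
        + (LINT y:U|lebesgue. u y * (partial_deriv i \<Psi> y * \<zeta> y)) + (LINT y:U|lebesgue. \<Phi> y * partial_deriv i \<zeta> y)"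
      by (simp only: set_integral_add[OF set_integral_add(1)[OF i1 i2] i3] set_integral_add[OF i1 i2])
    also have "(LINT y:U|lebesgue. u y * partial_deriv i ?\<eta> y) = - (LINT y:U|lebesgue. G y $ i * ?\<eta> y)"
      using G t\<eta> by (auto simp: has_weak_gradient_def)
    also have "(LINT y:U|lebesgue. \<Phi> y * partial_deriv i \<zeta> y) = - (LINT y:U|lebesgue. partial_deriv i \<Phi> y * \<zeta> y)"
      by (rule integration_by_parts_test_functions[OF \<Phi> t])
    also have "- (LINT y:U|lebesgue. G y $ i * ?\<eta> y) + (LINT y:U|lebesgue. u y * (partial_deriv i \<Psi> y * \<zeta> y))
          + - (LINT y:U|lebesgue. partial_deriv i \<Phi> y * \<zeta> y)
        = - (LINT y:U|lebesgue. (G y $ i * ?\<eta> y - u y * (partial_deriv i \<Psi> y * \<zeta> y)) + partial_deriv i \<Phi> y * \<zeta> y)"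
      by (simp add: set_integral_add[OF set_integral_diff(1)[OF i4 i2] i5] set_integral_diff[OF i4 i2])
    also have "(LINT y:U|lebesgue. (G y $ i * ?\<eta> y - u y * (partial_deriv i \<Psi> y * \<zeta> y)) + partial_deriv i \<Phi> y * \<zeta> y)
        = (LINT y:U|lebesgue. modify_grad \<Psi> \<Phi> u G y $ i * \<zeta> y)"
    proof -
      have "(G y $ i * ?\<eta> y - u y * (partial_deriv i \<Psi> y * \<zeta> y)) + partial_deriv i \<Phi> y * \<zeta> y
          = modify_grad \<Psi> \<Phi> u G y $ i * \<zeta> y" for y
        unfolding modify_grad_def grad_def by (simp add: ring_distribs)
      then show ?thesis by (simp only:)
    qed
    finally show ?thesis .
  qed
  then show ?thesis using L1 L3 by (auto simp: has_weak_gradient_def)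
qed

section \<open>Traces\<close>

text \<open>The surface measure is a multiple of the image of Lebesgue measure under the radial
  projection, so a bound on the sphere pulls back to the ball. The projection is degenerate only at
  the centre, a null set.\<close>

lemma nn_integral_sphere_measure_le:
  fixes y :: "real^'n::finite"
  assumes d: "0 < d" and f: "f \<in> borel_measurable borel" and le: "\<And>z. z \<in> sphere y d \<Longrightarrow> f z \<le> c"
  shows "(\<integral>\<^sup>+z. f z \<partial>sphere_measure y d) \<le> ennreal (real CARD('n) / d) * (c * emeasure lborel (ball y d))"
proof -
  let ?p = "\<lambda>w. y + (d / norm (w - y)) *\<^sub>R (w - y)"
  have "?p \<in> borel_measurable borel" by measurable
  then have p: "?p \<in> restrict_space lborel (ball y d) \<rightarrow>\<^sub>M borel"
    by (intro measurable_restrict_space1) simp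
  have "(\<integral>\<^sup>+z. f z \<partial>sphere_measure y d)
      = ennreal (real CARD('n) / d) * (\<integral>\<^sup>+w. f (?p w) \<partial>restrict_space lborel (ball y d))"
    unfolding sphere_measure_def
    by (subst nn_integral_scale_measure) (use f p in \<open>simp_all add: nn_integral_distr\<close>)
  also have "(\<integral>\<^sup>+w. f (?p w) \<partial>restrict_space lborel (ball y d)) = (\<integral>\<^sup>+w\<in>ball y d. f (?p w) \<partial>lborel)"
    by (rule nn_integral_restrict_space) simp
  also have "\<dots> \<le> (\<integral>\<^sup>+w. c * indicator (ball y d) w \<partial>lborel)"
  proof (rule nn_integral_mono_AE)
    have "AE w in lborel. w \<noteq> y" by (rule AE_lborel_singleton)
    then show "AE w in lborel. f (?p w) * indicator (ball y d) w \<le> c * indicator (ball y d) w"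
    proof eventually_elim
      case (elim w)
      then have "?p w \<in> sphere y d" using d by (simp add: dist_norm)
      then show ?case by (intro mult_right_mono le) auto
    qed
  qed
  also have "\<dots> = c * emeasure lborel (ball y d)" by (rule nn_integral_cmult_indicator) simp
  finally show ?thesis by (simp add: mult_left_mono)
qed

lemma sets_sphere_measure [simp]: "sets (sphere_measure y d) = sets borel"
  by (simp add: sphere_measure_def)

lemma has_weak_gradient_cong:
  assumes "has_weak_gradient U u G" "\<And>z. z \<in> U \<Longrightarrow> v z = u z"
  shows "has_weak_gradient U v G"
proof -
  have "L1_loc U v"
    unfolding L1_loc_def
  proof (intro allI impI)
    fix K assume K: "compact K \<and> K \<subseteq> U"
    then have "u absolutely_integrable_on K" using assms(1) by (auto simp: has_weak_gradient_def L1_loc_def)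
    moreover have "indicat_real K x *\<^sub>R u x = indicat_real K x *\<^sub>R v x" for x
      using K assms(2) by (auto split: split_indicator)
    ultimately show "v absolutely_integrable_on K" by (simp only: set_integrable_def)
  qed
  moreover have "(LINT z:U|lebesgue. v z * f z) = (LINT z:U|lebesgue. u z * f z)" for f
    unfolding set_lebesgue_integral_def
    by (rule Bochner_Integration.integral_cong) (use assms(2) in \<open>auto split: split_indicator\<close>)
  ultimately show ?thesis using assms(1) by (simp add: has_weak_gradient_def)
qed

lemma nn_integral_set_eq_set_integral:
  fixes f :: "'a \<Rightarrow> real"
  assumes "set_integrable M A f" "\<And>x. x \<in> A \<Longrightarrow> 0 \<le> f x"
  shows "(\<integral>\<^sup>+x\<in>A. ennreal (f x) \<partial>M) = ennreal (LINT x:A|M. f x)"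
proof -
  have "(\<integral>\<^sup>+x\<in>A. ennreal (f x) \<partial>M) = (\<integral>\<^sup>+x. ennreal (indicat_real A x *\<^sub>R f x) \<partial>M)"
    by (rule nn_integral_cong) (auto split: split_indicator)
  also have "\<dots> = ennreal (LINT x:A|M. f x)"
    using assms unfolding set_integrable_def set_lebesgue_integral_def
    by (intro nn_integral_eq_integral) (auto split: split_indicator)
  finally show ?thesis .
qed

lemma set_integrable_ball_bounded:
  fixes f :: "'a::euclidean_space \<Rightarrow> real"
  assumes m: "(\<lambda>x. indicat_real (ball y d) x * f x) \<in> borel_measurable lebesgue"
    and b: "AE x in lebesgue. x \<in> ball y d \<longrightarrow> \<bar>f x\<bar> \<le> C"
  shows "set_integrable lebesgue (ball y d) f"
  unfolding set_integrable_def
proof (rule Bochner_Integration.integrable_bound)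
  show "integrable lebesgue (\<lambda>x. C * indicat_real (ball y d) x)"
    by (intro integrable_mult_right integrable_real_indicator)
       (use emeasure_lborel_ball_finite in \<open>auto simp: less_top\<close>)
  show "(\<lambda>x. indicat_real (ball y d) x *\<^sub>R f x) \<in> borel_measurable lebesgue"
    using m by simp
  show "AE x in lebesgue. norm (indicat_real (ball y d) x *\<^sub>R f x) \<le> norm (C * indicat_real (ball y d) x)"
    using b by eventually_elim (auto split: split_indicator)
qed

section \<open>Functions that are Lipschitz on a ball, and their modifications as
  competitors\<close>

text \<open>The solution \<open>u\<close> is Lipschitz only near \<open>y\<close>; \<open>u'\<close>
  is a Lipschitz function on the whole space that agrees with it on \<open>ball y r\<close>. It
  provides values on the sphere and global continuity and measurability. The margin d < r is the
  room in which mollification on \<open>ball y d\<close> takes place.\<close>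

locale weak_lipschitz_ball =
  fixes u u' :: "real^'n::finite \<Rightarrow> real" and G :: "real^'n \<Rightarrow> real^'n" and y :: "real^'n" and d r L :: real
  assumes d: "0 < d" "d < r"
    and G: "has_weak_gradient (ball y r) u G"
    and lip: "L-lipschitz_on UNIV u'"
    and eq: "\<And>z. z \<in> ball y r \<Longrightarrow> u' z = u z"
begin

lemma L_nonneg: "0 \<le> L" using lip by (simp add: lipschitz_on_def)

lemma cont_u': "continuous_on S u'"
  using lipschitz_on_continuous_on[OF lip] continuous_on_subset by blast

lemma ball_sub: "ball y d \<subseteq> ball y r" using d by auto

lemma G_ball: "has_weak_gradient (ball y d) u G"
  by (rule has_weak_gradient_subset[OF G ball_sub])

lemma G_measurable: "(\<lambda>z. indicat_real (ball y d) z *\<^sub>R G z) \<in> borel_measurable lebesgue"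
proof -
  have "L1_loc (ball y r) G" using G by (simp add: has_weak_gradient_def)
  then have "G absolutely_integrable_on cball y d" unfolding L1_loc_def using d(2)
    by (auto simp: subset_iff)
  then have "G absolutely_integrable_on ball y d" by (rule set_integrable_subset) auto
  then show ?thesis by (auto simp: set_integrable_def dest: borel_measurable_integrable)
qed

lemma approximation:
  obtains \<phi> e where "\<forall>k. smooth (\<phi> k)" "e \<longlonglongrightarrow> 0"
    "\<forall>k. \<forall>z\<in>cball y d. \<bar>\<phi> k z - u' z\<bar> \<le> e k"
    "\<forall>k. \<forall>z\<in>ball y d. norm (grad (\<phi> k) z) \<le> L"
    "AE z in lebesgue. z \<in> ball y d \<longrightarrow> (\<lambda>k. grad (\<phi> k) z) \<longlonglongrightarrow> G z"
  by (rule weak_gradient_approximation[OF lip has_weak_gradient_cong[OF G eq] d])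

lemma G_le: "AE z in lebesgue. z \<in> ball y d \<longrightarrow> norm (G z) \<le> L"
proof -
  obtain \<phi> e where 1: "\<forall>k. smooth (\<phi> k)" and 2: "e \<longlonglongrightarrow> 0"
    and 3: "\<forall>k. \<forall>z\<in>cball y d. \<bar>\<phi> k z - u' z\<bar> \<le> e k"
    and 4: "\<forall>k. \<forall>z\<in>ball y d. norm (grad (\<phi> k) z) \<le> L"
    and ae: "AE z in lebesgue. z \<in> ball y d \<longrightarrow> (\<lambda>k. grad (\<phi> k) z) \<longlonglongrightarrow> G z"
    by (rule approximation)
  from ae show ?thesis
  proof eventually_elim
    case (elim z)
    show ?case
    proof
      assume z: "z \<in> ball y d"
      have "(\<lambda>k. norm (grad (\<phi> k) z)) \<longlonglongrightarrow> norm (G z)"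
        using elim z by (intro tendsto_norm) blast
      then show "norm (G z) \<le> L"
        by (rule Lim_bounded[where M = 0]) (use 4 z in blast)
    qed
  qed
qed

context
  fixes \<Psi> \<Phi> :: "real^'n \<Rightarrow> real"
  assumes \<Psi>: "test_function (ball y d) \<Psi>" and \<Phi>: "test_function (ball y d) \<Phi>"
begin

lemma modify_weak_gradient: "has_weak_gradient (ball y d) (modify \<Psi> \<Phi> u) (modify_grad \<Psi> \<Phi> u G)"
  by (rule has_weak_gradient_modify[OF G_ball test_function_smooth[OF \<Psi>] test_function_smooth[OF \<Phi>]])

lemma bounds:
  obtains A A' C K where "\<forall>z. \<bar>1 - \<Psi> z\<bar> \<le> A" "\<forall>z. norm (grad \<Psi> z) \<le> A'"
    "\<forall>z. norm (grad \<Phi> z) \<le> C" "\<forall>z\<in>cball y d. \<bar>u' z\<bar> \<le> K" "0 \<le> K"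
proof -
  obtain A where A: "\<And>z. \<bar>\<Psi> z\<bar> \<le> A" using test_function_bounded[OF \<Psi>] by blast
  obtain A' where A': "\<And>z. norm (grad \<Psi> z) \<le> A'" using test_function_grad_bounded[OF \<Psi>] by blast
  obtain C where C: "\<And>z. norm (grad \<Phi> z) \<le> C" using test_function_grad_bounded[OF \<Phi>] by blast
  have "bounded (u' ` cball y d)"
    by (intro compact_imp_bounded compact_continuous_image cont_u' compact_cball)
  then obtain K where K: "0 < K" "\<forall>z\<in>cball y d. \<bar>u' z\<bar> \<le> K" unfolding bounded_pos by auto
  have "\<bar>1 - \<Psi> z\<bar> \<le> 1 + A" for z using A[of z] by linarith
  then have a: "\<forall>z. \<bar>1 - \<Psi> z\<bar> \<le> 1 + A" by blast
  show thesis by (rule that[OF a _ _ K(2) less_imp_le[OF K(1)]]) (use A' C in blast)+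
qed

lemma modify_grad_measurable: "(\<lambda>z. indicat_real (ball y d) z *\<^sub>R modify_grad \<Psi> \<Phi> u G z) \<in> borel_measurable lebesgue"
proof -
  have sm: "smooth \<Psi>" "smooth \<Phi>" using \<Psi> \<Phi> by (auto simp: test_function_def)
  have "(\<lambda>z. (1 - \<Psi> z) *\<^sub>R (indicat_real (ball y d) z *\<^sub>R G z)
      - (indicat_real (ball y d) z * u' z) *\<^sub>R grad \<Psi> z + indicat_real (ball y d) z *\<^sub>R grad \<Phi> z) \<in> borel_measurable lebesgue"
    by (intro borel_measurable_add borel_measurable_diff borel_measurable_scaleR borel_measurable_times
        borel_measurable_indicator G_measurable borel_measurable_lebesgue_continuous cont_u'
        continuous_on_grad sm smooth_continuous_on smooth_one_minus) auto
  also have "(\<lambda>z. (1 - \<Psi> z) *\<^sub>R (indicat_real (ball y d) z *\<^sub>R G z)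
      - (indicat_real (ball y d) z * u' z) *\<^sub>R grad \<Psi> z + indicat_real (ball y d) z *\<^sub>R grad \<Phi> z)
     = (\<lambda>z. indicat_real (ball y d) z *\<^sub>R modify_grad \<Psi> \<Phi> u G z)"
  proof
    fix z show "(1 - \<Psi> z) *\<^sub>R (indicat_real (ball y d) z *\<^sub>R G z)
      - (indicat_real (ball y d) z * u' z) *\<^sub>R grad \<Psi> z + indicat_real (ball y d) z *\<^sub>R grad \<Phi> z
      = indicat_real (ball y d) z *\<^sub>R modify_grad \<Psi> \<Phi> u G z"
    proof (cases "z \<in> ball y d")
      case True
      then have "u' z = u z" using eq ball_sub by blast
      then show ?thesis using True by (simp add: modify_grad_def)
    qed simp
  qed
  finally show ?thesis .
qed

lemma modify_grad_bounded:
  obtains W where "0 \<le> W" "AE z in lebesgue. z \<in> ball y d \<longrightarrow> norm (modify_grad \<Psi> \<Phi> u G z) \<le> W"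
proof -
  obtain A A' C K where b: "\<forall>z. \<bar>1 - \<Psi> z\<bar> \<le> A" "\<forall>z. norm (grad \<Psi> z) \<le> A'"
    "\<forall>z. norm (grad \<Phi> z) \<le> C" "\<forall>z\<in>cball y d. \<bar>u' z\<bar> \<le> K" "0 \<le> K"
    by (rule bounds)
  note b = b[rule_format]
  have A0: "0 \<le> A" "0 \<le> A'" "0 \<le> C"
    using b(1)[of y] b(2)[of y] b(3)[of y] norm_ge_zero[of "grad \<Psi> y"] norm_ge_zero[of "grad \<Phi> y"] by linarith+
  show thesis
  proof (rule that)
    show "0 \<le> A * L + K * A' + C" using A0 b(5) L_nonneg by simp
    show "AE z in lebesgue. z \<in> ball y d \<longrightarrow> norm (modify_grad \<Psi> \<Phi> u G z) \<le> A * L + K * A' + C"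
      using G_le
    proof eventually_elim
      case (elim z)
      show ?case
      proof
        assume z: "z \<in> ball y d"
        have u: "\<bar>u z\<bar> \<le> K" using b(4)[of z] eq[of z] z ball_sub by auto
        have "norm (modify_grad \<Psi> \<Phi> u G z) \<le> norm ((1 - \<Psi> z) *\<^sub>R G z) + norm (u z *\<^sub>R grad \<Psi> z) + norm (grad \<Phi> z)"
          unfolding modify_grad_def by (rule norm_triangle_le, rule add_right_mono, rule norm_triangle_ineq4)
        also have "\<dots> \<le> A * L + K * A' + C"
          unfolding norm_scaleR using elim z A0 b(5) by (intro add_mono mult_mono b u) auto
        finally show "norm (modify_grad \<Psi> \<Phi> u G z) \<le> A * L + K * A' + C" .
      qed
    qed
  qed
qed

lemma set_integrable_norm_grad_sq:
  "set_integrable lebesgue (ball y d) (\<lambda>z. (norm (modify_grad \<Psi> \<Phi> u G z))\<^sup>2)"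
proof -
  obtain W where W: "0 \<le> W" "AE z in lebesgue. z \<in> ball y d \<longrightarrow> norm (modify_grad \<Psi> \<Phi> u G z) \<le> W"
    using modify_grad_bounded by blast
  show ?thesis
  proof (rule set_integrable_ball_bounded)
    have "(\<lambda>z. (norm (indicat_real (ball y d) z *\<^sub>R modify_grad \<Psi> \<Phi> u G z))\<^sup>2) \<in> borel_measurable lebesgue"
      using modify_grad_measurable by measurable
    also have "(\<lambda>z. (norm (indicat_real (ball y d) z *\<^sub>R modify_grad \<Psi> \<Phi> u G z))\<^sup>2)
        = (\<lambda>z. indicat_real (ball y d) z * (norm (modify_grad \<Psi> \<Phi> u G z))\<^sup>2)"
      by (auto split: split_indicator)
    finally show "(\<lambda>z. indicat_real (ball y d) z * (norm (modify_grad \<Psi> \<Phi> u G z))\<^sup>2) \<in> borel_measurable lebesgue" .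
    show "AE z in lebesgue. z \<in> ball y d \<longrightarrow> \<bar>(norm (modify_grad \<Psi> \<Phi> u G z))\<^sup>2\<bar> \<le> W\<^sup>2"
      using W(2) by eventually_elim (auto intro!: power_mono)
  qed
qed

text \<open>The approximating functions are the same modifications applied to smooth approximations
  of \<open>u'\<close>. The uniform estimate gives convergence in the ball and on the sphere; the
  gradients are uniformly bounded and converge almost everywhere, so dominated convergence gives L2
  convergence.\<close>

lemma modify_has_trace: "has_trace y d (modify \<Psi> \<Phi> u) u'"
proof -
  obtain \<phi> e where \<phi>: "\<forall>k. smooth (\<phi> k)" and e0: "e \<longlonglongrightarrow> 0"
    and c: "\<forall>k. \<forall>z\<in>cball y d. \<bar>\<phi> k z - u' z\<bar> \<le> e k"
    and g: "\<forall>k. \<forall>z\<in>ball y d. norm (grad (\<phi> k) z) \<le> L"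
    and ae: "AE z in lebesgue. z \<in> ball y d \<longrightarrow> (\<lambda>k. grad (\<phi> k) z) \<longlonglongrightarrow> G z"
    by (rule approximation)
  note sm = \<phi>[rule_format] and close = c[rule_format] and gb = g[rule_format]
  obtain A A' C K where b: "\<forall>z. \<bar>1 - \<Psi> z\<bar> \<le> A" "\<forall>z. norm (grad \<Psi> z) \<le> A'"
    "\<forall>z. norm (grad \<Phi> z) \<le> C" "\<forall>z\<in>cball y d. \<bar>u' z\<bar> \<le> K" "0 \<le> K"
    by (rule bounds)
  note b = b[rule_format]
  have A0: "0 \<le> A" "0 \<le> A'"
    using b(1)[of y] b(2)[of y] norm_ge_zero[of "grad \<Psi> y"] by linarith+
  have en: "0 \<le> e k" for k using close[of y k] d(1) by force
  define V where "V = emeasure lborel (ball y d)"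
  have V: "V < \<infinity>" unfolding V_def by (rule emeasure_lborel_ball_finite)
  then obtain V' where V': "V = ennreal V'" "0 \<le> V'" by (cases V rule: ennreal_cases) auto
  define \<psi> where "\<psi> = (\<lambda>k. modify \<Psi> \<Phi> (\<phi> k))"
  have sm\<psi>: "smooth (\<psi> k)" and g\<psi>: "grad (\<psi> k) z = modify_grad \<Psi> \<Phi> (\<phi> k) (grad (\<phi> k)) z" for k z
    unfolding \<psi>_def using grad_modify[OF test_function_smooth[OF \<Psi>] test_function_smooth[OF \<Phi>] sm] by auto
  have int: "integrable (sphere_measure y d) u'"
  proof (rule integrableI_bounded)
    have "u' \<in> borel_measurable borel" by (intro borel_measurable_continuous_onI cont_u')
    then show "u' \<in> borel_measurable (sphere_measure y d)" by (simp cong: measurable_cong_sets)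
    have "(\<integral>\<^sup>+z. ennreal (norm (u' z)) \<partial>sphere_measure y d)
        \<le> ennreal (real CARD('n) / d) * (ennreal K * V)"
      unfolding V_def
      by (rule nn_integral_sphere_measure_le[OF d(1)])
         (use b(4) \<open>u' \<in> borel_measurable borel\<close> in \<open>auto intro!: ennreal_leI\<close>)
    also have "\<dots> < \<infinity>" using V by (simp add: ennreal_mult_less_top)
    finally show "(\<integral>\<^sup>+z. ennreal (norm (u' z)) \<partial>sphere_measure y d) < \<infinity>" .
  qed
  have lim1: "(\<lambda>k. \<integral>\<^sup>+z\<in>ball y d. ennreal \<bar>\<psi> k z - modify \<Psi> \<Phi> u z\<bar> \<partial>lebesgue) \<longlonglongrightarrow> 0"
  proof (rule tendsto_sandwich[OF _ _ tendsto_const])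
    show "\<forall>\<^sub>F k in sequentially. (\<integral>\<^sup>+z\<in>ball y d. ennreal \<bar>\<psi> k z - modify \<Psi> \<Phi> u z\<bar> \<partial>lebesgue) \<le> ennreal (A * e k) * V"
    proof (intro always_eventually allI)
      fix k
      have "(\<integral>\<^sup>+z\<in>ball y d. ennreal \<bar>\<psi> k z - modify \<Psi> \<Phi> u z\<bar> \<partial>lebesgue) \<le> (\<integral>\<^sup>+z. ennreal (A * e k) * indicator (ball y d) z \<partial>lebesgue)"
      proof (rule nn_integral_mono)
        fix z
        show "ennreal \<bar>\<psi> k z - modify \<Psi> \<Phi> u z\<bar> * indicator (ball y d) z \<le> ennreal (A * e k) * indicator (ball y d) z"
        proof (cases "z \<in> ball y d")
          case True
          have "\<psi> k z - modify \<Psi> \<Phi> u z = (1 - \<Psi> z) * (\<phi> k z - u' z)"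
            using eq[of z] ball_sub True by (auto simp: \<psi>_def modify_def algebra_simps)
          then have "\<bar>\<psi> k z - modify \<Psi> \<Phi> u z\<bar> \<le> A * e k"
            unfolding abs_mult using True A0 by (auto simp: abs_mult intro!: mult_mono b close)
          then show ?thesis using True by (auto intro: ennreal_leI)
        qed simp
      qed
      also have "\<dots> = ennreal (A * e k) * V"
        unfolding V_def by (subst nn_integral_cmult_indicator) auto
      finally show "(\<integral>\<^sup>+z\<in>ball y d. ennreal \<bar>\<psi> k z - modify \<Psi> \<Phi> u z\<bar> \<partial>lebesgue) \<le> ennreal (A * e k) * V" .
    qed
    have "(\<lambda>k. ennreal (A * e k * V')) \<longlonglongrightarrow> ennreal (A * 0 * V')"
      by (intro tendsto_intros e0)
    moreover have "ennreal (A * e k) * V = ennreal (A * e k * V')" for k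
      unfolding V'(1) using A0 en[of k] V'(2) by (intro ennreal_mult[symmetric]) auto
    ultimately show "(\<lambda>k. ennreal (A * e k) * V) \<longlonglongrightarrow> 0" by simp
  qed simp
  have lim3: "(\<lambda>k. \<integral>\<^sup>+z. ennreal \<bar>\<psi> k z - u' z\<bar> \<partial>sphere_measure y d) \<longlonglongrightarrow> 0"
  proof (rule tendsto_sandwich[OF _ _ tendsto_const])
    show "\<forall>\<^sub>F k in sequentially. (\<integral>\<^sup>+z. ennreal \<bar>\<psi> k z - u' z\<bar> \<partial>sphere_measure y d) \<le> ennreal (real CARD('n) / d) * (ennreal (e k) * V)"
      unfolding V_def
    proof (intro always_eventually allI nn_integral_sphere_measure_le d(1))
      fix k
      have "\<psi> k \<in> borel_measurable borel" "u' \<in> borel_measurable borel"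
        by (intro borel_measurable_continuous_onI cont_u' smooth_continuous_on sm\<psi>)+
      then show "(\<lambda>z. ennreal \<bar>\<psi> k z - u' z\<bar>) \<in> borel_measurable borel" by measurable
      \<comment> \<open>\<Psi> and \<Phi> have their supports in the open ball, so the modification
        is invisible on the sphere.\<close>
      fix z assume z: "z \<in> sphere y d"
      then have "z \<notin> ball y d" "z \<in> cball y d" by auto
      then have "\<psi> k z = \<phi> k z"
        using test_function_eq_0[OF \<Psi>] test_function_eq_0[OF \<Phi>] by (simp add: \<psi>_def modify_def)
      then show "ennreal \<bar>\<psi> k z - u' z\<bar> \<le> ennreal (e k)"
        using close[OF \<open>z \<in> cball y d\<close>] by (auto intro: ennreal_leI)
    qed
    have "(\<lambda>k. ennreal (real CARD('n) / d * (e k * V'))) \<longlonglongrightarrow> ennreal (real CARD('n) / d * (0 * V'))"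
      by (intro tendsto_intros e0)
    moreover have "ennreal (real CARD('n) / d) * (ennreal (e k) * V) = ennreal (real CARD('n) / d * (e k * V'))" for k
    proof -
      have "0 \<le> e k * V'" "0 \<le> real CARD('n) / d" using en[of k] V'(2) d(1) by auto
      then show ?thesis
        unfolding V'(1) ennreal_mult[OF en V'(2), symmetric] by (rule ennreal_mult[OF _ , symmetric, rotated])
    qed
    ultimately show "(\<lambda>k. ennreal (real CARD('n) / d) * (ennreal (e k) * V)) \<longlonglongrightarrow> 0" by simp
  qed simp
  have lim2: "(\<lambda>k. \<integral>\<^sup>+z\<in>ball y d. ennreal ((norm (grad (\<psi> k) z - weak_grad (ball y d) (modify \<Psi> \<Phi> u) z))\<^sup>2) \<partial>lebesgue) \<longlonglongrightarrow> 0"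
  proof -
    let ?D = "\<lambda>k z. norm (indicat_real (ball y d) z *\<^sub>R grad (\<psi> k) z - indicat_real (ball y d) z *\<^sub>R modify_grad \<Psi> \<Phi> u G z)"
    have "Bseq e" by (rule convergent_imp_Bseq[OF convergentI[OF e0]])
    then obtain E where E': "\<forall>k. norm (e k) \<le> E" by (auto simp: Bseq_def)
    have E: "e k \<le> E" for k using E'[rule_format, of k] by simp
    have E0: "0 \<le> E" using E[of 0] en[of 0] by linarith
    define W where "W = A * (L + L) + E * A'"
    \<comment> \<open>The term \<open>grad \<Phi>\<close> cancels; what remains is controlled by the
      error of the gradients and the uniform error of the values.\<close>
    have diff: "grad (\<psi> k) z - modify_grad \<Psi> \<Phi> u G z = (1 - \<Psi> z) *\<^sub>R (grad (\<phi> k) z - G z) - (\<phi> k z - u' z) *\<^sub>R grad \<Psi> z"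
      if "z \<in> ball y d" for k z
      using eq[of z] ball_sub that by (auto simp: g\<psi> modify_grad_def algebra_simps)
    have "(\<lambda>k. \<integral>\<^sup>+z. ennreal ((?D k z)\<^sup>2) \<partial>lebesgue) \<longlonglongrightarrow> (\<integral>\<^sup>+(z::real^'n). 0 \<partial>lebesgue)"
    proof (rule nn_integral_dominated_convergence[where w = "\<lambda>z. ennreal (W\<^sup>2) * indicator (ball y d) z"])
      show "(\<lambda>z. ennreal ((?D k z)\<^sup>2)) \<in> borel_measurable lebesgue" for k
      proof -
        have "(\<lambda>z. indicat_real (ball y d) z *\<^sub>R grad (\<psi> k) z) \<in> borel_measurable lebesgue"
          by (intro borel_measurable_scaleR borel_measurable_indicator borel_measurable_lebesgue_continuous continuous_on_grad sm\<psi>) auto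
        from borel_measurable_diff[OF this modify_grad_measurable] show ?thesis by measurable
      qed
      show "AE z in lebesgue. ennreal ((?D k z)\<^sup>2) \<le> ennreal (W\<^sup>2) * indicator (ball y d) z" for k
        using G_le
      proof eventually_elim
        case (elim z)
        show ?case
        proof (cases "z \<in> ball y d")
          case True
          have "norm (grad (\<psi> k) z - modify_grad \<Psi> \<Phi> u G z) \<le> norm ((1 - \<Psi> z) *\<^sub>R (grad (\<phi> k) z - G z)) + norm ((\<phi> k z - u' z) *\<^sub>R grad \<Psi> z)"
            unfolding diff[OF True] by (rule norm_triangle_ineq4)
          also have "\<dots> \<le> W"
          proof -
            have "norm (grad (\<phi> k) z - G z) \<le> L + L"
              using gb[OF True, of k] elim True norm_triangle_ineq4[of "grad (\<phi> k) z" "G z"] by auto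
            moreover have "\<bar>\<phi> k z - u' z\<bar> \<le> E" using close[of z k] E[of k] True by auto
            ultimately show ?thesis
              unfolding W_def norm_scaleR real_norm_def using A0 E0 by (intro add_mono mult_mono b) auto
          qed
          finally show ?thesis using True by (auto intro!: ennreal_leI power_mono)
        qed simp
      qed
      show "(\<integral>\<^sup>+z. ennreal (W\<^sup>2) * indicator (ball y d) z \<partial>lebesgue) < \<infinity>"
        using V by (subst nn_integral_cmult_indicator) (auto simp: V_def ennreal_mult_less_top)
      show "AE z in lebesgue. (\<lambda>k. ennreal ((?D k z)\<^sup>2)) \<longlonglongrightarrow> 0"
        using ae
      proof eventually_elim
        case (elim z)
        show ?case
        proof (cases "z \<in> ball y d")
          case True
          have "(\<lambda>k. \<phi> k z - u' z) \<longlonglongrightarrow> 0"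
            by (rule Lim_null_comparison[OF _ e0]) (use True close[of z] in auto)
          moreover have "(\<lambda>k. grad (\<phi> k) z - G z) \<longlonglongrightarrow> 0"
            using elim True by (intro Lim_null[THEN iffD1]) simp
          ultimately have "(\<lambda>k. (norm ((1 - \<Psi> z) *\<^sub>R (grad (\<phi> k) z - G z) - (\<phi> k z - u' z) *\<^sub>R grad \<Psi> z))\<^sup>2)
             \<longlonglongrightarrow> (norm ((1 - \<Psi> z) *\<^sub>R 0 - 0 *\<^sub>R grad \<Psi> z))\<^sup>2"
            by (intro tendsto_intros)
          then have "(\<lambda>k. ennreal ((norm ((1 - \<Psi> z) *\<^sub>R (grad (\<phi> k) z - G z) - (\<phi> k z - u' z) *\<^sub>R grad \<Psi> z))\<^sup>2)) \<longlonglongrightarrow> ennreal 0"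
            by (intro tendsto_ennrealI) simp
          then show ?thesis using True diff[OF True] by simp
        qed simp
      qed
    qed (auto intro!: borel_measurable_times_ennreal borel_measurable_indicator)
    moreover have "(\<integral>\<^sup>+z. ennreal ((?D k z)\<^sup>2) \<partial>lebesgue)
       = (\<integral>\<^sup>+z\<in>ball y d. ennreal ((norm (grad (\<psi> k) z - weak_grad (ball y d) (modify \<Psi> \<Phi> u) z))\<^sup>2) \<partial>lebesgue)" for k
      by (rule nn_integral_cong_AE)
         (use weak_grad_eq[OF modify_weak_gradient] in \<open>eventually_elim, auto split: split_indicator\<close>)
    ultimately show ?thesis by simp
  qed
  show ?thesis
    unfolding has_trace_def using int sm\<psi> lim1 lim2 lim3 by blast
qed

end

lemma test_function_zero: "test_function U (\<lambda>_. 0)"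
  by (simp add: test_function_def smooth_const)

lemma competitor_modify:
  assumes \<Psi>: "test_function (ball y d) \<Psi>" and \<Phi>: "test_function (ball y d) \<Phi>"
  shows "competitor y d u (modify \<Psi> \<Phi> u)"
proof -
  \<comment> \<open>The trivial modification shows that \<open>u\<close> itself has the trace
    \<open>u'\<close>.\<close>
  have "modify (\<lambda>_. 0) (\<lambda>_. 0) u = u" by (auto simp: modify_def)
  then have "has_trace y d u u'"
    using modify_has_trace[OF test_function_zero test_function_zero] by simp
  then have tr: "same_trace y d u (modify \<Psi> \<Phi> u)"
    unfolding same_trace_def using modify_has_trace[OF \<Psi> \<Phi>] by blast
  have abs: "modify \<Psi> \<Phi> u absolutely_integrable_on ball y d"
  proof -
    have "continuous_on (cball y d) (modify \<Psi> \<Phi> u')"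
      unfolding modify_def[abs_def]
      by (intro continuous_intros cont_u' smooth_continuous_on test_function_smooth[OF \<Psi>] test_function_smooth[OF \<Phi>])
    then have "modify \<Psi> \<Phi> u' absolutely_integrable_on cball y d"
      by (intro absolutely_integrable_continuous_compact compact_cball)
    then have "modify \<Psi> \<Phi> u' absolutely_integrable_on ball y d"
      by (rule set_integrable_subset) auto
    moreover have "indicat_real (ball y d) z *\<^sub>R modify \<Psi> \<Phi> u' z = indicat_real (ball y d) z *\<^sub>R modify \<Psi> \<Phi> u z" for z
      using eq[of z] ball_sub by (cases "z \<in> ball y d") (auto simp: modify_def)
    ultimately show ?thesis by (simp only: set_integrable_def)
  qed
  have L2: "L2_on (ball y d) (modify_grad \<Psi> \<Phi> u G)"
    unfolding L2_on_def
  proof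
    show "modify_grad \<Psi> \<Phi> u G \<in> borel_measurable (lebesgue_on (ball y d))"
      using modify_grad_measurable[OF \<Psi> \<Phi>]
      by (simp add: borel_measurable_restrict_space_iff)
    show "(\<lambda>z. (norm (modify_grad \<Psi> \<Phi> u G z))\<^sup>2) absolutely_integrable_on ball y d"
      by (rule set_integrable_norm_grad_sq[OF \<Psi> \<Phi>])
  qed
  show ?thesis
    unfolding competitor_def using abs modify_weak_gradient[OF \<Psi> \<Phi>] L2 tr by blast
qed

end

section \<open>Comparison of energies\<close>

lemma set_lebesgue_integral_nonneg:
  fixes f :: "'a \<Rightarrow> real"
  assumes "\<And>x. x \<in> S \<Longrightarrow> 0 \<le> f x"
  shows "0 \<le> (LINT x:S|M. f x)"
  unfolding set_lebesgue_integral_def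
  by (rule Bochner_Integration.integral_nonneg) (use assms in \<open>auto split: split_indicator\<close>)

lemma set_integrable_cmult:
  fixes f :: "'a \<Rightarrow> real"
  assumes "set_integrable M S f"
  shows "set_integrable M S (\<lambda>x. c * f x)"
  using set_integrable_mult_right[of c M S f] assms by blast

lemma norm_add_scaled_sq:
  fixes a b :: "'a::real_inner"
  shows "(norm (a + t *\<^sub>R b))\<^sup>2 = (norm a)\<^sup>2 + 2 * t * (a \<bullet> b) + t\<^sup>2 * (norm b)\<^sup>2"
  unfolding power2_norm_eq_inner inner_add_left inner_add_right inner_scaleR_left inner_scaleR_right
    inner_commute[of b a] by algebra

context weak_lipschitz_ball
begin

lemma modify_zero: "modify (\<lambda>_. 0) (\<lambda>_. 0) u = u"
  by (auto simp: modify_def)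

lemma modify_grad_zero: "modify_grad (\<lambda>_. 0) (\<lambda>_. 0) u G = G"
  by (auto simp: modify_grad_def grad_const)

lemma set_integrable_G_sq: "set_integrable lebesgue (ball y d) (\<lambda>z. (norm (G z))\<^sup>2)"
  using set_integrable_norm_grad_sq[OF test_function_zero test_function_zero] by (simp only: modify_grad_zero)

text \<open>For a nonnegative function the term with \<open>qm\<close> vanishes, so
  \<open>J_fun\<close> and \<open>J_plus_fun\<close> agree and both kinds of almost minimizer can be
  treated at once.\<close>

lemma energy_eq:
  fixes qp :: "real^'n \<Rightarrow> real"
  assumes \<Psi>: "test_function (ball y d) \<Psi>" and \<Phi>: "test_function (ball y d) \<Phi>"
    and nonneg: "\<And>z. z \<in> ball y d \<Longrightarrow> 0 \<le> modify \<Psi> \<Phi> u z"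
  defines "E \<equiv> \<integral>\<^sup>+z\<in>ball y d. ennreal ((norm (modify_grad \<Psi> \<Phi> u G z))\<^sup>2
      + (qp z)\<^sup>2 * indicator {z. 0 < modify \<Psi> \<Phi> u z} z) \<partial>lebesgue"
  shows "J_fun qp qm y d (modify \<Psi> \<Phi> u) = E" "J_plus_fun qp y d (modify \<Psi> \<Phi> u) = E"
proof -
  note ae = weak_grad_eq[OF modify_weak_gradient[OF \<Psi> \<Phi>]]
  have n: "indicat_real {z. modify \<Psi> \<Phi> u z < 0} z = 0" if "z \<in> ball y d" for z
    using nonneg[OF that] by simp
  show "J_fun qp qm y d (modify \<Psi> \<Phi> u) = E"
    unfolding J_fun_def E_def
  proof (rule nn_integral_cong_AE)
    show "AE z in lebesgue. ennreal ((norm (weak_grad (ball y d) (modify \<Psi> \<Phi> u) z))\<^sup>2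
        + (qp z)\<^sup>2 * indicator {z. 0 < modify \<Psi> \<Phi> u z} z
        + (qm z)\<^sup>2 * indicator {z. modify \<Psi> \<Phi> u z < 0} z) * indicator (ball y d) z
      = ennreal ((norm (modify_grad \<Psi> \<Phi> u G z))\<^sup>2
        + (qp z)\<^sup>2 * indicator {z. 0 < modify \<Psi> \<Phi> u z} z) * indicator (ball y d) z"
      using ae by (rule eventually_mono) (use n in \<open>force split: split_indicator\<close>)
  qed
  show "J_plus_fun qp y d (modify \<Psi> \<Phi> u) = E"
    unfolding J_plus_fun_def E_def
  proof (rule nn_integral_cong_AE)
    show "AE z in lebesgue. ennreal ((norm (weak_grad (ball y d) (modify \<Psi> \<Phi> u) z))\<^sup>2
        + (qp z)\<^sup>2 * indicator {z. 0 < modify \<Psi> \<Phi> u z} z) * indicator (ball y d) z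
      = ennreal ((norm (modify_grad \<Psi> \<Phi> u G z))\<^sup>2
        + (qp z)\<^sup>2 * indicator {z. 0 < modify \<Psi> \<Phi> u z} z) * indicator (ball y d) z"
      using ae by (rule eventually_mono) (auto split: split_indicator)
  qed
qed

text \<open>Both energies are finite, which allows the passage from extended nonnegative numbers to
  real integrals. The closed ball lies in \<Omega>, as almost minimality for the functional
  \<open>J_plus_fun\<close> demands, and since \<open>u\<close> is positive its own positivity term
  is the full integral of \<open>qp\<close> squared.\<close>

lemma energy_comparison:
  assumes am: "almost_minimizer_J \<Omega> qp qm \<kappa> \<alpha> u \<or> almost_minimizer_J_plus \<Omega> qp \<kappa> \<alpha> u"
    and sub: "cball y d \<subseteq> \<Omega>" and "0 \<le> \<kappa>"
    and pos: "\<And>z. z \<in> ball y d \<Longrightarrow> 0 < u z"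
    and q: "set_integrable lebesgue (ball y d) (\<lambda>z. (qp z)\<^sup>2)"
    and \<Psi>: "test_function (ball y d) \<Psi>" and \<Phi>: "test_function (ball y d) \<Phi>"
    and nonneg: "\<And>z. z \<in> ball y d \<Longrightarrow> 0 \<le> modify \<Psi> \<Phi> u z"
  shows "(LINT z:ball y d|lebesgue. (norm (G z))\<^sup>2) + (LINT z:ball y d|lebesgue. (qp z)\<^sup>2)
    \<le> (1 + \<kappa> * d powr \<alpha>) * ((LINT z:ball y d|lebesgue. (norm (modify_grad \<Psi> \<Phi> u G z))\<^sup>2)
        + (LINT z:ball y d|lebesgue. (qp z)\<^sup>2 * indicat_real {z. 0 < modify \<Psi> \<Phi> u z} z))"
proof -
  let ?E = "\<lambda>\<Psi> \<Phi>. \<integral>\<^sup>+z\<in>ball y d. ennreal ((norm (modify_grad \<Psi> \<Phi> u G z))\<^sup>2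
      + (qp z)\<^sup>2 * indicator {z. 0 < modify \<Psi> \<Phi> u z} z) \<partial>lebesgue"
  note comp = competitor_modify[OF \<Psi> \<Phi>]
  have bsub: "ball y d \<subseteq> \<Omega>" using sub ball_subset_cball by blast
  have pos': "z \<in> ball y d \<Longrightarrow> 0 \<le> modify (\<lambda>_. 0) (\<lambda>_. 0) u z" for z
    using pos[of z] by (simp only: modify_zero less_imp_le)
  note e0 = energy_eq[OF test_function_zero test_function_zero pos', unfolded modify_zero]
  note e1 = energy_eq[OF \<Psi> \<Phi> nonneg]
  let ?h0 = "\<lambda>z. (norm (G z))\<^sup>2 + (qp z)\<^sup>2"
  let ?h1 = "\<lambda>z. (norm (modify_grad \<Psi> \<Phi> u G z))\<^sup>2 + (qp z)\<^sup>2 * indicat_real {z. 0 < modify \<Psi> \<Phi> u z} z"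
  have E0: "(\<integral>\<^sup>+z\<in>ball y d. ennreal ((norm (modify_grad (\<lambda>_. 0) (\<lambda>_. 0) u G z))\<^sup>2
      + (qp z)\<^sup>2 * indicator {z. 0 < u z} z) \<partial>lebesgue) = (\<integral>\<^sup>+z\<in>ball y d. ennreal (?h0 z) \<partial>lebesgue)"
    unfolding modify_grad_zero
    by (rule nn_integral_cong) (use pos in \<open>auto split: split_indicator\<close>)
  have le: "(\<integral>\<^sup>+z\<in>ball y d. ennreal (?h0 z) \<partial>lebesgue) \<le> ennreal (1 + \<kappa> * d powr \<alpha>) * ?E \<Psi> \<Phi>"
    using am
  proof
    assume "almost_minimizer_J \<Omega> qp qm \<kappa> \<alpha> u"
    then have "J_fun qp qm y d u \<le> ennreal (1 + \<kappa> * d powr \<alpha>) * J_fun qp qm y d (modify \<Psi> \<Phi> u)"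
      using d(1) bsub comp unfolding almost_minimizer_J_def by blast
    then show ?thesis by (simp only: e0(1) e1(1) E0)
  next
    assume "almost_minimizer_J_plus \<Omega> qp \<kappa> \<alpha> u"
    then have "J_plus_fun qp y d u \<le> ennreal (1 + \<kappa> * d powr \<alpha>) * J_plus_fun qp y d (modify \<Psi> \<Phi> u)"
      using d(1) sub comp unfolding almost_minimizer_J_plus_def by blast
    then show ?thesis by (simp only: e0(2) e1(2) E0)
  qed
  have i1: "set_integrable lebesgue (ball y d) (\<lambda>z. (qp z)\<^sup>2 * indicat_real {z. 0 < modify \<Psi> \<Phi> u z} z)"
  proof -
    \<comment> \<open>Measurability of the positivity set comes from the continuous function built
      with \<open>u'\<close>, which agrees with the competitor on the ball.\<close>
    have cv: "continuous_on UNIV (modify \<Psi> \<Phi> u')"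
      unfolding modify_def[abs_def]
      by (intro continuous_intros cont_u' smooth_continuous_on test_function_smooth[OF \<Psi>] test_function_smooth[OF \<Phi>])
    have "open {z. 0 < modify \<Psi> \<Phi> u' z}"
      by (rule open_Collect_less[OF continuous_on_const cv])
    then have o: "{z. 0 < modify \<Psi> \<Phi> u' z} \<in> sets lebesgue" by auto
    have "integrable lebesgue (\<lambda>z. (indicat_real (ball y d) z *\<^sub>R (qp z)\<^sup>2) * indicat_real {z. 0 < modify \<Psi> \<Phi> u' z} z)"
      using integrable_mult_indicator[OF o q[unfolded set_integrable_def]] by (simp add: mult_ac)
    also have "(\<lambda>z. (indicat_real (ball y d) z *\<^sub>R (qp z)\<^sup>2) * indicat_real {z. 0 < modify \<Psi> \<Phi> u' z} z)
        = (\<lambda>z. indicat_real (ball y d) z *\<^sub>R ((qp z)\<^sup>2 * indicat_real {z. 0 < modify \<Psi> \<Phi> u z} z))"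
    proof
      fix z show "(indicat_real (ball y d) z *\<^sub>R (qp z)\<^sup>2) * indicat_real {z. 0 < modify \<Psi> \<Phi> u' z} z
        = indicat_real (ball y d) z *\<^sub>R ((qp z)\<^sup>2 * indicat_real {z. 0 < modify \<Psi> \<Phi> u z} z)"
      proof (cases "z \<in> ball y d")
        case True
        then have "modify \<Psi> \<Phi> u' z = modify \<Psi> \<Phi> u z" using eq[of z] ball_sub by (auto simp: modify_def)
        then show ?thesis by (auto split: split_indicator)
      qed simp
    qed
    finally show ?thesis by (simp only: set_integrable_def)
  qed
  note iG = set_integrable_norm_grad_sq[OF \<Psi> \<Phi>]
  have h0: "(\<integral>\<^sup>+z\<in>ball y d. ennreal (?h0 z) \<partial>lebesgue) = ennreal (LINT z:ball y d|lebesgue. ?h0 z)"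
    by (rule nn_integral_set_eq_set_integral[OF set_integral_add(1)[OF set_integrable_G_sq q]]) auto
  have h1: "?E \<Psi> \<Phi> = ennreal (LINT z:ball y d|lebesgue. ?h1 z)"
    by (rule nn_integral_set_eq_set_integral[OF set_integral_add(1)[OF iG i1]]) auto
  have n1: "0 \<le> (LINT z:ball y d|lebesgue. ?h1 z)"
    by (rule set_lebesgue_integral_nonneg) auto
  have "ennreal (LINT z:ball y d|lebesgue. ?h0 z) \<le> ennreal ((1 + \<kappa> * d powr \<alpha>) * (LINT z:ball y d|lebesgue. ?h1 z))"
    using le unfolding h0 h1 using \<open>0 \<le> \<kappa>\<close> n1 by (subst ennreal_mult) auto
  then have "(LINT z:ball y d|lebesgue. ?h0 z) \<le> (1 + \<kappa> * d powr \<alpha>) * (LINT z:ball y d|lebesgue. ?h1 z)"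
    using \<open>0 \<le> \<kappa>\<close> n1 by (subst (asm) ennreal_le_iff) auto
  then show ?thesis
    by (simp only: set_integral_add(2)[OF set_integrable_G_sq q] set_integral_add(2)[OF iG i1])
qed

text \<open>The weak gradient is tested with each partial derivative of \<Phi>, and the results are
  summed.\<close>

lemma weak_laplacian:
  assumes \<Phi>: "test_function (ball y d) \<Phi>"
  shows "set_integrable lebesgue (ball y d) (\<lambda>z. G z \<bullet> grad \<Phi> z)"
    and "set_integrable lebesgue (ball y d) (\<lambda>z. u z * (\<Sum>i\<in>UNIV. partial_deriv i (partial_deriv i \<Phi>) z))"
    and "(LINT z:ball y d|lebesgue. u z * (\<Sum>i\<in>UNIV. partial_deriv i (partial_deriv i \<Phi>) z))
      = - (LINT z:ball y d|lebesgue. G z \<bullet> grad \<Phi> z)"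
proof -
  let ?B = "ball y d"
  have Lu: "L1_loc ?B u" and LG: "L1_loc ?B G" using G_ball by (auto simp: has_weak_gradient_def)
  have t: "test_function ?B (partial_deriv i \<Phi>)" for i by (rule test_function_partial_deriv[OF \<Phi>])
  have a: "set_integrable lebesgue ?B (\<lambda>z. G z $ i * partial_deriv i \<Phi> z)" for i
    by (rule set_integrable_test_function_mult[OF L1_loc_component[OF LG] t])
  have b: "set_integrable lebesgue ?B (\<lambda>z. u z * partial_deriv i (partial_deriv i \<Phi>) z)" for i
    by (rule set_integrable_test_function_mult[OF Lu test_function_partial_deriv[OF t]])
  have ab: "(LINT z:?B|lebesgue. u z * partial_deriv i (partial_deriv i \<Phi>) z) = - (LINT z:?B|lebesgue. G z $ i * partial_deriv i \<Phi> z)" for i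
    using G_ball t[of i] by (auto simp: has_weak_gradient_def)
  have e1: "G z \<bullet> grad \<Phi> z = (\<Sum>i\<in>UNIV. G z $ i * partial_deriv i \<Phi> z)" for z
    by (simp add: inner_vec_def grad_def)
  have e2: "u z * (\<Sum>i\<in>UNIV. partial_deriv i (partial_deriv i \<Phi>) z) = (\<Sum>i\<in>UNIV. u z * partial_deriv i (partial_deriv i \<Phi>) z)" for z
    by (rule sum_distrib_left)
  have s: "set_integrable lebesgue ?B (\<lambda>z. \<Sum>i\<in>UNIV. f i z)"
    "(LINT z:?B|lebesgue. (\<Sum>i\<in>UNIV. f i z)) = (\<Sum>i\<in>UNIV. LINT z:?B|lebesgue. f i z)"
    if f: "\<And>i. set_integrable lebesgue ?B (f i)" for f :: "'n \<Rightarrow> real^'n \<Rightarrow> real"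
  proof -
    note f' = f[unfolded set_integrable_def]
    show "set_integrable lebesgue ?B (\<lambda>z. \<Sum>i\<in>UNIV. f i z)"
      unfolding set_integrable_def scaleR_sum_right by (rule Bochner_Integration.integrable_sum[OF f'])
    show "(LINT z:?B|lebesgue. (\<Sum>i\<in>UNIV. f i z)) = (\<Sum>i\<in>UNIV. LINT z:?B|lebesgue. f i z)"
      unfolding set_lebesgue_integral_def scaleR_sum_right by (rule Bochner_Integration.integral_sum[OF f'])
  qed
  show "set_integrable lebesgue ?B (\<lambda>z. G z \<bullet> grad \<Phi> z)" unfolding e1 by (rule s(1)[OF a])
  show "set_integrable lebesgue ?B (\<lambda>z. u z * (\<Sum>i\<in>UNIV. partial_deriv i (partial_deriv i \<Phi>) z))"
    unfolding e2 by (rule s(1)[OF b])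
  show "(LINT z:?B|lebesgue. u z * (\<Sum>i\<in>UNIV. partial_deriv i (partial_deriv i \<Phi>) z))
      = - (LINT z:?B|lebesgue. G z \<bullet> grad \<Phi> z)"
    unfolding e1 e2 s(2)[OF a] s(2)[OF b] ab by (rule sum_negf)
qed

lemma set_integrable_continuous:
  fixes f :: "real^'n \<Rightarrow> real"
  assumes "continuous_on UNIV f"
  shows "set_integrable lebesgue (ball y d) f"
proof -
  have "f absolutely_integrable_on cball y d"
    by (rule absolutely_integrable_continuous_compact[OF compact_cball continuous_on_subset[OF assms subset_UNIV]])
  then show ?thesis by (rule set_integrable_subset) auto
qed

end

section \<open>The two comparison inequalities for a positive almost minimizer\<close>

locale positive_almost_minimizer = weak_lipschitz_ball u u' G y d r L
  for u u' :: "real^'n::finite \<Rightarrow> real" and G y d r L +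
  fixes \<Omega> :: "(real^'n) set" and qp qm :: "real^'n \<Rightarrow> real" and \<kappa> \<alpha> :: real
  assumes am: "almost_minimizer_J \<Omega> qp qm \<kappa> \<alpha> u \<or> almost_minimizer_J_plus \<Omega> qp \<kappa> \<alpha> u"
    and sub: "cball y d \<subseteq> \<Omega>" and \<kappa>: "0 \<le> \<kappa>"
    and pos: "\<And>z. z \<in> ball y d \<Longrightarrow> 0 < u z"
    and q: "set_integrable lebesgue (ball y d) (\<lambda>z. (qp z)\<^sup>2)"
begin

abbreviation "B \<equiv> ball y d"
text \<open>Because \<open>u\<close> is positive on \<open>B\<close>, A + Q is its whole energy
  there, and \<epsilon> is the relative excess that almost minimality admits on this ball.\<close>

definition "A = (LINT z:B|lebesgue. (norm (G z))\<^sup>2)"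
definition "Q = (LINT z:B|lebesgue. (qp z)\<^sup>2)"
definition "\<epsilon> = \<kappa> * d powr \<alpha>"

lemma \<epsilon>_nonneg: "0 \<le> \<epsilon>" using \<kappa> by (simp add: \<epsilon>_def)

lemma A_nonneg: "0 \<le> A" and Q_nonneg: "0 \<le> Q"
  unfolding A_def Q_def by (rule set_lebesgue_integral_nonneg; simp)+

text \<open>The competitor u + t \<Phi> has the same positivity set, so only the Dirichlet energy
  changes, by 2 t P + t^2 R. Minimality up to the factor 1 + \<epsilon> bounds -P from above, and
  division by 2 t leaves the two error terms. Small \<open>t\<close> suppresses the second; the
  first is then suppressed by \<epsilon>.\<close>

lemma almost_superharmonic:
  assumes \<Phi>: "test_function B \<Phi>" and \<Phi>0: "\<And>z. 0 \<le> \<Phi> z" and "0 < t"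
  shows "(LINT z:B|lebesgue. u z * (\<Sum>i\<in>UNIV. partial_deriv i (partial_deriv i \<Phi>) z))
    \<le> \<epsilon> * (A + Q) / (2 * t) + t / 2 * (LINT z:B|lebesgue. (norm (grad \<Phi> z))\<^sup>2)"
proof -
  define R where "R = (LINT z:B|lebesgue. (norm (grad \<Phi> z))\<^sup>2)"
  define P where "P = (LINT z:B|lebesgue. G z \<bullet> grad \<Phi> z)"
  let ?\<Phi> = "\<lambda>z. t * \<Phi> z"
  have t\<Phi>: "test_function B ?\<Phi>" by (rule test_function_cmult[OF \<Phi>])
  have g: "grad ?\<Phi> z = t *\<^sub>R grad \<Phi> z" for z
    using partial_deriv_cmult[OF smooth_differentiable[OF test_function_smooth[OF \<Phi>]], of _ t z]
    by (simp add: grad_def vec_eq_iff)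
  have v: "0 < modify (\<lambda>_. 0) ?\<Phi> u z" if "z \<in> B" for z
    using pos[OF that] \<Phi>0[of z] \<open>0 < t\<close> by (simp add: modify_def add_pos_nonneg)
  have mg: "(norm (modify_grad (\<lambda>_. 0) ?\<Phi> u G z))\<^sup>2 = (norm (G z))\<^sup>2 + (2 * t) * (G z \<bullet> grad \<Phi> z) + t\<^sup>2 * (norm (grad \<Phi> z))\<^sup>2" for z
  proof -
    have "modify_grad (\<lambda>_. 0) ?\<Phi> u G z = G z + t *\<^sub>R grad \<Phi> z"
      unfolding modify_grad_def g grad_const by simp
    then show ?thesis by (simp only: norm_add_scaled_sq)
  qed
  have iR: "set_integrable lebesgue B (\<lambda>z. (norm (grad \<Phi> z))\<^sup>2)"
    by (intro set_integrable_continuous continuous_intros continuous_on_grad test_function_smooth[OF \<Phi>])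
  note iP = weak_laplacian(1)[OF \<Phi>]
  have "(LINT z:B|lebesgue. (norm (modify_grad (\<lambda>_. 0) ?\<Phi> u G z))\<^sup>2) = A + 2 * t * P + t\<^sup>2 * R"
    unfolding mg A_def P_def R_def
      set_integral_add(2)[OF set_integral_add(1)[OF set_integrable_G_sq set_integrable_cmult[OF iP]] set_integrable_cmult[OF iR]]
      set_integral_add(2)[OF set_integrable_G_sq set_integrable_cmult[OF iP]] set_integral_mult_right by (rule refl)
  moreover have "(LINT z:B|lebesgue. (qp z)\<^sup>2 * indicat_real {z. 0 < modify (\<lambda>_. 0) ?\<Phi> u z} z) = Q"
    unfolding Q_def set_lebesgue_integral_def
    by (rule Bochner_Integration.integral_cong) (use v in \<open>auto split: split_indicator\<close>)
  ultimately have "A + Q \<le> (1 + \<epsilon>) * (A + 2 * t * P + t\<^sup>2 * R + Q)"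
    using energy_comparison[OF am sub \<kappa> pos q test_function_zero t\<Phi> less_imp_le[OF v]]
    unfolding A_def[symmetric] Q_def[symmetric] \<epsilon>_def[symmetric] by simp
  then have "0 \<le> \<epsilon> * (A + Q) + (1 + \<epsilon>) * (2 * t * P + t\<^sup>2 * R)" by (simp add: algebra_simps)
  then have "(1 + \<epsilon>) * (- (2 * t * P + t\<^sup>2 * R)) \<le> \<epsilon> * (A + Q)" by (simp add: algebra_simps)
  moreover have "- (2 * t * P + t\<^sup>2 * R) \<le> (1 + \<epsilon>) * (- (2 * t * P + t\<^sup>2 * R)) \<or> - (2 * t * P + t\<^sup>2 * R) \<le> 0"
    using mult_right_mono[of 1 "1 + \<epsilon>" "- (2 * t * P + t\<^sup>2 * R)"] \<epsilon>_nonneg by fastforce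
  moreover have "0 \<le> \<epsilon> * (A + Q)" using \<epsilon>_nonneg A_nonneg Q_nonneg by simp
  ultimately have "- (2 * t * P + t\<^sup>2 * R) \<le> \<epsilon> * (A + Q)" by linarith
  then have "(2 * t) * (- P) \<le> \<epsilon> * (A + Q) + t\<^sup>2 * R" by simp
  then have "- P \<le> (\<epsilon> * (A + Q) + t\<^sup>2 * R) / (2 * t)"
    using \<open>0 < t\<close> by (subst pos_le_divide_eq) (auto simp: mult.commute)
  also have "\<dots> = \<epsilon> * (A + Q) / (2 * t) + t / 2 * R"
    using \<open>0 < t\<close> by (simp add: add_divide_distrib power2_eq_square)
  finally show ?thesis using weak_laplacian(3)[OF \<Phi>] by (simp add: P_def R_def)
qed

text \<open>On \<open>B\<close> the competitor (1 - \<Psi>) u vanishes exactly where \<Psi> = 1, and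
  there the energy of positivity is saved. The price is the gradient of the cutoff, separated from
  the gradient of \<open>u\<close> with a weight \<tau> that keeps the multiple of \<open>A\<close>
  small.\<close>

lemma vanishing_competitor:
  assumes \<Psi>: "test_function B \<Psi>" and \<Psi>01: "\<And>z. 0 \<le> \<Psi> z" "\<And>z. \<Psi> z \<le> 1" and "0 < \<tau>"
  shows "(LINT z:B|lebesgue. (qp z)\<^sup>2 * indicat_real {z. \<Psi> z = 1} z)
    \<le> \<epsilon> * (A + Q) + \<tau> * A + (1 / \<tau> + 1) * (LINT z:B|lebesgue. (u' z * norm (grad \<Psi> z))\<^sup>2)"
proof -
  define P where "P = (LINT z:B|lebesgue. (u' z * norm (grad \<Psi> z))\<^sup>2)"
  define Q1 where "Q1 = (LINT z:B|lebesgue. (qp z)\<^sup>2 * indicat_real {z. \<Psi> z = 1} z)"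
  have sm: "smooth \<Psi>" by (rule test_function_smooth[OF \<Psi>])
  have v: "0 \<le> modify \<Psi> (\<lambda>_. 0) u z" "0 < modify \<Psi> (\<lambda>_. 0) u z \<longleftrightarrow> \<Psi> z \<noteq> 1" if "z \<in> B" for z
    using pos[OF that] \<Psi>01(2)[of z] by (auto simp: modify_def zero_less_mult_iff)
  have iP: "set_integrable lebesgue B (\<lambda>z. (u' z * norm (grad \<Psi> z))\<^sup>2)"
    by (intro set_integrable_continuous continuous_intros continuous_on_grad sm cont_u')
  have iA: "set_integrable lebesgue B (\<lambda>z. (1 + \<tau>) * (norm (G z))\<^sup>2)"
    using set_integrable_cmult[OF set_integrable_G_sq] .
  have iP': "set_integrable lebesgue B (\<lambda>z. (1 / \<tau> + 1) * (u' z * norm (grad \<Psi> z))\<^sup>2)"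
    using set_integrable_cmult[OF iP] .
  have pt: "(norm (modify_grad \<Psi> (\<lambda>_. 0) u G z))\<^sup>2
      \<le> (1 + \<tau>) * (norm (G z))\<^sup>2 + (1 / \<tau> + 1) * (u' z * norm (grad \<Psi> z))\<^sup>2" if "z \<in> B" for z
  proof -
    let ?a = "norm (G z)" and ?b = "u' z * norm (grad \<Psi> z)"
    have u: "u' z = u z" using eq[of z] ball_sub that by blast
    have b0: "0 \<le> ?b" using pos[OF that] u by simp
    have "norm (modify_grad \<Psi> (\<lambda>_. 0) u G z) \<le> norm ((1 - \<Psi> z) *\<^sub>R G z) + norm (u z *\<^sub>R grad \<Psi> z)"
      unfolding modify_grad_def grad_const add_0_right by (rule norm_triangle_ineq4)
    also have "\<dots> \<le> 1 * ?a + ?b"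
      unfolding norm_scaleR using \<Psi>01[of z] pos[OF that] u by (intro add_mono mult_right_mono) auto
    finally have "(norm (modify_grad \<Psi> (\<lambda>_. 0) u G z))\<^sup>2 \<le> (?a + ?b)\<^sup>2"
      by (intro power_mono) auto
    also have "\<dots> = ?a\<^sup>2 + ?b\<^sup>2 + 2 * ?a * ?b" by (rule power2_sum)
    \<comment> \<open>Young's inequality with weight \<tau>.\<close>
    also have "2 * ?a * ?b \<le> \<tau> * ?a\<^sup>2 + 1 / \<tau> * ?b\<^sup>2"
    proof -
      have "0 \<le> (\<tau> * ?a - ?b)\<^sup>2 / \<tau>" using \<open>0 < \<tau>\<close> by simp
      also have "\<dots> = \<tau> * ?a\<^sup>2 + 1 / \<tau> * ?b\<^sup>2 - 2 * ?a * ?b"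
        using \<open>0 < \<tau>\<close> by (simp add: power2_eq_square field_simps)
      finally show ?thesis by simp
    qed
    finally show ?thesis by (simp add: ring_distribs)
  qed
  have G1: "(LINT z:B|lebesgue. (norm (modify_grad \<Psi> (\<lambda>_. 0) u G z))\<^sup>2) \<le> (1 + \<tau>) * A + (1 / \<tau> + 1) * P"
  proof -
    have "(LINT z:B|lebesgue. (norm (modify_grad \<Psi> (\<lambda>_. 0) u G z))\<^sup>2)
      \<le> (LINT z:B|lebesgue. (1 + \<tau>) * (norm (G z))\<^sup>2 + (1 / \<tau> + 1) * (u' z * norm (grad \<Psi> z))\<^sup>2)"
      by (rule set_integral_mono[OF set_integrable_norm_grad_sq[OF \<Psi> test_function_zero] set_integral_add(1)[OF iA iP'] pt])
    also have "\<dots> = (1 + \<tau>) * A + (1 / \<tau> + 1) * P"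
      unfolding set_integral_add(2)[OF iA iP'] A_def P_def by (simp only: set_integral_mult_right)
    finally show ?thesis .
  qed
  have iQ1: "set_integrable lebesgue B (\<lambda>z. (qp z)\<^sup>2 * indicat_real {z. \<Psi> z = 1} z)"
  proof -
    have "closed {z. \<Psi> z = 1}"
      by (rule closed_Collect_eq[OF smooth_continuous_on[OF sm] continuous_on_const])
    then have o: "{z. \<Psi> z = 1} \<in> sets lebesgue" by auto
    show ?thesis
      using integrable_mult_indicator[OF o q[unfolded set_integrable_def]]
      by (simp add: set_integrable_def mult_ac)
  qed
  have Q2: "(LINT z:B|lebesgue. (qp z)\<^sup>2 * indicat_real {z. 0 < modify \<Psi> (\<lambda>_. 0) u z} z) = Q - Q1"
  proof -
    have "(LINT z:B|lebesgue. (qp z)\<^sup>2 * indicat_real {z. 0 < modify \<Psi> (\<lambda>_. 0) u z} z)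
        = (LINT z:B|lebesgue. (qp z)\<^sup>2 - (qp z)\<^sup>2 * indicat_real {z. \<Psi> z = 1} z)"
      unfolding set_lebesgue_integral_def
      by (rule Bochner_Integration.integral_cong) (use v(2) in \<open>auto split: split_indicator\<close>)
    also have "\<dots> = Q - Q1"
      unfolding Q_def Q1_def by (rule set_integral_diff(2)[OF q iQ1])
    finally show ?thesis .
  qed
  have "A + Q \<le> (1 + \<epsilon>) * ((LINT z:B|lebesgue. (norm (modify_grad \<Psi> (\<lambda>_. 0) u G z))\<^sup>2) + (Q - Q1))"
    using energy_comparison[OF am sub \<kappa> pos q \<Psi> test_function_zero v(1)]
    unfolding A_def[symmetric] Q_def[symmetric] \<epsilon>_def[symmetric] Q2 by simp
  also have "\<dots> \<le> (1 + \<epsilon>) * ((1 + \<tau>) * A + (1 / \<tau> + 1) * P + (Q - Q1))"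
    using G1 \<epsilon>_nonneg by (intro mult_left_mono add_right_mono) auto
  finally have *: "(1 + \<epsilon>) * (Q1 - (\<tau> * A + (1 / \<tau> + 1) * P)) \<le> \<epsilon> * (A + Q)"
    by (simp add: ring_distribs)
  have "0 \<le> \<epsilon> * (A + Q)" using \<epsilon>_nonneg A_nonneg Q_nonneg by simp
  moreover have "Q1 - (\<tau> * A + (1 / \<tau> + 1) * P) \<le> (1 + \<epsilon>) * (Q1 - (\<tau> * A + (1 / \<tau> + 1) * P))
      \<or> Q1 - (\<tau> * A + (1 / \<tau> + 1) * P) \<le> 0"
    using mult_right_mono[of 1 "1 + \<epsilon>" "Q1 - (\<tau> * A + (1 / \<tau> + 1) * P)"] \<epsilon>_nonneg by fastforce
  ultimately show ?thesis using * by (simp only: P_def Q1_def) linarith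
qed

end

section \<open>Profiles of the test functions\<close>

text \<open>At x = 1/t this bounds the slope of the truncation used in
  \<open>superharmonic_test_profile\<close> by 1.\<close>

lemma exp_one_plus_le: "(1 + x) * exp (- x) \<le> (1::real)"
  using mult_right_mono[OF exp_ge_add_one_self[of x], of "exp (- x)"] by (simp add: exp_minus)

lemma Ck_real_shift_powr: "Ck_real k {- a<..} (\<lambda>s. (s + a) powr p)"
proof (rule Ck_real_compose[where T = "{0<..}" and f = "\<lambda>x. x powr p" and g = "\<lambda>s. s + a"])
  show "Ck_real k {- a<..} (\<lambda>s. s + a)" by (intro Ck_real_add Ck_real_ident Ck_real_const)
qed (auto intro: Ck_real_powr)

text \<open>For W = (s + a) powr (-\<sigma>) the operator 4 s W'' + 2 n W' equals \<sigma> (s + a)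
  powr (-\<sigma> - 2) times s - 2 n a, which is negative only on the core s < 2 n a. The constant
  \<open>c\<close> is fixed before \<open>a\<close>: the gain on the annulus must survive while the
  core shrinks. The range of \<open>a\<close> keeps the core away from the annulus.\<close>

lemma superharmonic_test_profile:
  fixes n :: real
  assumes n: "2 \<le> n"
  defines "\<sigma> \<equiv> n / 2 - 3 / 4"
  obtains c where "0 < c"
    "\<forall>a. 0 < a \<and> a \<le> 1 / (64 * n) \<longrightarrow> (\<exists>F F' F''. (\<forall>k. Ck_real k {- a<..} F) \<and>
      (\<forall>s\<ge>0. (F has_real_derivative F' s) (at s) \<and> (F' has_real_derivative F'' s) (at s)) \<and>
      (\<forall>s. 0 \<le> F s) \<and> (\<forall>s\<ge>3/4. F s = 0) \<and> (\<forall>s\<ge>0. \<bar>F' s\<bar> \<le> \<sigma> * a powr (- \<sigma> - 1)) \<and>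
      (\<forall>s\<ge>0. c * indicat_real {1/16..1/4} s
          - \<sigma> * (2 * n * a) * a powr (- \<sigma> - 2) * indicat_real {..<2 * n * a} s \<le> 4 * s * F'' s + 2 * n * F' s))"
proof -
  have \<sigma>: "0 < \<sigma>" using n by (simp add: \<sigma>_def)
  \<comment> \<open>On the annulus s + a \<le> 1/2, so \<open>w0\<close> bounds the shifted power
    from below there; the shift 3/4 makes the profile vanish for s \<ge> 3/4.\<close>
  define w0 where "w0 = (1/2) powr (- \<sigma>) - (3/4) powr (- \<sigma>)"
  have w0: "0 < w0"
    unfolding w0_def using powr_less_mono2_neg[of "- \<sigma>" "1/2" "3/4"] \<sigma> by simp
  \<comment> \<open>On the annulus the truncation has slope at least exp (-1/w0), the power of s + a
    is at least 1, and s - 2 n a is at least 1/16 - 1/32 = 1/32.\<close>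
  define c where "c = exp (- (1 / w0)) * \<sigma> / 32"
  have c: "0 < c" using \<sigma> by (simp add: c_def)
  show thesis
  proof (rule that[OF c], intro allI impI)
    fix a assume a: "0 < a \<and> a \<le> 1 / (64 * n)"
    then have a0: "0 < a" and na: "2 * n * a \<le> 1 / 32" using n by (auto simp: field_simps)
    have a1: "a \<le> 1 / 128"
    proof -
      have "1 / (64 * n) \<le> 1 / 128" using n by (intro divide_left_mono) auto
      then show ?thesis using a by linarith
    qed
    define W where "W = (\<lambda>s. (s + a) powr (- \<sigma>) + - ((3/4) powr (- \<sigma>)))"
    define W' where "W' = (\<lambda>s. - \<sigma> * (s + a) powr (- \<sigma> - 1))"
    define W'' where "W'' = (\<lambda>s. \<sigma> * (\<sigma> + 1) * (s + a) powr (- \<sigma> - 2))"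
    \<comment> \<open>\<open>h\<close> is smooth, convex and nondecreasing with \<open>h' \<le> 1\<close> and \<open>h = 0\<close> for \<open>t \<le> 0\<close>, so that \<open>h \<circ> W\<close>
      has bounded support and is subharmonic wherever \<open>W\<close> is.\<close>
    define h where "h = (\<lambda>t. t * flat 0 t)"
    define h' where "h' = (\<lambda>t. flat 0 t + flat 1 t)"
    define F where "F = (\<lambda>s. h (W s))"
    define F' where "F' = (\<lambda>s. h' (W s) * W' s)"
    define F'' where "F'' = (\<lambda>s. flat 3 (W s) * W' s * W' s + W'' s * h' (W s))"
    have dW: "(W has_real_derivative W' s) (at s)" and dW': "(W' has_real_derivative W'' s) (at s)" if "0 \<le> s" for s
    proof -
      have s: "0 < s + a" using that a0 by simp
      have D: "((\<lambda>s. (s + a) powr p) has_real_derivative p * (s + a) powr (p - 1)) (at s)" for p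
        using DERIV_chain2[OF has_real_derivative_powr[OF s, of p] DERIV_add[OF DERIV_ident DERIV_const[of a]]] by simp
      from DERIV_add[OF D[of "- \<sigma>"] DERIV_const[of "- ((3/4) powr (- \<sigma>))"]]
      show "(W has_real_derivative W' s) (at s)" by (simp only: W_def W'_def add_0_right)
      from DERIV_cmult[OF D[of "- \<sigma> - 1"], of "- \<sigma>"]
      have "(W' has_real_derivative - \<sigma> * ((- \<sigma> - 1) * (s + a) powr (- \<sigma> - 1 - 1))) (at s)"
        by (simp only: W'_def)
      moreover have "- \<sigma> * ((- \<sigma> - 1) * (s + a) powr (- \<sigma> - 1 - 1)) = W'' s"
        by (simp add: W''_def algebra_simps)
      ultimately show "(W' has_real_derivative W'' s) (at s)" by simp
    qed
    have dh: "(h has_real_derivative h' t) (at t)" for t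
    proof -
      have "(h has_real_derivative 1 * flat 0 t + (flat (0 + 2) t - real 0 * flat (0 + 1) t) * t) (at t)"
        unfolding h_def by (rule DERIV_mult[OF DERIV_ident flat_has_derivative])
      moreover have "1 * flat 0 t + (flat (0 + 2) t - real 0 * flat (0 + 1) t) * t = h' t"
        by (auto simp: h'_def flat_def power2_eq_square)
      ultimately show ?thesis by simp
    qed
    have dh': "(h' has_real_derivative flat 3 t) (at t)" for t
    proof -
      have "(h' has_real_derivative (flat (0 + 2) t - real 0 * flat (0 + 1) t) + (flat (1 + 2) t - real 1 * flat (1 + 1) t)) (at t)"
        unfolding h'_def by (rule DERIV_add[OF flat_has_derivative flat_has_derivative])
      then show ?thesis by (simp add: numeral_3_eq_3 numeral_2_eq_2)
    qed
    have h'0: "0 \<le> h' t" for t by (simp add: h'_def flat_nonneg)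
    have h'1: "h' t \<le> 1" for t
    proof (cases "0 < t")
      case True
      then show ?thesis using exp_one_plus_le[of "1 / t"] by (simp add: h'_def flat_def ring_distribs)
    qed (simp add: h'_def flat_def)
    have Ck: "Ck_real k {- a<..} F" for k
    proof -
      have "Ck_real k {- a<..} W"
        unfolding W_def by (intro Ck_real_add Ck_real_shift_powr Ck_real_const)
      moreover have "Ck_real k UNIV h"
        unfolding h_def by (intro Ck_real_mult Ck_real_ident Ck_real_flat)
      ultimately show ?thesis unfolding F_def
        by (intro Ck_real_compose[where T = UNIV and f = h and g = W]) auto
    qed
    have dF: "(F has_real_derivative F' s) (at s)" if "0 \<le> s" for s
      unfolding F_def F'_def by (rule DERIV_chain2[OF dh dW[OF that]])
    have dF': "(F' has_real_derivative F'' s) (at s)" if "0 \<le> s" for s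
      unfolding F'_def F''_def by (rule DERIV_mult[OF DERIV_chain2[OF dh' dW[OF that]] dW'[OF that]])
    have F0: "0 \<le> F s" for s by (simp add: F_def h_def flat_def)
    have Fz: "F s = 0" if "3/4 \<le> s" for s
    proof -
      have "(s + a) powr (- \<sigma>) \<le> (3/4) powr (- \<sigma>)"
        using that a0 \<sigma> by (intro powr_mono2') auto
      then show ?thesis by (simp add: F_def h_def flat_def W_def)
    qed
    have F'b: "\<bar>F' s\<bar> \<le> \<sigma> * a powr (- \<sigma> - 1)" if "0 \<le> s" for s
    proof -
      have "\<bar>F' s\<bar> = h' (W s) * (\<sigma> * (s + a) powr (- \<sigma> - 1))"
        using h'0 \<sigma> by (simp add: F'_def W'_def abs_mult)
      also have "\<dots> \<le> 1 * (\<sigma> * (s + a) powr (- \<sigma> - 1))"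
        using h'1 \<sigma> by (intro mult_right_mono) auto
      also have "(s + a) powr (- \<sigma> - 1) \<le> a powr (- \<sigma> - 1)"
        using that a0 \<sigma> by (intro powr_mono2') auto
      finally show ?thesis using \<sigma> by simp
    qed
    have lap: "h' (W s) * (\<sigma> * (s + a) powr (- \<sigma> - 2) * (s - 2 * n * a)) \<le> 4 * s * F'' s + 2 * n * F' s" if "0 \<le> s" for s
    proof -
      have s: "0 < s + a" using that a0 by simp
      define g where "g = (s + a) powr (- \<sigma> - 2)"
      have g1: "(s + a) powr (- \<sigma> - 1) = (s + a) * g"
      proof -
        have "- \<sigma> - 1 = 1 + (- \<sigma> - 2)" by simp
        then have "(s + a) powr (- \<sigma> - 1) = (s + a) powr 1 * g" by (simp only: powr_add g_def)
        then show ?thesis using s by simp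
      qed
      have "4 * s * W'' s + 2 * n * W' s = \<sigma> * g * (4 * s * (\<sigma> + 1) - 2 * n * (s + a))"
        unfolding W''_def W'_def g1 g_def[symmetric] by (simp add: ring_distribs)
      \<comment> \<open>The choice of \<sigma> enters here: 4 (\<sigma> + 1) = 2 n + 1, so exactly
        one copy of \<open>s\<close> survives.\<close>
      also have "4 * s * (\<sigma> + 1) - 2 * n * (s + a) = s - 2 * n * a"
        by (simp add: \<sigma>_def field_simps)
      finally have e: "4 * s * W'' s + 2 * n * W' s = \<sigma> * g * (s - 2 * n * a)" .
      have "4 * s * F'' s + 2 * n * F' s = 4 * s * (flat 3 (W s) * (W' s * W' s)) + h' (W s) * (4 * s * W'' s + 2 * n * W' s)"
        by (simp add: F''_def F'_def ring_distribs)
      \<comment> \<open>Convexity of the truncation: its second derivative contributes with the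
        favourable sign.\<close>
      moreover have "0 \<le> 4 * s * (flat 3 (W s) * (W' s * W' s))"
        using that flat_nonneg[of 3 "W s"] by simp
      ultimately show ?thesis unfolding e g_def[symmetric] by linarith
    qed
    have low: "c * indicat_real {1/16..1/4} s
          - \<sigma> * (2 * n * a) * a powr (- \<sigma> - 2) * indicat_real {..<2 * n * a} s \<le> 4 * s * F'' s + 2 * n * F' s"
      if "0 \<le> s" for s
    proof -
      define g where "g = (s + a) powr (- \<sigma> - 2)"
      have g0: "0 \<le> g" by (simp add: g_def)
      have ga: "g \<le> a powr (- \<sigma> - 2)" unfolding g_def using that a0 \<sigma> by (intro powr_mono2') auto
      note lap = lap[OF that, folded g_def]
      consider "s < 2 * n * a" | "s \<in> {1/16..1/4}" | "2 * n * a \<le> s" "s \<notin> {1/16..1/4}" by fastforce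
      then show ?thesis
      proof cases
        case 1
        have "s \<notin> {1/16..1/4}" using 1 na by auto
        have "h' (W s) * (\<sigma> * g * (2 * n * a - s)) \<le> 1 * (\<sigma> * a powr (- \<sigma> - 2) * (2 * n * a))"
          using h'0 h'1 \<sigma> g0 ga 1 that n a0 by (intro mult_mono) auto
        moreover have "h' (W s) * (\<sigma> * g * (s - 2 * n * a)) = - (h' (W s) * (\<sigma> * g * (2 * n * a - s)))"
          by (simp add: ring_distribs)
        ultimately have "- (\<sigma> * (2 * n * a) * a powr (- \<sigma> - 2)) \<le> 4 * s * F'' s + 2 * n * F' s"
          using lap by (simp add: mult_ac)
        then show ?thesis using 1 \<open>s \<notin> {1/16..1/4}\<close> by simp
      next
        case 2
        have gs: "s + a \<le> 1 / 2" "0 < s + a" using 2 a1 a0 by auto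
        have "(1/2) powr (- \<sigma>) \<le> (s + a) powr (- \<sigma>)" using gs \<sigma> by (intro powr_mono2') auto
        then have Ww: "w0 \<le> W s" by (simp add: W_def w0_def)
        then have "1 / W s \<le> 1 / w0" using w0 by (intro divide_left_mono) auto
        then have "exp (- (1 / w0)) \<le> flat 0 (W s)" using Ww w0 by (simp add: flat_def)
        then have hc: "exp (- (1 / w0)) \<le> h' (W s)" using flat_nonneg[of 1 "W s"] by (simp add: h'_def)
        have g1: "1 \<le> g"
        proof -
          have "1 powr (- \<sigma> - 2) \<le> (s + a) powr (- \<sigma> - 2)" using gs \<sigma> by (intro powr_mono2') auto
          then show ?thesis by (simp add: g_def)
        qed
        have "exp (- (1 / w0)) * (\<sigma> * 1 * (1 / 32)) \<le> h' (W s) * (\<sigma> * g * (s - 2 * n * a))"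
          using hc g1 \<sigma> 2 na g0 h'0 by (intro mult_mono) auto
        then have "c \<le> 4 * s * F'' s + 2 * n * F' s" using lap by (simp add: c_def)
        moreover have "\<not> s < 2 * n * a" using 2 na by auto
        ultimately show ?thesis using 2 by simp
      next
        case 3
        have "0 \<le> h' (W s) * (\<sigma> * g * (s - 2 * n * a))" using h'0 \<sigma> g0 3 by simp
        then show ?thesis using lap 3 by simp
      qed
    qed
    show "\<exists>F F' F''. (\<forall>k. Ck_real k {- a<..} F) \<and>
      (\<forall>s\<ge>0. (F has_real_derivative F' s) (at s) \<and> (F' has_real_derivative F'' s) (at s)) \<and>
      (\<forall>s. 0 \<le> F s) \<and> (\<forall>s\<ge>3/4. F s = 0) \<and> (\<forall>s\<ge>0. \<bar>F' s\<bar> \<le> \<sigma> * a powr (- \<sigma> - 1)) \<and>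
      (\<forall>s\<ge>0. c * indicat_real {1/16..1/4} s
          - \<sigma> * (2 * n * a) * a powr (- \<sigma> - 2) * indicat_real {..<2 * n * a} s \<le> 4 * s * F'' s + 2 * n * F' s)"
      by (rule exI[of _ F], rule exI[of _ F'], rule exI[of _ F'']) (intro conjI allI impI Ck dF dF' F0 Fz F'b low)
  qed
qed

text \<open>The quotient p / (p + m) of two flat functions whose positivity sets cover the line. In
  terms of distance the transition takes place between d/4 and d/2, on the annulus for which the
  other profile has its lower bound.\<close>

lemma cutoff_profile:
  obtains \<psi> \<psi>' :: "real \<Rightarrow> real" and C where "\<forall>k. Ck_real k UNIV \<psi>"
    "\<forall>s. (\<psi> has_real_derivative \<psi>' s) (at s)" "\<forall>s. 0 \<le> \<psi> s \<and> \<psi> s \<le> 1"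
    "\<forall>s\<le>1/16. \<psi> s = 1" "\<forall>s\<ge>1/4. \<psi> s = 0" "\<forall>s. s \<notin> {1/16..1/4} \<longrightarrow> \<psi>' s = 0" "\<forall>s. \<bar>\<psi>' s\<bar> \<le> C" "0 < C"
proof -
  define p where "p = (\<lambda>s::real. flat 0 (1/4 - s))"
  define m where "m = (\<lambda>s::real. flat 0 (s + - (1/16)))"
  define \<psi> where "\<psi> = (\<lambda>s. p s * (p s + m s) powr (- 1))"
  have pm: "0 < p s + m s" for s
    by (cases "s < 1/4") (auto simp: p_def m_def flat_def intro: add_pos_nonneg)
  have p0: "0 \<le> p s" "0 \<le> m s" for s by (auto simp: p_def m_def flat_nonneg)
  have \<psi>_alt: "\<psi> s = p s / (p s + m s)" for s
    using pm[of s] by (simp add: \<psi>_def powr_minus_divide)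
  have Ck: "Ck_real k UNIV \<psi>" for k
  proof -
    have p: "Ck_real k UNIV p" unfolding p_def by (rule Ck_real_bump)
    have m: "Ck_real k UNIV m" unfolding m_def
      by (rule Ck_real_compose[where T = UNIV and f = "flat 0" and g = "\<lambda>s. s + - (1/16)"])
         (auto intro!: Ck_real_flat Ck_real_add Ck_real_ident Ck_real_const simp del: add_uminus_conv_diff)
    show ?thesis unfolding \<psi>_def
      by (intro Ck_real_mult p Ck_real_compose[where T = "{0<..}" and f = "\<lambda>x. x powr (- 1)" and g = "\<lambda>s. p s + m s"]
          Ck_real_powr Ck_real_add m) (use pm in auto)
  qed
  obtain \<psi>' where d: "\<forall>s. (\<psi> has_real_derivative \<psi>' s) (at s)" and c: "continuous_on UNIV \<psi>'"
    using Ck[of "Suc 0"] by auto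
  have one: "\<psi> s = 1" if "s \<le> 1/16" for s
    using pm[of s] that by (simp add: \<psi>_alt m_def flat_def)
  have zero: "\<psi> s = 0" if "1/4 \<le> s" for s
    using that by (simp add: \<psi>_alt p_def flat_def)
  have loc: "\<psi>' s = 0" if "s \<notin> {1/16..1/4}" for s
  proof -
    have "(\<psi> has_real_derivative 0) (at s)"
    proof (cases "s < 1/16")
      case True
      have "((\<lambda>_. 1) has_real_derivative 0) (at s)" by simp
      then show ?thesis
        by (rule has_field_derivative_transform_within_open[where S = "{..<1/16}"]) (use True one in auto)
    next
      case False
      have "((\<lambda>_. 0) has_real_derivative 0) (at s)" by simp
      then show ?thesis
        by (rule has_field_derivative_transform_within_open[where S = "{1/4<..}"]) (use False that zero in auto)
    qed
    then show ?thesis using d DERIV_unique by blast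
  qed
  have "bounded (\<psi>' ` {1/16..1/4})"
    by (intro compact_imp_bounded compact_continuous_image continuous_on_subset[OF c]) auto
  then obtain C where C: "0 < C" "\<forall>s\<in>{1/16..1/4}. \<bar>\<psi>' s\<bar> \<le> C"
    unfolding bounded_pos by auto
  have Cb: "\<bar>\<psi>' s\<bar> \<le> C" for s
    using C loc[of s] by (cases "s \<in> {1/16..1/4}") auto
  have "0 \<le> \<psi> s \<and> \<psi> s \<le> 1" for s
    using pm[of s] p0[of s] by (simp add: \<psi>_alt)
  then show thesis
    by (intro that[of \<psi> \<psi>' C] allI impI Ck d one zero loc Cb C(1)) auto
qed

section \<open>Energy estimates on a zero-free ball\<close>

lemma measure_lebesgue_ball:
  assumes "0 \<le> r"
  shows "measure lebesgue (ball (y :: 'a::euclidean_space) r) = unit_ball_vol (real DIM('a)) * r ^ DIM('a)"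
  using content_ball[OF assms, of y] by (simp add: measure_completion)

lemma set_integral_indicator_ball:
  fixes y :: "'a::euclidean_space"
  assumes "b \<le> d"
  shows "set_integrable lebesgue (ball y d) (\<lambda>z. k * indicat_real (ball y b) z)"
    and "(LINT z:ball y d|lebesgue. k * indicat_real (ball y b) z) = k * measure lebesgue (ball y b)"
proof -
  have e: "indicat_real (ball y d) z *\<^sub>R (k * indicat_real (ball y b) z) = k * indicat_real (ball y b) z" for z
    using assms by (auto split: split_indicator)
  have i: "integrable lebesgue (indicat_real (ball y b))"
    by (intro integrable_real_indicator) (use emeasure_lborel_ball_finite in \<open>auto simp: less_top\<close>)
  show "set_integrable lebesgue (ball y d) (\<lambda>z. k * indicat_real (ball y b) z)"
    unfolding set_integrable_def e using i by (rule integrable_mult_right)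
  show "(LINT z:ball y d|lebesgue. k * indicat_real (ball y b) z) = k * measure lebesgue (ball y b)"
    unfolding set_lebesgue_integral_def e using i by simp
qed

lemma set_integral_ball_le_const:
  fixes f :: "'a::euclidean_space \<Rightarrow> real"
  assumes f: "set_integrable lebesgue (ball y d) f" and le: "AE z in lebesgue. z \<in> ball y d \<longrightarrow> f z \<le> k"
  shows "(LINT z:ball y d|lebesgue. f z) \<le> k * measure lebesgue (ball y d)"
proof -
  note i = set_integral_indicator_ball[OF order_refl, of y d k]
  have "(LINT z:ball y d|lebesgue. f z) \<le> (LINT z:ball y d|lebesgue. k * indicat_real (ball y d) z)"
    unfolding set_lebesgue_integral_def
  proof (rule integral_mono_AE[OF f[unfolded set_integrable_def] i(1)[unfolded set_integrable_def]])
    show "AE z in lebesgue. indicat_real (ball y d) z *\<^sub>R f z \<le> indicat_real (ball y d) z *\<^sub>R (k * indicat_real (ball y d) z)"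
      using le by eventually_elim (auto split: split_indicator)
  qed
  then show ?thesis unfolding i(2) .
qed

context positive_almost_minimizer
begin

definition "V = measure lebesgue B"
definition "s z = (norm (z - y))\<^sup>2 / d\<^sup>2"
text \<open>The integral of \<open>u\<close> over the annulus d/4 \<le> |z - y| \<le> d/2, the
  quantity exchanged between the two comparisons: almost superharmonicity bounds it from above, and
  it bounds the cost of cutting \<open>u\<close> off.\<close>

definition "I = (LINT z:B|lebesgue. u' z * indicat_real {1/16..1/4} (s z))"

lemma s_nonneg: "0 \<le> s z" by (simp add: s_def)

lemma s_less_iff: "0 \<le> b \<Longrightarrow> s z < b\<^sup>2 \<longleftrightarrow> z \<in> ball y (b * d)"
proof -
  assume b: "0 \<le> b"
  have "s z < b\<^sup>2 \<longleftrightarrow> (norm (z - y))\<^sup>2 < (b * d)\<^sup>2"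
    using d(1) by (simp add: s_def divide_less_eq power_mult_distrib)
  also have "\<dots> \<longleftrightarrow> norm (z - y) < b * d"
    using b d(1) by (auto intro: power_strict_mono power_less_imp_less_base)
  finally show ?thesis by (simp add: dist_norm norm_minus_commute)
qed

lemma V_pos: "0 < V"
  unfolding V_def using d(1) by (simp add: measure_lebesgue_ball)

lemma measure_ball_scale:
  assumes "0 \<le> b"
  shows "measure lebesgue (ball y (b * d)) = b ^ CARD('n) * V"
proof -
  have bd: "0 \<le> b * d" using assms d(1) by simp
  show ?thesis
    unfolding V_def measure_lebesgue_ball[OF bd] measure_lebesgue_ball[OF less_imp_le[OF d(1)]]
    by (simp add: power_mult_distrib)
qed

lemma u'_pos: "z \<in> B \<Longrightarrow> 0 < u' z"
  using pos[of z] eq[of z] ball_sub by auto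

lemma u'_le: "norm (z - y) \<le> b \<Longrightarrow> u' z \<le> u' y + L * b"
proof -
  assume b: "norm (z - y) \<le> b"
  have "\<bar>u' z - u' y\<bar> \<le> L * dist z y"
    using lip by (auto simp: lipschitz_on_def dist_real_def)
  also have "\<dots> \<le> L * b" using b L_nonneg by (intro mult_left_mono) (auto simp: dist_norm)
  finally show ?thesis by linarith
qed

lemma A_le: "A \<le> L\<^sup>2 * V"
  unfolding A_def V_def
  by (rule set_integral_ball_le_const[OF set_integrable_G_sq])
     (use G_le in \<open>eventually_elim, auto intro: power_mono\<close>)

lemma annulus_integrable: "set_integrable lebesgue B (\<lambda>z. u' z * indicat_real {1/16..1/4} (s z))"
proof -
  have c: "continuous_on UNIV s"
    unfolding s_def[abs_def] by (intro continuous_intros) (use d in auto)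
  have "closed (s -` {1/16..1/4})"
    using c by (intro closed_vimage) auto
  then have o: "s -` {1/16..1/4} \<in> sets lebesgue" by auto
  have "integrable lebesgue (\<lambda>z. indicat_real (s -` {1/16..1/4}) z *\<^sub>R (indicat_real B z *\<^sub>R u' z))"
    by (rule integrable_mult_indicator[OF o set_integrable_continuous[OF cont_u', unfolded set_integrable_def]])
  also have "(\<lambda>z. indicat_real (s -` {1/16..1/4}) z *\<^sub>R (indicat_real B z *\<^sub>R u' z))
      = (\<lambda>z. indicat_real B z *\<^sub>R (u' z * indicat_real {1/16..1/4} (s z)))"
    by (auto split: split_indicator)
  finally show ?thesis by (simp only: set_integrable_def)
qed

text \<open>The integral of \<open>u\<close> against the Laplacian of the test function is estimated
  twice: from above by almost superharmonicity, from below by c I / d minus the contribution of the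
  core, the ball of radius b d. There the Lipschitz bound and the smallness of u(y) give u \<le>
  (\<eta> + L b) d.\<close>

lemma annulus_integral_le:
  fixes F F' F'' :: "real \<Rightarrow> real"
  assumes F: "\<forall>k. Ck_real k S F" "{0..} \<subseteq> S"
    and F': "\<forall>s\<ge>0. (F has_real_derivative F' s) (at s) \<and> (F' has_real_derivative F'' s) (at s)"
    and F0: "\<forall>s. 0 \<le> F s" "\<forall>s\<ge>3/4. F s = 0" and C1: "\<forall>s\<ge>0. \<bar>F' s\<bar> \<le> C1"
    and low: "\<forall>s\<ge>0. c * indicat_real {1/16..1/4} s - C3 * indicat_real {..<b\<^sup>2} s
        \<le> 4 * s * F'' s + 2 * real CARD('n) * F' s"
    and C3: "0 \<le> C3" and b: "0 \<le> b" "b \<le> 1" and \<eta>: "u' y \<le> \<eta> * d" and "0 < t"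
  shows "c * (I / d) \<le> \<epsilon> * (A + Q) / (2 * t) + t / 2 * ((2 * C1)\<^sup>2 * V) + C3 * (\<eta> + L * b) * (b ^ CARD('n) * V)"
proof -
  let ?R = "radial F y d :: real^'n \<Rightarrow> real"
  \<comment> \<open>The factor \<open>d\<close> makes the gradient of the test function bounded
    independently of \<open>d\<close> and its Laplacian of order 1/d.\<close>
  let ?\<Phi> = "\<lambda>z. d * ?R z"
  have d0: "d \<noteq> 0" using d(1) by simp
  have D1: "\<And>s. 0 \<le> s \<Longrightarrow> (F has_real_derivative F' s) (at s)"
    and D2: "\<And>s. 0 \<le> s \<Longrightarrow> (F' has_real_derivative F'' s) (at s)" using F' by auto
  have tR: "test_function B ?R"
    by (rule test_function_radial[where S = S and b = "3/4"]) (use F F0 d in auto)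
  have t\<Phi>: "test_function B ?\<Phi>" by (rule test_function_cmult[OF tR])
  have p1: "partial_deriv i ?\<Phi> = (\<lambda>z. d * partial_deriv i ?R z)" for i
    by (rule ext) (rule partial_deriv_cmult[OF smooth_differentiable[OF test_function_smooth[OF tR]]])
  have p2: "partial_deriv i (partial_deriv i ?\<Phi>) z = d * partial_deriv i (partial_deriv i ?R) z" for i z
    unfolding p1
    by (rule partial_deriv_cmult[OF smooth_differentiable[OF smooth_partial_deriv[OF test_function_smooth[OF tR]]]])
  have lap: "(\<Sum>i\<in>UNIV. partial_deriv i (partial_deriv i ?\<Phi>) z)
      = (4 * s z * F'' (s z) + 2 * real CARD('n) * F' (s z)) / d" for z
  proof -
    have "(\<Sum>i\<in>UNIV. partial_deriv i (partial_deriv i ?\<Phi>) z) = d * (\<Sum>i\<in>UNIV. partial_deriv i (partial_deriv i ?R) z)"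
      unfolding p2 by (rule sum_distrib_left[symmetric])
    also have "\<dots> = d * ((4 * s z * F'' (s z) + 2 * real CARD('n) * F' (s z)) / d\<^sup>2)"
      unfolding s_def by (rule arg_cong[where f = "(*) d"], rule laplacian_radial[OF D1 D2 d0])
    also have "\<dots> = (4 * s z * F'' (s z) + 2 * real CARD('n) * F' (s z)) / d"
      using d0 by (simp add: power2_eq_square)
    finally show ?thesis .
  qed
  have g: "norm (grad ?\<Phi> z) \<le> 2 * C1" if z: "z \<in> B" for z
  proof -
    have "grad ?\<Phi> z = d *\<^sub>R grad ?R z" by (simp add: grad_def vec_eq_iff p1)
    also have "grad ?R z = (2 * F' (s z) / d\<^sup>2) *\<^sub>R (z - y)"
      unfolding s_def by (rule grad_radial[OF D1]) simp
    finally have "norm (grad ?\<Phi> z) = 2 * \<bar>F' (s z)\<bar> * (norm (z - y) / d)"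
      using d(1) by (simp add: abs_mult power2_eq_square)
    also have "\<dots> \<le> 2 * C1 * 1"
      using C1 s_nonneg[of z] z d(1) by (intro mult_mono) (auto simp: dist_norm norm_minus_commute divide_le_eq intro: order_trans[OF abs_ge_zero])
    finally show ?thesis by simp
  qed
  have gi: "(LINT z:B|lebesgue. (norm (grad ?\<Phi> z))\<^sup>2) \<le> (2 * C1)\<^sup>2 * V"
    unfolding V_def
  proof (rule set_integral_ball_le_const)
    show "set_integrable lebesgue B (\<lambda>z. (norm (grad ?\<Phi> z))\<^sup>2)"
      by (intro set_integrable_continuous continuous_intros continuous_on_grad test_function_smooth[OF t\<Phi>])
    show "AE z in lebesgue. z \<in> B \<longrightarrow> (norm (grad ?\<Phi> z))\<^sup>2 \<le> (2 * C1)\<^sup>2"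
      by (intro AE_I2 impI power_mono g norm_ge_zero)
  qed
  have up: "(LINT z:B|lebesgue. u z * (\<Sum>i\<in>UNIV. partial_deriv i (partial_deriv i ?\<Phi>) z))
      \<le> \<epsilon> * (A + Q) / (2 * t) + t / 2 * ((2 * C1)\<^sup>2 * V)"
  proof -
    have "t / 2 * (LINT z:B|lebesgue. (norm (grad ?\<Phi> z))\<^sup>2) \<le> t / 2 * ((2 * C1)\<^sup>2 * V)"
      using gi \<open>0 < t\<close> by (intro mult_left_mono) auto
    moreover have "0 \<le> ?\<Phi> z" for z using F0(1) d(1) by (simp add: radial_def)
    then have "(LINT z:B|lebesgue. u z * (\<Sum>i\<in>UNIV. partial_deriv i (partial_deriv i ?\<Phi>) z))
        \<le> \<epsilon> * (A + Q) / (2 * t) + t / 2 * (LINT z:B|lebesgue. (norm (grad ?\<Phi> z))\<^sup>2)"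
      by (rule almost_superharmonic[OF t\<Phi> _ \<open>0 < t\<close>])
    ultimately show ?thesis by linarith
  qed
  have bd: "b * d \<le> d" using b d(1) by simp
  note ic = set_integral_indicator_ball[OF bd, of y "C3 * (\<eta> + L * b)"]
  note ia = set_integrable_cmult[OF annulus_integrable, of "c / d"]
  have "(LINT z:B|lebesgue. c / d * (u' z * indicat_real {1/16..1/4} (s z)) - C3 * (\<eta> + L * b) * indicat_real (ball y (b * d)) z)
      \<le> (LINT z:B|lebesgue. u z * (\<Sum>i\<in>UNIV. partial_deriv i (partial_deriv i ?\<Phi>) z))"
  proof (rule set_integral_mono[OF set_integral_diff(1)[OF ia ic(1)] weak_laplacian(2)[OF t\<Phi>]])
    fix z assume z: "z \<in> B"
    have u: "u z = u' z" using eq[of z] ball_sub z by auto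
    \<comment> \<open>The condition s z < b^2 describes the ball of radius b d about
      \<open>y\<close>, so both indicators are those of the core.\<close>
    have core: "u' z / d * indicat_real {..<b\<^sup>2} (s z) \<le> (\<eta> + L * b) * indicat_real (ball y (b * d)) z"
    proof (cases "z \<in> ball y (b * d)")
      case True
      then have "norm (z - y) \<le> b * d" by (simp add: dist_norm norm_minus_commute)
      then have "u' z \<le> \<eta> * d + L * (b * d)" using u'_le \<eta> by fastforce
      then have "u' z / d \<le> \<eta> + L * b" using d(1) by (simp add: divide_le_eq ring_distribs mult_ac)
      then show ?thesis using True s_less_iff[OF b(1), of z] by simp
    next
      case False
      then show ?thesis using s_less_iff[OF b(1), of z] by simp
    qed
    have "c / d * (u' z * indicat_real {1/16..1/4} (s z)) - C3 * (\<eta> + L * b) * indicat_real (ball y (b * d)) z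
        \<le> c / d * (u' z * indicat_real {1/16..1/4} (s z)) - C3 * (u' z / d * indicat_real {..<b\<^sup>2} (s z))"
      using mult_left_mono[OF core C3] by (simp only: mult.assoc)
    also have "\<dots> = u' z / d * (c * indicat_real {1/16..1/4} (s z) - C3 * indicat_real {..<b\<^sup>2} (s z))"
      by (simp add: right_diff_distrib mult.left_commute)
    also have "\<dots> \<le> u' z / d * (4 * s z * F'' (s z) + 2 * real CARD('n) * F' (s z))"
      using low s_nonneg[of z] u'_pos[OF z] d(1) by (intro mult_left_mono) auto
    also have "\<dots> = u z * (\<Sum>i\<in>UNIV. partial_deriv i (partial_deriv i ?\<Phi>) z)"
      unfolding lap u by simp
    finally show "c / d * (u' z * indicat_real {1/16..1/4} (s z)) - C3 * (\<eta> + L * b) * indicat_real (ball y (b * d)) z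
        \<le> u z * (\<Sum>i\<in>UNIV. partial_deriv i (partial_deriv i ?\<Phi>) z)" .
  qed
  moreover have "(LINT z:B|lebesgue. c / d * (u' z * indicat_real {1/16..1/4} (s z))) = c / d * I"
    unfolding I_def by (rule set_integral_mult_right)
  ultimately have "c / d * I - C3 * (\<eta> + L * b) * (b ^ CARD('n) * V)
      \<le> (LINT z:B|lebesgue. u z * (\<Sum>i\<in>UNIV. partial_deriv i (partial_deriv i ?\<Phi>) z))"
    by (simp only: set_integral_diff(2)[OF ia ic(1)] ic(2) measure_ball_scale[OF b(1)])
  with up show ?thesis by simp
qed

text \<open>Cutting \<open>u\<close> off on B(y, d/4) saves at least \<rho>^2 times the volume of
  that ball. The gradient of the cutoff is at most 2 C / d and lives on the annulus.\<close>

lemma positivity_cost_le: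
  assumes \<psi>: "\<forall>k. Ck_real k UNIV \<psi>" "\<forall>s. (\<psi> has_real_derivative \<psi>' s) (at s)" "\<forall>s. 0 \<le> \<psi> s \<and> \<psi> s \<le> 1"
    "\<forall>s\<le>1/16. \<psi> s = 1" "\<forall>s\<ge>1/4. \<psi> s = 0" "\<forall>s. s \<notin> {1/16..1/4} \<longrightarrow> \<psi>' s = 0" "\<forall>s. \<bar>\<psi>' s\<bar> \<le> C"
    and \<rho>: "0 \<le> \<rho>" "\<And>z. z \<in> B \<Longrightarrow> \<rho> \<le> qp z"
    and uy: "u' y \<le> L * d" and "0 < \<tau>"
  shows "\<rho>\<^sup>2 * ((1/4) ^ CARD('n) * V) \<le> \<epsilon> * (A + Q) + \<tau> * A + (1 / \<tau> + 1) * (2 * L * (2 * C)\<^sup>2 * (I / d))"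
proof -
  let ?\<Psi> = "radial \<psi> y d :: real^'n \<Rightarrow> real"
  have t: "test_function B ?\<Psi>"
    by (rule test_function_radial[where S = UNIV and b = "1/4"]) (use \<psi> d in auto)
  have C0: "0 \<le> C" using \<psi>(7) abs_ge_zero order_trans by blast
  have g: "grad ?\<Psi> z = (2 * \<psi>' (s z) / d\<^sup>2) *\<^sub>R (z - y)" for z
    unfolding s_def by (rule grad_radial) (use \<psi>(2) in blast)
  have quarter: "1/4 * d \<le> d" using d(1) by simp
  note iq = set_integral_indicator_ball[OF quarter, of y "\<rho>\<^sup>2"]
  have iQ1: "set_integrable lebesgue B (\<lambda>z. (qp z)\<^sup>2 * indicat_real {z. ?\<Psi> z = 1} z)"
  proof -
    have "closed {z. ?\<Psi> z = 1}"
      by (rule closed_Collect_eq[OF smooth_continuous_on[OF test_function_smooth[OF t]] continuous_on_const])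
    then have o: "{z. ?\<Psi> z = 1} \<in> sets lebesgue" by auto
    show ?thesis
      using integrable_mult_indicator[OF o q[unfolded set_integrable_def]]
      by (simp add: set_integrable_def mult_ac)
  qed
  have "\<rho>\<^sup>2 * ((1/4) ^ CARD('n) * V) = (LINT z:B|lebesgue. \<rho>\<^sup>2 * indicat_real (ball y (1/4 * d)) z)"
    unfolding iq(2) by (subst measure_ball_scale) auto
  also have "\<dots> \<le> (LINT z:B|lebesgue. (qp z)\<^sup>2 * indicat_real {z. ?\<Psi> z = 1} z)"
  proof (rule set_integral_mono[OF iq(1) iQ1])
    fix z assume z: "z \<in> B"
    show "\<rho>\<^sup>2 * indicat_real (ball y (1/4 * d)) z \<le> (qp z)\<^sup>2 * indicat_real {z. ?\<Psi> z = 1} z"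
    proof (cases "z \<in> ball y (1/4 * d)")
      case True
      then have "s z < (1/4)\<^sup>2" using s_less_iff[of "1/4" z] by simp
      then have "s z \<le> 1/16" by (simp add: power2_eq_square)
      then have "?\<Psi> z = 1" using \<psi>(4) by (simp add: radial_def s_def)
      moreover have "\<rho>\<^sup>2 \<le> (qp z)\<^sup>2" using \<rho>(1) \<rho>(2)[OF z] by (rule power_mono[rotated])
      ultimately show ?thesis using True by simp
    qed simp
  qed
  also have "\<dots> \<le> \<epsilon> * (A + Q) + \<tau> * A + (1 / \<tau> + 1) * (LINT z:B|lebesgue. (u' z * norm (grad ?\<Psi> z))\<^sup>2)"
    by (rule vanishing_competitor[OF t _ _ \<open>0 < \<tau>\<close>]) (use \<psi>(3) in \<open>auto simp: radial_def\<close>)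
  also have "(LINT z:B|lebesgue. (u' z * norm (grad ?\<Psi> z))\<^sup>2) \<le> 2 * L * (2 * C)\<^sup>2 * (I / d)"
  proof -
    have iP: "set_integrable lebesgue B (\<lambda>z. (u' z * norm (grad ?\<Psi> z))\<^sup>2)"
      by (intro set_integrable_continuous continuous_intros continuous_on_grad test_function_smooth[OF t] cont_u')
    note ia = set_integrable_cmult[OF annulus_integrable, of "2 * L * (2 * C)\<^sup>2 / d"]
    have "(LINT z:B|lebesgue. (u' z * norm (grad ?\<Psi> z))\<^sup>2)
      \<le> (LINT z:B|lebesgue. 2 * L * (2 * C)\<^sup>2 / d * (u' z * indicat_real {1/16..1/4} (s z)))"
    proof (rule set_integral_mono[OF iP ia])
      fix z assume z: "z \<in> B"
      then have nz: "norm (z - y) \<le> d" by (simp add: dist_norm norm_minus_commute)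
      show "(u' z * norm (grad ?\<Psi> z))\<^sup>2 \<le> 2 * L * (2 * C)\<^sup>2 / d * (u' z * indicat_real {1/16..1/4} (s z))"
      proof (cases "s z \<in> {1/16..1/4}")
        case True
        have "norm (grad ?\<Psi> z) = 2 * \<bar>\<psi>' (s z)\<bar> * norm (z - y) / d\<^sup>2"
          unfolding g by (simp add: abs_mult)
        also have "\<dots> \<le> 2 * C * d / d\<^sup>2"
          using \<psi>(7) nz C0 d(1) by (intro divide_right_mono mult_mono) auto
        also have "\<dots> = 2 * C / d" using d(1) by (simp add: power2_eq_square)
        finally have "(norm (grad ?\<Psi> z))\<^sup>2 \<le> (2 * C / d)\<^sup>2" by (intro power_mono) auto
        moreover have "u' z \<le> 2 * L * d" using u'_le[OF nz] uy by simp
        \<comment> \<open>One factor of \<open>u\<close> is estimated by 2 L d and the other is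
          kept, which turns the quadratic cost into the linear quantity \<open>I\<close>.\<close>
        then have "(u' z)\<^sup>2 \<le> u' z * (2 * L * d)"
          unfolding power2_eq_square using u'_pos[OF z] by (intro mult_left_mono) auto
        ultimately have "(u' z)\<^sup>2 * (norm (grad ?\<Psi> z))\<^sup>2 \<le> (u' z * (2 * L * d)) * (2 * C / d)\<^sup>2"
          using u'_pos[OF z] L_nonneg d(1) by (intro mult_mono) auto
        also have "\<dots> = 2 * L * (2 * C)\<^sup>2 / d * u' z"
          using d(1) by (simp add: power2_eq_square field_simps)
        finally show ?thesis using True by (simp add: power_mult_distrib)
      next
        case False
        then show ?thesis using \<psi>(6) by (simp add: g)
      qed
    qed
    also have "\<dots> = 2 * L * (2 * C)\<^sup>2 * (I / d)"
      unfolding set_integral_mult_right I_def by simp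
    finally show ?thesis .
  qed
  finally show ?thesis using \<open>0 < \<tau>\<close> by (simp add: mult_left_mono)
qed

end

section \<open>Nondegeneracy\<close>

text \<open>Both strict signs are open conditions: a positive value would put \<open>x\<close> in
  the interior of the positivity set, a negative one outside its closure.\<close>

lemma free_boundary_zero:
  assumes "open \<Omega>" "continuous_on \<Omega> u" "x \<in> free_boundary \<Omega> u"
  shows "x \<in> \<Omega>" "u x = 0"
proof -
  let ?S = "{z \<in> \<Omega>. u z > 0}"
  have op: "open {z \<in> \<Omega>. u z > 0}" "open {z \<in> \<Omega>. u z < 0}"
    using continuous_open_preimage[OF assms(2,1) open_greaterThan[of 0]]
      continuous_open_preimage[OF assms(2,1) open_lessThan[of 0]]
    by (simp_all add: vimage_def Int_def conj_commute)
  show x: "x \<in> \<Omega>" using assms(3) by (simp add: free_boundary_def)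
  have f: "x \<in> closure ?S" "x \<notin> interior ?S" using assms(3) by (auto simp: free_boundary_def frontier_def)
  have "\<not> 0 < u x" using f(2) x interior_open[OF op(1)] by auto
  moreover have "\<not> u x < 0"
  proof
    assume "u x < 0"
    then have "x \<in> {z \<in> \<Omega>. u z < 0}" using x by simp
    then have "{z \<in> \<Omega>. u z < 0} \<inter> ?S \<noteq> {}"
      using f(1) open_Int_closure_eq_empty[OF op(2), of ?S] by blast
    then show False by auto
  qed
  ultimately show "u x = 0" by linarith
qed

text \<open>Projection onto a closed ball does not increase distances, so composing with it extends
  \<open>u\<close> to the whole space with the same constant.\<close>

lemma lipschitz_closest_point:
  fixes u :: "'a::euclidean_space \<Rightarrow> real"
  assumes "L-lipschitz_on (cball y r) u" "0 \<le> r"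
  shows "L-lipschitz_on UNIV (\<lambda>z. u (closest_point (cball y r) z))"
proof (rule lipschitz_onI)
  fix p q :: 'a
  have ne: "cball y r \<noteq> {}" using assms(2) by simp
  have "dist (u (closest_point (cball y r) p)) (u (closest_point (cball y r) q))
      \<le> L * dist (closest_point (cball y r) p) (closest_point (cball y r) q)"
    by (rule lipschitz_onD[OF assms(1)]) (intro closest_point_in_set closed_cball ne)+
  also have "\<dots> \<le> L * dist p q"
    by (intro mult_left_mono closest_point_lipschitz convex_cball closed_cball ne lipschitz_on_nonneg[OF assms(1)])
  finally show "dist (u (closest_point (cball y r) p)) (u (closest_point (cball y r) q)) \<le> L * dist p q" .
qed (rule lipschitz_on_nonneg[OF assms(1)])

text \<open>By connectedness a continuous function without zeros keeps one sign on the ball, and the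
  value at the centre fixes which.\<close>

lemma positive_on_zero_free_ball:
  fixes u :: "'a::euclidean_space \<Rightarrow> real"
  assumes "continuous_on (ball y d) u" "\<And>z. z \<in> ball y d \<Longrightarrow> u z \<noteq> 0" "0 \<le> u y" "z \<in> ball y d"
  shows "0 < u z"
proof (rule ccontr)
  assume "\<not> 0 < u z"
  then have "u z \<le> 0" by simp
  have y: "y \<in> ball y d" using assms(4) by (auto intro: le_less_trans[OF zero_le_dist])
  have "connected (u ` ball y d)"
    by (intro connected_continuous_image assms(1) connected_ball)
  then have "0 \<in> u ` ball y d"
    using connected_contains_Icc[of "u ` ball y d" "u z" "u y"] \<open>u z \<le> 0\<close> assms(3,4) y by auto
  then show False using assms(2) by auto
qed

lemma almost_minimizer_K_loc:
  "almost_minimizer_J \<Omega> qp qm \<kappa> \<alpha> u \<or> almost_minimizer_J_plus \<Omega> qp \<kappa> \<alpha> u \<Longrightarrow> K_loc \<Omega> u"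
  by (auto simp: almost_minimizer_J_def almost_minimizer_J_plus_def K_loc_plus_def)

lemma Linf_norm_AE:
  assumes "open \<Omega>" "Linf_norm \<Omega> q = ennreal M" "0 \<le> M"
  shows "AE z in lebesgue. z \<in> \<Omega> \<longrightarrow> \<bar>q z\<bar> \<le> M"
proof -
  have "AE z in lebesgue_on \<Omega>. ennreal \<bar>q z\<bar> \<le> ennreal M"
    using esssup_AE[of "\<lambda>z. ennreal \<bar>q z\<bar>" "lebesgue_on \<Omega>"] assms(2) by (simp add: Linf_norm_def)
  moreover have "\<Omega> \<in> sets lebesgue" using assms(1) by auto
  ultimately show ?thesis
    using assms(3) by (simp add: AE_restrict_space_iff)
qed

lemma set_integrable_ball_sq:
  assumes "open \<Omega>" "q \<in> borel_measurable (lebesgue_on \<Omega>)" "Linf_norm \<Omega> q = ennreal M" "0 \<le> M" "ball y d \<subseteq> \<Omega>"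
  shows "set_integrable lebesgue (ball y d) (\<lambda>z. (q z)\<^sup>2)"
    and "(LINT z:ball y d|lebesgue. (q z)\<^sup>2) \<le> M\<^sup>2 * measure lebesgue (ball y d)"
proof -
  have b: "AE z in lebesgue. z \<in> ball y d \<longrightarrow> \<bar>(q z)\<^sup>2\<bar> \<le> M\<^sup>2"
    using Linf_norm_AE[OF assms(1,3,4)]
  proof eventually_elim
    case (elim z)
    show ?case
    proof
      assume "z \<in> ball y d"
      then have "\<bar>q z\<bar> \<le> M" using elim assms(5) by blast
      then have "\<bar>q z\<bar>\<^sup>2 \<le> M\<^sup>2" by (intro power_mono) auto
      then show "\<bar>(q z)\<^sup>2\<bar> \<le> M\<^sup>2" by simp
    qed
  qed
  have "(\<lambda>z. indicat_real \<Omega> z *\<^sub>R q z) \<in> borel_measurable lebesgue"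
    using assms(1,2) by (subst (asm) borel_measurable_restrict_space_iff) auto
  then have "(\<lambda>z. indicat_real (ball y d) z * (indicat_real \<Omega> z *\<^sub>R q z)\<^sup>2) \<in> borel_measurable lebesgue"
    by (intro borel_measurable_times borel_measurable_indicator borel_measurable_power) auto
  also have "(\<lambda>z. indicat_real (ball y d) z * (indicat_real \<Omega> z *\<^sub>R q z)\<^sup>2) = (\<lambda>z. indicat_real (ball y d) z * (q z)\<^sup>2)"
  proof
    fix z show "indicat_real (ball y d) z * (indicat_real \<Omega> z *\<^sub>R q z)\<^sup>2 = indicat_real (ball y d) z * (q z)\<^sup>2"
      using assms(5) by (cases "z \<in> ball y d") auto
  qed
  finally show i: "set_integrable lebesgue (ball y d) (\<lambda>z. (q z)\<^sup>2)"
    using b by (rule set_integrable_ball_bounded)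
  show "(LINT z:ball y d|lebesgue. (q z)\<^sup>2) \<le> M\<^sup>2 * measure lebesgue (ball y d)"
    by (rule set_integral_ball_le_const[OF i]) (use b in simp)
qed

section \<open>Choice of the constants and conclusion\<close>

text \<open>The error splits into four terms, each of which receives the share m/4: \<open>a\<close>
  handles the Lipschitz part of the core, \<eta> the value at the centre, \<open>t\<close> the
  quadratic term, and \<open>e\<close> the failure of exact minimality. Each choice may depend on
  the preceding ones only. The statement is uniform in e' \<le> e because the actual relative error
  depends on \<open>d\<close>.\<close>

lemma nondegeneracy_constants:
  fixes n L D c E \<sigma> K :: real and N :: nat
  assumes "2 \<le> n" "n = real N" "\<sigma> = n / 2 - 3 / 4" "1 \<le> L" "0 < m" "0 < D" "0 \<le> K"
  obtains a \<eta> t e where "0 < a" "a \<le> 1 / (64 * n)" "0 < \<eta>" "\<eta> \<le> 1" "0 < t" "0 < e"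
    "\<And>e'. 0 \<le> e' \<Longrightarrow> e' \<le> e \<Longrightarrow> e' * K / (2 * t) + t / 2 * (2 * (\<sigma> * a powr (- \<sigma> - 1)))\<^sup>2
      + \<sigma> * (2 * n * a) * a powr (- \<sigma> - 2) * (\<eta> + L * sqrt (2 * n * a)) * sqrt (2 * n * a) ^ N \<le> m"
    "e * K \<le> D"
proof -
  have n: "0 < n" and \<sigma>: "0 < \<sigma>" using assms by auto
  define k where "k = \<sigma> * (2 * n) powr (n / 2 + 1)"
  have k: "0 < k" using \<sigma> n by (simp add: k_def)
  \<comment> \<open>The Lipschitz part of the core equals k L sqrt (2 n) times a powr (1/4), and
    \<open>w\<close> is the size of a powr (1/4) at which it reaches m/4. Hence the bound w powr 4
    on \<open>a\<close> below.\<close>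
  define w where "w = m / (4 * (k * L * sqrt (2 * n)))"
  have w: "0 < w" using assms k n by (simp add: w_def)
  define a where "a = min (1 / (64 * n)) (w powr 4)"
  have a: "0 < a" "a \<le> 1 / (64 * n)" using n w by (auto simp: a_def)
  have aw: "a powr (1/4) \<le> w"
  proof -
    have "a powr (1/4) \<le> (w powr 4) powr (1/4)" using a by (intro powr_mono2) (auto simp: a_def)
    also have "\<dots> = w" using w by (simp add: powr_powr del: powr_numeral)
    finally show ?thesis .
  qed
  define b where "b = sqrt (2 * n * a)"
  have b: "0 < b" using n a by (simp add: b_def)
  define C3 where "C3 = \<sigma> * (2 * n * a) * a powr (- \<sigma> - 2)"
  have C3: "0 < C3" using \<sigma> n a by (simp add: C3_def)
  \<comment> \<open>The mass of the core grows only like \<open>a powr (-1/4)\<close>, which loses against \<open>b = O(a powr (1/2))\<close>.\<close>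
  have Cb: "C3 * b ^ N = k * a powr (- 1 / 4)"
  proof -
    have "b ^ N = ((2 * n * a) powr (1/2)) powr n"
      using b n a by (simp add: b_def powr_half_sqrt assms(2) powr_realpow)
    also have "\<dots> = (2 * n) powr (n / 2) * a powr (n / 2)"
      using n a by (simp add: powr_powr powr_mult)
    finally have "C3 * b ^ N = \<sigma> * ((2 * n) powr 1 * (2 * n) powr (n / 2)) * (a powr 1 * a powr (- \<sigma> - 2) * a powr (n / 2))"
      using n a by (simp add: C3_def)
    also have "\<dots> = \<sigma> * (2 * n) powr (1 + n / 2) * a powr (1 + (- \<sigma> - 2) + n / 2)"
      by (simp only: powr_add)
    also have "1 + (- \<sigma> - 2) + n / 2 = - 1 / 4" by (simp add: assms(3))
    finally show ?thesis by (simp add: k_def add.commute)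
  qed
  have T4: "C3 * (L * b) * b ^ N \<le> m / 4"
  proof -
    have "b = sqrt (2 * n) * a powr (1/2)" using a by (simp add: b_def real_sqrt_mult powr_half_sqrt)
    then have "C3 * (L * b) * b ^ N = (C3 * b ^ N) * (L * (sqrt (2 * n) * a powr (1/2)))" by simp
    also have "\<dots> = k * L * sqrt (2 * n) * (a powr (- 1 / 4) * a powr (1/2))" by (simp add: Cb)
    also have "a powr (- 1 / 4) * a powr (1/2) = a powr (1/4)" by (simp flip: powr_add)
    also have "k * L * sqrt (2 * n) * a powr (1/4) \<le> k * L * sqrt (2 * n) * w"
      using aw k n assms(4) by (intro mult_left_mono) auto
    also have "\<dots> = m / 4" using k n assms(4) by (simp add: w_def)
    finally show ?thesis .
  qed
  \<comment> \<open>With \<open>a\<close> fixed, the mass of the core is a fixed number, and \<eta>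
    is small against its inverse.\<close>
  define \<eta> where "\<eta> = min 1 (m / (4 * (C3 * b ^ N)))"
  have Cbp: "0 < C3 * b ^ N" using C3 b by simp
  have \<eta>: "0 < \<eta>" "\<eta> \<le> 1" using Cbp assms(5) by (auto simp: \<eta>_def)
  have T3: "C3 * \<eta> * b ^ N \<le> m / 4"
  proof -
    have "\<eta> \<le> m / (4 * (C3 * b ^ N))" by (simp add: \<eta>_def)
    then have "\<eta> * (4 * (C3 * b ^ N)) \<le> m" using Cbp by (subst (asm) pos_le_divide_eq) auto
    then show ?thesis by (simp add: mult_ac)
  qed
  define X where "X = (2 * (\<sigma> * a powr (- \<sigma> - 1)))\<^sup>2"
  have X: "0 < X" using \<sigma> a by (simp add: X_def)
  \<comment> \<open>Chosen so that the quadratic term is exactly m/4.\<close>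
  define t where "t = m / (2 * X)"
  have t: "0 < t" using X assms(5) by (simp add: t_def)
  have T2: "t / 2 * X = m / 4" using X by (simp add: t_def)
  \<comment> \<open>The first entry treats the term divided by \<open>t\<close>, the second the
    condition e K \<le> D; K + 1 keeps the denominators positive when K = 0.\<close>
  define e where "e = min (m * t / (2 * (K + 1))) (D / (K + 1))"
  have e: "0 < e" using t assms by (simp add: e_def)
  have eD: "e * K \<le> D"
  proof -
    have "e * K \<le> e * (K + 1)" using e by simp
    also have "\<dots> \<le> D" using assms(7) by (simp add: e_def pos_le_divide_eq[symmetric])
    finally show ?thesis .
  qed
  have T1: "e' * K / (2 * t) \<le> m / 4" if "0 \<le> e'" "e' \<le> e" for e'
  proof -
    have "e' * K \<le> e * (K + 1)" using that assms(7) by (intro mult_mono) auto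
    also have "\<dots> \<le> m * t / 2"
    proof -
      have "e \<le> m * t / (2 * (K + 1))" by (simp add: e_def)
      then have "e * (2 * (K + 1)) \<le> m * t" using assms(7) by (subst (asm) pos_le_divide_eq) auto
      then show ?thesis by (simp add: ring_distribs)
    qed
    finally show ?thesis using t by (simp add: divide_le_eq mult_ac)
  qed
  show thesis
  proof (rule that[OF a \<eta> t e _ eD])
    fix e' assume "0 \<le> e'" "e' \<le> e"
    note T1 = T1[OF this]
    have "C3 * (\<eta> + L * b) * b ^ N = C3 * \<eta> * b ^ N + C3 * (L * b) * b ^ N" by (simp add: ring_distribs)
    then have "e' * K / (2 * t) + t / 2 * X + C3 * (\<eta> + L * b) * b ^ N \<le> m"
      using T1 T2 T3 T4 by linarith
    then show "e' * K / (2 * t) + t / 2 * (2 * (\<sigma> * a powr (- \<sigma> - 1)))\<^sup>2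
      + \<sigma> * (2 * n * a) * a powr (- \<sigma> - 2) * (\<eta> + L * sqrt (2 * n * a)) * sqrt (2 * n * a) ^ N \<le> m"
      unfolding X_def b_def C3_def .
  qed
qed

text \<open>The constants precede \<Omega>, the weights and \<open>u\<close>, so they depend only on
  the numbers fixed in front and on the dimension. Continuity selects the continuous representative.
  An almost minimizer for \<open>J\<close> may be negative at \<open>y\<close>; its positive part
  vanishes there although the distance to the zero set is positive, so the bound is asserted where
  \<open>u\<close> is nonnegative.\<close>

theorem theorem10p2:
  fixes \<rho>\<^sub>0 L \<kappa> \<alpha> Mp Mm :: real
  assumes "CARD('n::finite) \<ge> 2"
    and "0 < \<rho>\<^sub>0" and "1 \<le> L"
    and "0 < \<kappa>" and "0 < \<alpha>" and "\<alpha> \<le> 1"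
    and "0 \<le> Mp" and "0 \<le> Mm"
  shows "\<exists>\<eta>\<^sub>0>0. \<exists>r\<^sub>1>0. \<forall>(\<Omega> :: (real^'n) set) qp qm u.
    open \<Omega> \<longrightarrow>
    qp \<in> borel_measurable (lebesgue_on \<Omega>) \<longrightarrow> Linf_norm \<Omega> qp = ennreal Mp \<longrightarrow>
    qm \<in> borel_measurable (lebesgue_on \<Omega>) \<longrightarrow> Linf_norm \<Omega> qm = ennreal Mm \<longrightarrow>
    continuous_on \<Omega> u \<longrightarrow>
    almost_minimizer_J \<Omega> qp qm \<kappa> \<alpha> u \<or> almost_minimizer_J_plus \<Omega> qp \<kappa> \<alpha> u \<longrightarrow>
    (\<forall>x\<in>free_boundary \<Omega> u. \<forall>r.
       0 < r \<and> r \<le> r\<^sub>1 \<and> cball x r \<subseteq> \<Omega> \<and> L-lipschitz_on (ball x r) u \<and>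
       (\<forall>y\<in>ball x r. qp y \<ge> \<rho>\<^sub>0) \<longrightarrow>
       (\<forall>y\<in>ball x (r/2). 0 \<le> u y \<longrightarrow> max (u y) 0 \<ge> \<eta>\<^sub>0 * zero_dist \<Omega> u y / 4))"
proof -
  let ?N = "CARD('n)"
  define n where "n = real ?N"
  define \<sigma> where "\<sigma> = n / 2 - 3 / 4"
  have n2: "2 \<le> n" using assms(1) by (simp add: n_def)
  have \<sigma>: "0 < \<sigma>" using n2 by (simp add: \<sigma>_def)
  obtain c where c: "0 < c" and prof: "\<forall>a. 0 < a \<and> a \<le> 1 / (64 * n) \<longrightarrow> (\<exists>F F' F''. (\<forall>k. Ck_real k {- a<..} F) \<and>
      (\<forall>s\<ge>0. (F has_real_derivative F' s) (at s) \<and> (F' has_real_derivative F'' s) (at s)) \<and>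
      (\<forall>s. 0 \<le> F s) \<and> (\<forall>s\<ge>3/4. F s = 0) \<and> (\<forall>s\<ge>0. \<bar>F' s\<bar> \<le> \<sigma> * a powr (- \<sigma> - 1)) \<and>
      (\<forall>s\<ge>0. c * indicat_real {1/16..1/4} s
          - \<sigma> * (2 * n * a) * a powr (- \<sigma> - 2) * indicat_real {..<2 * n * a} s \<le> 4 * s * F'' s + 2 * n * F' s))"
    unfolding \<sigma>_def by (rule superharmonic_test_profile[OF n2])
  obtain \<psi> \<psi>' :: "real \<Rightarrow> real" and C where \<psi>: "\<forall>k. Ck_real k UNIV \<psi>"
    "\<forall>s. (\<psi> has_real_derivative \<psi>' s) (at s)" "\<forall>s. 0 \<le> \<psi> s \<and> \<psi> s \<le> 1"
    "\<forall>s\<le>1/16. \<psi> s = 1" "\<forall>s\<ge>1/4. \<psi> s = 0" "\<forall>s. s \<notin> {1/16..1/4} \<longrightarrow> \<psi>' s = 0" "\<forall>s. \<bar>\<psi>' s\<bar> \<le> C" and C: "0 < C"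
    by (rule cutoff_profile)
  \<comment> \<open>D V is the least energy saved on the ball of radius d/4, where V is the volume
    of the ball of radius \<open>d\<close>. The constants \<tau>, \<open>m\<close> and
    \<open>e\<close> give each of the three error terms at most a quarter of it, hence a
    contradiction.\<close>
  define D where "D = \<rho>\<^sub>0\<^sup>2 * (1/4) ^ ?N"
  have D: "0 < D" using assms(2) by (simp add: D_def)
  define \<tau> where "\<tau> = D / (4 * L\<^sup>2)"
  have \<tau>: "0 < \<tau>" using D assms(3) by (simp add: \<tau>_def)
  define Y where "Y = (1 / \<tau> + 1) * (2 * L * (2 * C)\<^sup>2)"
  have Y: "0 < Y" using \<tau> C assms(3) by (simp add: Y_def add_pos_pos)
  define m where "m = D / (4 * Y)"
  have m: "0 < m" using D Y by (simp add: m_def)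
  \<comment> \<open>The Lipschitz bound and the bound on the weight give A + Q \<le> K V.\<close>
  define K where "K = L\<^sup>2 + Mp\<^sup>2"
  have K: "0 \<le> K" by (simp add: K_def)
  have D4: "0 < D / 4" and cm: "0 < c * m" using D c m by auto
  obtain a \<eta> t e where a: "0 < a" "a \<le> 1 / (64 * n)" and \<eta>: "0 < \<eta>" "\<eta> \<le> 1" and t: "0 < t" and e: "0 < e"
    and small: "\<And>e'. 0 \<le> e' \<Longrightarrow> e' \<le> e \<Longrightarrow> e' * K / (2 * t) + t / 2 * (2 * (\<sigma> * a powr (- \<sigma> - 1)))\<^sup>2
      + \<sigma> * (2 * n * a) * a powr (- \<sigma> - 2) * (\<eta> + L * sqrt (2 * n * a)) * sqrt (2 * n * a) ^ ?N \<le> c * m"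
    and eK: "e * K \<le> D / 4"
    using nondegeneracy_constants[OF n2 n_def \<sigma>_def assms(3) cm D4 K] by metis
  obtain F F' F'' where F: "\<forall>k. Ck_real k {- a<..} F"
      "\<forall>s\<ge>0. (F has_real_derivative F' s) (at s) \<and> (F' has_real_derivative F'' s) (at s)"
      "\<forall>s. 0 \<le> F s" "\<forall>s\<ge>3/4. F s = 0" "\<forall>s\<ge>0. \<bar>F' s\<bar> \<le> \<sigma> * a powr (- \<sigma> - 1)"
      "\<forall>s\<ge>0. c * indicat_real {1/16..1/4} s
          - \<sigma> * (2 * n * a) * a powr (- \<sigma> - 2) * indicat_real {..<2 * n * a} s \<le> 4 * s * F'' s + 2 * n * F' s"
    using prof a by metis
  define b where "b = sqrt (2 * n * a)"
  have b2: "b\<^sup>2 = 2 * n * a" using n2 a by (simp add: b_def)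
  have b: "0 \<le> b" "b \<le> 1"
  proof -
    show "0 \<le> b" using n2 a by (simp add: b_def)
    have "2 * n * a \<le> 1" using a n2 by (simp add: field_simps)
    then show "b \<le> 1" by (simp add: b_def)
  qed
  define C3 where "C3 = \<sigma> * (2 * n * a) * a powr (- \<sigma> - 2)"
  have C3: "0 \<le> C3" using \<sigma> n2 a by (simp add: C3_def)
  \<comment> \<open>The radius at which \<kappa> r powr \<alpha> reaches \<open>e\<close>.\<close>
  define r\<^sub>1 where "r\<^sub>1 = (e / \<kappa>) powr (1 / \<alpha>)"
  have r1: "0 < r\<^sub>1" using e assms(4) by (simp add: r\<^sub>1_def)
  have small_radius: "\<kappa> * d powr \<alpha> \<le> e" if "0 \<le> d" "d \<le> r\<^sub>1" for d
  proof -
    have "d powr \<alpha> \<le> r\<^sub>1 powr \<alpha>" using that assms(5) by (intro powr_mono2) auto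
    also have "\<dots> = e / \<kappa>" using assms(4,5) e by (simp add: r\<^sub>1_def powr_powr)
    finally show ?thesis using assms(4) by (simp add: field_simps)
  qed
  have main: "\<eta> * d / 4 \<le> max (u y) 0"
    if \<Omega>: "open \<Omega>" and qp: "qp \<in> borel_measurable (lebesgue_on \<Omega>)" "Linf_norm \<Omega> qp = ennreal Mp"
      and u: "continuous_on \<Omega> u"
      and am: "almost_minimizer_J \<Omega> qp qm \<kappa> \<alpha> u \<or> almost_minimizer_J_plus \<Omega> qp \<kappa> \<alpha> u"
      and x: "x \<in> free_boundary \<Omega> u"
      and r: "0 < r" "r \<le> r\<^sub>1" "cball x r \<subseteq> \<Omega>" and L: "L-lipschitz_on (ball x r) u"
      and \<rho>: "\<forall>y\<in>ball x r. qp y \<ge> \<rho>\<^sub>0" and y: "y \<in> ball x (r/2)" "0 \<le> u y"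
      and d_def: "d = zero_dist \<Omega> u y"
    for \<Omega> :: "(real^'n) set" and qp qm u x r y d
  proof (rule ccontr)
    assume neg: "\<not> \<eta> * d / 4 \<le> max (u y) 0"
    have dpos: "0 < d"
    proof (rule ccontr)
      assume "\<not> 0 < d"
      then have "\<eta> * d / 4 \<le> 0" using \<eta> by (simp add: mult_nonneg_nonpos)
      then show False using neg by simp
    qed
    have uy: "u y \<le> \<eta> * d" using neg \<eta> dpos by (auto simp: max_def split: if_splits)
    note x0 = free_boundary_zero[OF \<Omega> u x]
    have xz: "x \<in> {z \<in> \<Omega>. u z = 0}" using x0 by simp
    \<comment> \<open>The point \<open>x\<close> is itself a zero of \<open>u\<close>, so d \<le> |y
      - x| < r/2 and the ball of radius \<open>d\<close> about \<open>y\<close> stays inside the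
      given one.\<close>
    have dx: "d \<le> dist y x" unfolding d_def zero_dist_def by (rule infdist_le[OF xz])
    have yx: "dist y x < r / 2" using y(1) by (simp add: dist_commute)
    \<comment> \<open>The midpoint between \<open>d\<close> and the distance of \<open>y\<close>
      from the sphere about \<open>x\<close>. It leaves room on both sides: for mollification beyond
      radius \<open>d\<close>, and for a closed ball on which \<open>u\<close> is Lipschitz.\<close>
    define r' where "r' = (d + (r - dist y x)) / 2"
    have r': "d < r'" "r' < r - dist y x" using dx yx by (auto simp: r'_def)
    have sub1: "cball y r' \<subseteq> ball x r"
    proof
      fix z assume "z \<in> cball y r'"
      then show "z \<in> ball x r" using r' dist_triangle[of x z y] by (auto simp: dist_commute)
    qed
    have sub2: "ball x r \<subseteq> \<Omega>" using r(3) ball_subset_cball by blast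
    have B: "ball y d \<subseteq> ball x r" "cball y d \<subseteq> \<Omega>" "ball y r' \<subseteq> \<Omega>" "ball y d \<subseteq> \<Omega>"
      using sub1 sub2 r' by (auto simp: subset_iff)
    have nz: "u z \<noteq> 0" if "z \<in> ball y d" for z
    proof
      assume "u z = 0"
      then have "z \<in> {z \<in> \<Omega>. u z = 0}" using that B(4) by auto
      then have "d \<le> dist y z" unfolding d_def zero_dist_def by (rule infdist_le)
      then show False using that by simp
    qed
    have pos: "0 < u z" if "z \<in> ball y d" for z
      by (rule positive_on_zero_free_ball[OF continuous_on_subset[OF u B(4)] nz y(2) that])
    define u' where "u' = (\<lambda>z. u (closest_point (cball y r') z))"
    obtain G where G: "has_weak_gradient \<Omega> u G"
      using almost_minimizer_K_loc[OF am] by (auto simp: K_loc_def)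
    note qi = set_integrable_ball_sq[OF \<Omega> qp assms(7) B(4)]
    have eq: "u' z = u z" if "z \<in> ball y r'" for z
      using that by (simp add: u'_def closest_point_self)
    interpret positive_almost_minimizer u u' G y d r' L \<Omega> qp qm \<kappa> \<alpha>
    proof
      show "0 < d" "d < r'" by fact+
      show "has_weak_gradient (ball y r') u G" by (rule has_weak_gradient_subset[OF G B(3)])
      show "L-lipschitz_on UNIV u'"
        unfolding u'_def using lipschitz_on_subset[OF L sub1] dpos r' by (intro lipschitz_closest_point) auto
      show "almost_minimizer_J \<Omega> qp qm \<kappa> \<alpha> u \<or> almost_minimizer_J_plus \<Omega> qp \<kappa> \<alpha> u" by (rule am)
    qed (use eq B assms(4) pos qi in auto)
    have u'y: "u' y = u y" using eq[of y] dpos r' by simp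
    have \<epsilon>: "\<epsilon> \<le> e"
      unfolding \<epsilon>_def using dpos dx yx r by (intro small_radius) auto
    have AQ: "A + Q \<le> K * V"
      using A_le qi(2) by (simp add: Q_def K_def V_def ring_distribs)
    have eAQ: "\<epsilon> * (A + Q) \<le> (\<epsilon> * K) * V"
      using mult_left_mono[OF AQ \<epsilon>_nonneg] by (simp add: mult.assoc)
    have "c * (I / d) \<le> \<epsilon> * (A + Q) / (2 * t) + t / 2 * ((2 * (\<sigma> * a powr (- \<sigma> - 1)))\<^sup>2 * V) + C3 * (\<eta> + L * b) * (b ^ ?N * V)"
    proof (rule annulus_integral_le[OF F(1) _ F(2,3,4,5) _ C3 b _ t])
      show "{0..} \<subseteq> {- a<..}" using a by auto
      show "\<forall>s\<ge>0. c * indicat_real {1/16..1/4} s - C3 * indicat_real {..<b\<^sup>2} s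
        \<le> 4 * s * F'' s + 2 * real CARD('n) * F' s"
        using F(6) unfolding C3_def b2 n_def .
      show "u' y \<le> \<eta> * d" using uy u'y by simp
    qed
    also have "\<dots> \<le> (\<epsilon> * K) * V / (2 * t) + t / 2 * ((2 * (\<sigma> * a powr (- \<sigma> - 1)))\<^sup>2 * V) + C3 * (\<eta> + L * b) * (b ^ ?N * V)"
      using eAQ t by (intro add_mono divide_right_mono) auto
    also have "\<dots> = (\<epsilon> * K / (2 * t) + t / 2 * (2 * (\<sigma> * a powr (- \<sigma> - 1)))\<^sup>2 + C3 * (\<eta> + L * b) * b ^ ?N) * V"
      by (simp add: ring_distribs)
    also have "\<dots> \<le> (c * m) * V"
      using small[OF \<epsilon>_nonneg \<epsilon>] V_pos unfolding C3_def b_def by (intro mult_right_mono) auto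
    finally have "c * (I / d) \<le> c * (m * V)" by (simp only: mult.assoc)
    \<comment> \<open>First half of the argument: smallness of u(y) has become smallness of the
      average over the annulus.\<close>
    then have I: "I / d \<le> m * V" using c by (simp only: mult_le_cancel_left_pos)
    have "\<rho>\<^sub>0\<^sup>2 * ((1/4) ^ ?N * V) \<le> \<epsilon> * (A + Q) + \<tau> * A + (1 / \<tau> + 1) * (2 * L * (2 * C)\<^sup>2 * (I / d))"
    proof (rule positivity_cost_le[OF \<psi> _ _ _ \<tau>])
      show "0 \<le> \<rho>\<^sub>0" using assms(2) by simp
      show "\<rho>\<^sub>0 \<le> qp z" if "z \<in> ball y d" for z using \<rho> B(1) that by blast
      have "\<eta> * d \<le> L * d" using \<eta>(2) assms(3) dpos by (intro mult_right_mono) auto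
      then show "u' y \<le> L * d" using uy u'y by simp
    qed
    \<comment> \<open>Second half: the saving D V is confronted with three costs of at most D V / 4
      each, while D V is positive.\<close>
    then have "D * V \<le> \<epsilon> * (A + Q) + \<tau> * A + Y * (I / d)" by (simp add: D_def Y_def mult.assoc)
    moreover have "\<epsilon> * (A + Q) \<le> D / 4 * V"
    proof -
      have "\<epsilon> * K \<le> D / 4" using mult_right_mono[OF \<epsilon> K] eK by linarith
      then show ?thesis using eAQ mult_right_mono[of "\<epsilon> * K" "D / 4" V] V_pos by linarith
    qed
    moreover have "\<tau> * A \<le> D / 4 * V"
    proof -
      have "\<tau> * A \<le> \<tau> * (L\<^sup>2 * V)" using A_le \<tau> by (intro mult_left_mono) auto
      also have "\<dots> = D / 4 * V" using assms(3) by (simp add: \<tau>_def)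
      finally show ?thesis .
    qed
    moreover have "Y * (I / d) \<le> D / 4 * V"
    proof -
      have "Y * (I / d) \<le> Y * (m * V)" using I Y by (intro mult_left_mono) auto
      also have "\<dots> = D / 4 * V" using Y by (simp add: m_def)
      finally show ?thesis .
    qed
    moreover have "0 < D * V" using D V_pos by simp
    ultimately show False by linarith
  qed
  show ?thesis
    by (rule exI[of _ \<eta>], intro conjI \<eta>(1), rule exI[of _ r\<^sub>1], intro conjI r1 allI impI ballI)
       (elim conjE, rule main[OF _ _ _ _ _ _ _ _ _ _ _ _ _ refl]; assumption)
qed

end
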